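(* Let $k\ge \ell\ge 1$ be integers with $k+\ell\ge 6$. If $k=\ell$, then $$i(S_{k,\ell})=\frac{(2k+1)!}{2^{2k}(k!)^2}\cdot \max_{\alpha\in[0,1]}\left\{\alpha(1-\alpha)^{2k}+(1-\alpha)\alpha^{2k}\right\}.$$ If $k\ge \ell+1$, then $$i(S_{k,\ell})=\frac{(k+\ell+1)!}{k!\,\ell!}\max_{(\alpha,d)\in[0,\frac12]\times[0,\frac{k}{k+\ell}]}\left\{\alpha(1-\alpha)^{k+\ell}d^k(1-d)^\ell+\frac{(k-1)^{k-1}\ell^\ell}{(k+\ell-1)^{k+\ell-1}}(1-\alpha)\alpha^{k+\ell}(1-d)\right\}.$$
   Context: Digraphs are finite and without loops; $xy$ denotes an arc from $x$ to $y$. For nonnegative integers $k,\ell$, the oriented star $S_{k,\ell}$ is the digraph with a center $c$, $k$ out-leaves $o$ (arcs $co$) and $\ell$ in-leaves $i$ (arcs $ic$), and no other arcs. For digraphs $H,G$, the induced density $i(H,G)$ is the number of induced copies of $H$ in $G$ (i.e. vertex subsets $W$ with $G[W]\cong H$) divided by $\binom{|V(G)|}{|V(H)|}$; $i(H,n)$ is the maximum of $i(H,G)$ over all $n$-vertex digraphs $G$; and the inducibility is $i(H)=\lim_{n\to\infty}i(H,n)$. *)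

theory Defs
  imports Complex_Main
begin

text \<open>A digraph is a finite vertex set V with an arc relation E (pairs (x,y) = arc xy),
  arcs only between vertices of V, and no loops. Opposite arcs xy, yx may both be present.\<close>
definition digraph :: "nat set \<Rightarrow> (nat \<times> nat) set \<Rightarrow> bool" where
  "digraph V E \<longleftrightarrow> finite V \<and> E \<subseteq> V \<times> V \<and> (\<forall>x. (x, x) \<notin> E)"

definition induced_iso ::
  "(nat \<times> nat) set \<Rightarrow> nat set \<Rightarrow> nat set \<Rightarrow> (nat \<times> nat) set \<Rightarrow> bool" where
  "induced_iso E W HV HE \<longleftrightarrow>
     (\<exists>f. bij_betw f W HV \<and> (\<forall>x\<in>W. \<forall>y\<in>W. (x, y) \<in> E \<longleftrightarrow> (f x, f y) \<in> HE))"

text \<open>Oriented star S_{k,l}: centre 0, out-leaves 1..k, in-leaves k+1..k+l.\<close>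
definition star_V :: "nat \<Rightarrow> nat \<Rightarrow> nat set" where
  "star_V k l = {..k + l}"

definition star_E :: "nat \<Rightarrow> nat \<Rightarrow> (nat \<times> nat) set" where
  "star_E k l = {(0, i) | i. 1 \<le> i \<and> i \<le> k} \<union> {(i, 0) | i. k < i \<and> i \<le> k + l}"

definition ind_density ::
  "nat set \<Rightarrow> (nat \<times> nat) set \<Rightarrow> nat set \<Rightarrow> (nat \<times> nat) set \<Rightarrow> real" where
  "ind_density HV HE V E =
     real (card {W. W \<subseteq> V \<and> induced_iso E W HV HE}) / real (card V choose card HV)"

text \<open>i(H,n): maximum over all n-vertex digraphs (vertex set {0..<n} w.l.o.g.).\<close>
definition ind_density_n :: "nat set \<Rightarrow> (nat \<times> nat) set \<Rightarrow> nat \<Rightarrow> real" where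
  "ind_density_n HV HE n = Max {ind_density HV HE {..<n} E | E. digraph {..<n} E}"

end

theory Submission
  imports Defs
begin

text \<open>Give each of the n vertices of an extremal digraph the weight 1/n, and let T be the weighted number of
  stars, s = k + l. Replacing a vertex by a twin of another one changes the number of stars essentially by the
  difference of the numbers of stars through them, so all vertices lie in about the same number of stars, which is (s+1) T on
  average. Now a vertex with strict degree D is the centre of at most a constant times D^s stars, and it
  is a leaf of few stars unless it is joined to vertices of large degree. Comparing with the lower bound for T,
  every vertex has degree either at least 1 - 1.1/(s+1) (the set A) or less than 0.46 (the set B);
  a bootstrap then shows that A has measure a close to 1/(s+1), that almost all pairs between A and B are joined
  by exactly one arc and that B spans few arcs. Stars are then counted by the positions of their centre and their
  leaves: those with centre in A and leaves in B contribute the first term of the maximized function, those with leaves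
  in A the second one, and the loss in the former pays for all others. For l = 1 this last step needs an additional
  argument, as few in-neighbours already suffice for many stars inside B.

  Conversely, bipartite digraphs between A and B with prescribed shares of out- and in-neighbours, realized by residue
  conditions, attain the maximum.\<close>

section \<open>Weighted counts of stars\<close>

text \<open>The two terms of the objective compete for the arcs between A and B: if an out-share d
  of them leaves A, only 1 - d enters it. For k = l both kinds of stars prefer share 1/2 and can be
  bounded separately. For k > l every centre prefers out-share k/(k+l), which both sides cannot
  have. The stars centred in B, as a function of the out-share x of their centre, are governed by
  the concave envelope of x^k (1-x)^l; it starts with the tangent from the origin, which touches at
  (k-1)/(k+l-1) and has slope \<open>kap (k - 1) l\<close>. Hence the coefficient of the second term
  and its linearity in 1 - d, and hence a construction in which only a part of B sends arcs to A.
  The obstacle for l = 1: arcs among the candidate leaves of a centre cost stars, but this loss is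
  detected from an out-leaf if k \<ge> 2 and from an in-leaf only if l \<ge> 2. The decimal
  constants are chosen so that the estimates hold from s = 6 on; decaying terms are replaced by
  their bounds at s = 6, and \<open>ww s\<close> by a number just below 1/e.\<close>

definition adj :: "(nat \<times> nat) set \<Rightarrow> nat \<Rightarrow> nat \<Rightarrow> bool" where
  "adj E u v \<longleftrightarrow> (u, v) \<in> E \<or> (v, u) \<in> E"

text \<open>No induced star contains both ends of a pair of opposite arcs, so only single arcs make
  neighbours.\<close>

definition outs :: "(nat \<times> nat) set \<Rightarrow> nat \<Rightarrow> nat set" where
  "outs E v = {x. (v, x) \<in> E \<and> (x, v) \<notin> E}"

definition ins :: "(nat \<times> nat) set \<Rightarrow> nat \<Rightarrow> nat set" where
  "ins E v = {x. (x, v) \<in> E \<and> (v, x) \<notin> E}"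

definition nb :: "(nat \<times> nat) set \<Rightarrow> nat \<Rightarrow> nat set" where
  "nb E v = outs E v \<union> ins E v"

text \<open>Once v is a leaf, all other leaves lie here. Vertices joined to v by two opposite arcs
  are excluded as well, although they are not in \<open>nb E v\<close>.\<close>

definition far :: "(nat \<times> nat) set \<Rightarrow> nat \<Rightarrow> nat set \<Rightarrow> nat set" where
  "far E v X = {x \<in> X. x \<noteq> v \<and> \<not> adj E v x}"

definition indep :: "(nat \<times> nat) set \<Rightarrow> nat set \<Rightarrow> bool" where
  "indep E X \<longleftrightarrow> (\<forall>x\<in>X. \<forall>y\<in>X. \<not> adj E x y)"

text \<open>For P = \<open>outs E c\<close> and Q = \<open>ins E c\<close> these are the leaf sets
  of the induced stars with centre c. General P and Q allow leaves to be confined to a class and to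
  be fixed one at a time.\<close>

definition sel :: "(nat \<times> nat) set \<Rightarrow> nat \<Rightarrow> nat \<Rightarrow> nat set \<Rightarrow> nat set \<Rightarrow> (nat set \<times> nat set) set" where
  "sel E k l P Q = {(K, L). K \<subseteq> P \<and> L \<subseteq> Q \<and> card K = k \<and> card L = l \<and> indep E (K \<union> L)}"

lemma outs_ins_disjoint: "outs E v \<inter> ins E v = {}"
  by (auto simp: outs_def ins_def)

lemma nb_sym: "x \<in> nb E v \<longleftrightarrow> v \<in> nb E x"
  by (auto simp: nb_def outs_def ins_def)

lemma nb_adj: "x \<in> nb E v \<Longrightarrow> adj E v x"
  by (auto simp: nb_def outs_def ins_def adj_def)

lemma far_subset: "far E v X \<subseteq> X"
  by (auto simp: far_def)

lemma far_mono: "X \<subseteq> Y \<Longrightarrow> far E v X \<subseteq> far E v Y"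
  by (auto simp: far_def)

lemma far_Un: "far E v (X \<union> Y) = far E v X \<union> far E v Y"
  by (auto simp: far_def)

lemma far_Int_nb: "far E v X \<inter> nb E v = {}"
  using nb_adj by (auto simp: far_def)

lemma sel_subset: "sel E k l P Q \<subseteq> Pow P \<times> Pow Q"
  by (auto simp: sel_def)

lemma finite_sel: "finite P \<Longrightarrow> finite Q \<Longrightarrow> finite (sel E k l P Q)"
  by (rule finite_subset[OF sel_subset]) auto

lemma sel_swap: "sel E l k Q P = prod.swap ` sel E k l P Q"
  by (auto simp: sel_def image_iff Un_commute)

lemma card_sel_le:
  assumes "finite P" "finite Q"
  shows "fact k * fact l * card (sel E k l P Q) \<le> card P ^ k * card Q ^ l"
proof -
  have "sel E k l P Q \<subseteq> {K. K \<subseteq> P \<and> card K = k} \<times> {L. L \<subseteq> Q \<and> card L = l}"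
    by (auto simp: sel_def)
  then have "card (sel E k l P Q) \<le> card ({K. K \<subseteq> P \<and> card K = k} \<times> {L. L \<subseteq> Q \<and> card L = l})"
    using assms by (intro card_mono) auto
  also have "\<dots> = (card P choose k) * (card Q choose l)"
    using assms by (simp add: card_cartesian_product n_subsets)
  finally have "fact k * fact l * card (sel E k l P Q) \<le>
      ((card P choose k) * fact k) * ((card Q choose l) * fact l)"
    by (simp add: mult.assoc mult.left_commute mult.commute mult_le_mono)
  also have "\<dots> \<le> card P ^ k * card Q ^ l"
    by (intro mult_le_mono binomial_fact_pow)
  finally show ?thesis .
qed

text \<open>Dropping the known leaf v is injective, and independence puts the other leaves into
  \<open>far E v\<close>.\<close>

lemma card_sel_remove_out:
  assumes "finite P" "finite Q" "P \<inter> Q = {}" "v \<in> P" "k \<ge> 1"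
  shows "card {F \<in> sel E k l P Q. v \<in> fst F} \<le> card (sel E (k - 1) l (far E v P) (far E v Q))"
proof (rule card_inj_on_le[where f = "\<lambda>F. (fst F - {v}, snd F)"])
  show "inj_on (\<lambda>F. (fst F - {v}, snd F)) {F \<in> sel E k l P Q. v \<in> fst F}"
    by (auto simp: inj_on_def)
  show "(\<lambda>F. (fst F - {v}, snd F)) ` {F \<in> sel E k l P Q. v \<in> fst F} \<subseteq>
      sel E (k - 1) l (far E v P) (far E v Q)"
    using assms by (auto simp: sel_def far_def indep_def dest: finite_subset)
  show "finite (sel E (k - 1) l (far E v P) (far E v Q))"
    using assms by (intro finite_sel finite_subset[OF far_subset])
qed

lemma card_sel_remove_in:
  assumes "finite P" "finite Q" "P \<inter> Q = {}" "v \<in> Q" "l \<ge> 1"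
  shows "card {F \<in> sel E k l P Q. v \<in> snd F} \<le> card (sel E k (l - 1) (far E v P) (far E v Q))"
proof -
  have "{F \<in> sel E k l P Q. v \<in> snd F} = prod.swap ` {F \<in> sel E l k Q P. v \<in> fst F}"
    by (auto simp: sel_def image_iff Un_commute)
  then have "card {F \<in> sel E k l P Q. v \<in> snd F} = card {F \<in> sel E l k Q P. v \<in> fst F}"
    by (simp add: card_image)
  also have "\<dots> \<le> card (sel E (l - 1) k (far E v Q) (far E v P))"
    using assms by (intro card_sel_remove_out) auto
  also have "\<dots> = card (sel E k (l - 1) (far E v P) (far E v Q))"
    by (subst sel_swap) (simp add: card_image)
  finally show ?thesis .
qed

lemma card_sel_count_out:
  assumes "finite P" "finite Q"
  shows "k * card (sel E k l P Q) = (\<Sum>v\<in>P. card {F \<in> sel E k l P Q. v \<in> fst F})"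
proof -
  have "(\<Sum>v\<in>P. card {F \<in> sel E k l P Q. v \<in> fst F}) = k * card (sel E k l P Q)"
  proof (rule sum_multicount[of _ _ "\<lambda>v F. v \<in> fst F"])
    show "\<forall>F\<in>sel E k l P Q. card {v \<in> P. v \<in> fst F} = k"
    proof
      fix F assume "F \<in> sel E k l P Q"
      then have "{v \<in> P. v \<in> fst F} = fst F" "card (fst F) = k" by (auto simp: sel_def)
      then show "card {v \<in> P. v \<in> fst F} = k" by simp
    qed
  qed (use assms finite_sel in auto)
  then show ?thesis by simp
qed

locale wdigraph =
  fixes E :: "(nat \<times> nat) set" and V :: "nat set" and r :: real
  assumes digraph: "digraph V E" and r_pos: "r > 0" and r_card: "r * card V = 1"
begin

definition m :: "nat set \<Rightarrow> real" where
  "m X = r * card X"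

text \<open>The factorials turn pairs of sets into ordered choices of leaves, so that free choices
  are bounded by \<open>m P ^ k * m Q ^ l\<close> without further constants.\<close>

definition W :: "nat \<Rightarrow> nat \<Rightarrow> (nat set \<times> nat set) set \<Rightarrow> real" where
  "W k l F = r ^ (k + l) * (fact k * fact l) * card F"

definition cnt :: "nat \<Rightarrow> nat \<Rightarrow> nat set \<Rightarrow> nat set \<Rightarrow> real" where
  "cnt k l P Q = W k l (sel E k l P Q)"

abbreviation "Out \<equiv> outs E"
abbreviation "In \<equiv> ins E"
abbreviation "Nb \<equiv> nb E"
abbreviation "Far \<equiv> far E"

lemma finV: "finite V" and EV: "E \<subseteq> V \<times> V" and irr: "(x, x) \<notin> E"
  using digraph by (auto simp: digraph_def)

lemma Out_V: "Out v \<subseteq> V" and In_V: "In v \<subseteq> V" and Nb_V: "Nb v \<subseteq> V"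
  using EV by (auto simp: outs_def ins_def nb_def)

lemma fin [simp]: "finite V" "finite (Out v)" "finite (In v)" "finite (Nb v)"
  using finite_subset[OF Out_V finV] finite_subset[OF In_V finV] finite_subset[OF Nb_V finV] finV by auto

lemma finFar [simp]: "finite X \<Longrightarrow> finite (Far v X)"
  by (rule finite_subset[OF far_subset])

lemma not_self: "v \<notin> Nb v"
  using irr by (auto simp: nb_def outs_def ins_def)

lemma m_nonneg [simp]: "0 \<le> m X"
  using r_pos by (simp add: m_def)

lemma m_mono: "X \<subseteq> Y \<Longrightarrow> finite Y \<Longrightarrow> m X \<le> m Y"
  using r_pos by (simp add: m_def card_mono)

lemma m_V: "m V = 1"
  using r_card by (simp add: m_def)

lemma m_le_1: "X \<subseteq> V \<Longrightarrow> m X \<le> 1"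
  using m_mono[of X V] finV m_V by simp

lemma m_Un: "finite X \<Longrightarrow> finite Y \<Longrightarrow> X \<inter> Y = {} \<Longrightarrow> m (X \<union> Y) = m X + m Y"
  by (simp add: m_def card_Un_disjoint algebra_simps)

lemma W_mono: "F \<subseteq> F' \<Longrightarrow> finite F' \<Longrightarrow> W k l F \<le> W k l F'"
  using r_pos by (auto simp: W_def intro!: mult_left_mono card_mono)

lemma W_nonneg [simp]: "0 \<le> W k l F"
  using r_pos by (simp add: W_def)

lemma W_Un: "W k l (F \<union> G) \<le> W k l F + W k l G"
proof -
  have "real (card (F \<union> G)) \<le> card F + card G"
    using card_Un_le of_nat_mono by (metis of_nat_add)
  then have "W k l (F \<union> G) \<le> r ^ (k + l) * (fact k * fact l) * (card F + card G)"
    unfolding W_def using r_pos by (intro mult_left_mono) auto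
  then show ?thesis by (simp add: W_def algebra_simps)
qed

lemma W_UN: "finite X \<Longrightarrow> W k l (\<Union>x\<in>X. F x) \<le> (\<Sum>x\<in>X. W k l (F x))"
proof (induction X rule: finite_induct)
  case empty then show ?case by (simp add: W_def)
next
  case (insert x X)
  then show ?case using W_Un[of k l "F x" "\<Union>x\<in>X. F x"] by simp
qed

lemma cnt_nonneg [simp]: "0 \<le> cnt k l P Q"
  by (simp add: cnt_def)

lemma cnt_le:
  assumes "finite P" "finite Q"
  shows "cnt k l P Q \<le> m P ^ k * m Q ^ l"
proof -
  have "real (fact k * fact l * card (sel E k l P Q)) \<le> real (card P ^ k * card Q ^ l)"
    using card_sel_le[OF assms] by (rule of_nat_mono)
  then have "r ^ (k + l) * (fact k * fact l * card (sel E k l P Q)) \<le> r ^ (k + l) * (card P ^ k * card Q ^ l)"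
    using r_pos by (intro mult_left_mono) auto
  then show ?thesis
    by (simp add: cnt_def W_def m_def power_mult_distrib power_add algebra_simps)
qed

lemma W_remove_out:
  assumes "finite P" "finite Q" "P \<inter> Q = {}" "v \<in> P" "k \<ge> 1"
  shows "W k l {F \<in> sel E k l P Q. v \<in> fst F} \<le> r * k * cnt (k - 1) l (Far v P) (Far v Q)"
proof -
  have "real (card {F \<in> sel E k l P Q. v \<in> fst F}) \<le> card (sel E (k - 1) l (Far v P) (Far v Q))"
    using card_sel_remove_out[OF assms] by simp
  then have "W k l {F \<in> sel E k l P Q. v \<in> fst F} \<le>
     r ^ (k + l) * (fact k * fact l) * card (sel E (k - 1) l (Far v P) (Far v Q))"
    unfolding W_def using r_pos by (intro mult_left_mono) auto
  also have "\<dots> = r * k * cnt (k - 1) l (Far v P) (Far v Q)"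
    using \<open>k \<ge> 1\<close> by (cases k) (simp_all add: cnt_def W_def algebra_simps)
  finally show ?thesis .
qed

lemma W_remove_in:
  assumes "finite P" "finite Q" "P \<inter> Q = {}" "v \<in> Q" "l \<ge> 1"
  shows "W k l {F \<in> sel E k l P Q. v \<in> snd F} \<le> r * l * cnt k (l - 1) (Far v P) (Far v Q)"
proof -
  have "real (card {F \<in> sel E k l P Q. v \<in> snd F}) \<le> card (sel E k (l - 1) (Far v P) (Far v Q))"
    using card_sel_remove_in[OF assms] by simp
  then have "W k l {F \<in> sel E k l P Q. v \<in> snd F} \<le>
     r ^ (k + l) * (fact k * fact l) * card (sel E k (l - 1) (Far v P) (Far v Q))"
    unfolding W_def using r_pos by (intro mult_left_mono) auto
  also have "\<dots> = r * l * cnt k (l - 1) (Far v P) (Far v Q)"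
    using \<open>l \<ge> 1\<close> by (cases l) (simp_all add: cnt_def W_def algebra_simps)
  finally show ?thesis .
qed

lemma cnt_swap: "cnt k l P Q = cnt l k Q P"
  unfolding cnt_def W_def by (subst sel_swap) (simp add: card_image algebra_simps)

text \<open>Choice of the first out-leaf in an ordered selection: double counting gives a factor k
  on the left, and \<open>W_remove_out\<close> the same factor on the right.\<close>

lemma cnt_expand_out:
  assumes "finite P" "finite Q" "P \<inter> Q = {}" "k \<ge> 1"
  shows "cnt k l P Q \<le> (\<Sum>v\<in>P. r * cnt (k - 1) l (Far v P) (Far v Q))"
proof -
  have "real k * cnt k l P Q = (\<Sum>v\<in>P. W k l {F \<in> sel E k l P Q. v \<in> fst F})"
  proof -
    have "real (k * card (sel E k l P Q)) = real (\<Sum>v\<in>P. card {F \<in> sel E k l P Q. v \<in> fst F})"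
      using card_sel_count_out[OF assms(1,2), of k E l] by simp
    then have *: "real k * card (sel E k l P Q) = (\<Sum>v\<in>P. real (card {F \<in> sel E k l P Q. v \<in> fst F}))"
      by simp
    have "real k * cnt k l P Q = r ^ (k + l) * (fact k * fact l) * (real k * card (sel E k l P Q))"
      by (simp add: cnt_def W_def)
    then show ?thesis unfolding * by (simp add: W_def sum_distrib_left)
  qed
  also have "\<dots> \<le> (\<Sum>v\<in>P. r * k * cnt (k - 1) l (Far v P) (Far v Q))"
    using assms by (intro sum_mono W_remove_out) auto
  also have "\<dots> = k * (\<Sum>v\<in>P. r * cnt (k - 1) l (Far v P) (Far v Q))"
    by (simp add: sum_distrib_left algebra_simps)
  finally show ?thesis using \<open>k \<ge> 1\<close> by simp
qed

end

section \<open>Induced copies in extremal digraphs\<close>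

definition copies :: "(nat \<times> nat) set \<Rightarrow> nat set \<Rightarrow> nat \<Rightarrow> nat \<Rightarrow> nat set set" where
  "copies E V k l = {X. X \<subseteq> V \<and> induced_iso E X (star_V k l) (star_E k l)}"

definition stars :: "(nat \<times> nat) set \<Rightarrow> nat set \<Rightarrow> nat \<Rightarrow> nat \<Rightarrow> (nat \<times> nat set \<times> nat set) set" where
  "stars E V k l = (SIGMA c:V. sel E k l (outs E c) (ins E c))"

definition verts :: "nat \<times> nat set \<times> nat set \<Rightarrow> nat set" where
  "verts F = insert (fst F) (fst (snd F) \<union> snd (snd F))"

lemma star_induced_iso:
  assumes K: "K \<subseteq> outs E c" and L: "L \<subseteq> ins E c" and cK: "card K = k" and cL: "card L = l"
    and fin: "finite K" "finite L" and ind: "indep E (K \<union> L)" and irr: "\<And>x. (x, x) \<notin> E"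
  shows "induced_iso E (insert c (K \<union> L)) (star_V k l) (star_E k l)"
proof -
  have "card K = card {1..k}" "card L = card {k+1..k+l}" using cK cL by auto
  then obtain g h where g: "bij_betw g K {1..k}" and h: "bij_betw h L {k+1..k+l}"
    using finite_same_card_bij[OF fin(1), of "{1..k}"] finite_same_card_bij[OF fin(2), of "{k+1..k+l}"] by auto
  have cnot: "c \<notin> K" "c \<notin> L" using K L irr by (auto simp: outs_def ins_def)
  have dis: "K \<inter> L = {}" using K L by (auto simp: outs_def ins_def)
  define f where "f x = (if x = c then 0 else if x \<in> K then g x else h x)" for x
  have fK: "f x = g x" "1 \<le> f x" "f x \<le> k" if "x \<in> K" for x
    using that cnot g by (auto simp: f_def bij_betw_def)
  have fL: "f x = h x" "k < f x" "f x \<le> k + l" if "x \<in> L" for x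
  proof -
    have "x \<noteq> c" "x \<notin> K" using that cnot dis by auto
    then show "f x = h x" by (simp add: f_def)
    moreover have "h x \<in> {k+1..k+l}" using h that by (rule bij_betw_apply)
    ultimately show "k < f x" "f x \<le> k + l" by auto
  qed
  have fc: "f c = 0" by (simp add: f_def)
  have bK: "bij_betw f K {1..k}" using g fK(1) by (metis bij_betw_cong)
  have bL: "bij_betw f L {k+1..k+l}" using h fL(1) by (metis bij_betw_cong)
  have "bij_betw f (K \<union> L) ({1..k} \<union> {k+1..k+l})"
    using bK bL by (rule bij_betw_combine) auto
  then have "bij_betw f (insert c (K \<union> L)) (insert 0 ({1..k} \<union> {k+1..k+l}))"
    unfolding bij_betw_def using cnot fc by auto
  moreover have "insert 0 ({1..k} \<union> {k+1..k+l}) = star_V k l"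
    by (auto simp: star_V_def)
  ultimately have bij: "bij_betw f (insert c (K \<union> L)) (star_V k l)" by simp
  have arc: "(x, y) \<in> E \<longleftrightarrow> (f x, f y) \<in> star_E k l"
    if xy: "x \<in> insert c (K \<union> L)" "y \<in> insert c (K \<union> L)" for x y
  proof -
    consider "x = c" "y = c" | "x = c" "y \<in> K" | "x = c" "y \<in> L" | "x \<in> K" "y = c" | "x \<in> L" "y = c"
      | "x \<in> K \<union> L" "y \<in> K \<union> L" using xy by blast
    then show ?thesis
    proof cases
      case 1 then show ?thesis using irr fc by (auto simp: star_E_def)
    next
      case 2 then have "(x, y) \<in> E" using K by (auto simp: outs_def)
      then show ?thesis using 2 fc fK by (auto simp: star_E_def)
    next
      case 3 then have "(x, y) \<notin> E" using L by (auto simp: ins_def)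
      then show ?thesis using 3 fc fL(2)[of y] by (auto simp: star_E_def)
    next
      case 4 then have "(x, y) \<notin> E" using K by (auto simp: outs_def)
      then show ?thesis using 4 fc fK(2,3)[of x] by (auto simp: star_E_def)
    next
      case 5 then have "(x, y) \<in> E" using L by (auto simp: ins_def)
      then show ?thesis using 5 fc fL[of x] by (auto simp: star_E_def)
    next
      case 6 then have "(x, y) \<notin> E" using ind by (auto simp: indep_def adj_def)
      moreover have "f x \<noteq> 0" "f y \<noteq> 0" using 6 fK(2) fL(2) by fastforce+
      ultimately show ?thesis by (auto simp: star_E_def)
    qed
  qed
  show ?thesis unfolding induced_iso_def using bij arc by blast
qed

lemma induced_iso_star:
  assumes "induced_iso E X (star_V k l) (star_E k l)"
  obtains c K L where "c \<in> X" "X = insert c (K \<union> L)" "K \<subseteq> outs E c" "L \<subseteq> ins E c" "card K = k" "card L = l"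
    "indep E (K \<union> L)"
proof -
  obtain f where f: "bij_betw f X (star_V k l)"
    and arc: "\<And>x y. x \<in> X \<Longrightarrow> y \<in> X \<Longrightarrow> (x, y) \<in> E \<longleftrightarrow> (f x, f y) \<in> star_E k l"
    using assms by (auto simp: induced_iso_def)
  have img: "f ` X = {..k+l}" and inj: "inj_on f X" using f by (auto simp: bij_betw_def star_V_def)
  then have "0 \<in> f ` X" by simp
  then obtain c where c: "c \<in> X" "f c = 0" by auto
  define K where "K = {x \<in> X. 1 \<le> f x \<and> f x \<le> k}"
  define L where "L = {x \<in> X. k < f x}"
  have le: "f x \<le> k + l" if "x \<in> X" for x using img that by auto
  have X: "X = insert c (K \<union> L)"
  proof -
    have "x = c \<or> x \<in> K \<or> x \<in> L" if "x \<in> X" for x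
    proof (cases "f x = 0")
      case True
      then show ?thesis using inj_onD[OF inj, of x c] that c by simp
    qed (use that in \<open>auto simp: K_def L_def\<close>)
    then show ?thesis using c by (auto simp: K_def L_def)
  qed
  have "f ` K = {1..k}"
  proof
    show "{1..k} \<subseteq> f ` K"
    proof
      fix i assume i: "i \<in> {1..k}"
      then have "i \<in> f ` X" using img by auto
      then show "i \<in> f ` K" using i by (auto simp: K_def)
    qed
  qed (auto simp: K_def)
  moreover have "inj_on f K" using inj by (auto simp: K_def inj_on_def)
  ultimately have cK: "card K = k" by (metis card_image card_atLeastAtMost diff_Suc_1)
  have "f ` L = {k+1..k+l}"
  proof
    show "{k+1..k+l} \<subseteq> f ` L"
    proof
      fix i assume i: "i \<in> {k+1..k+l}"
      then have "i \<in> f ` X" using img by auto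
      then show "i \<in> f ` L" using i by (auto simp: L_def)
    qed
  qed (auto simp: L_def le)
  moreover have "inj_on f L" using inj by (auto simp: L_def inj_on_def)
  ultimately have "card L = card {k+1..k+l}" by (metis card_image)
  then have cL: "card L = l" by simp
  have "K \<subseteq> outs E c" using arc c le by (auto simp: K_def outs_def star_E_def)
  moreover have "L \<subseteq> ins E c" using arc c le by (auto simp: L_def ins_def star_E_def)
  moreover have "indep E (K \<union> L)"
    using arc unfolding indep_def adj_def by (auto simp: K_def L_def star_E_def)
  ultimately show ?thesis using that c X cK cL by blast
qed

text \<open>A second centre would be a leaf of the first one and would be joined to another leaf,
  against independence.\<close>

lemma stars_centre_unique:
  assumes "k + l \<ge> 2" and "\<And>x. (x, x) \<notin> E"
    and F: "K \<subseteq> outs E c" "L \<subseteq> ins E c" "card K = k" "card L = l" "finite K" "finite L" "indep E (K \<union> L)"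
    and F': "K' \<subseteq> outs E c'" "L' \<subseteq> ins E c'"
    and eq: "insert c (K \<union> L) = insert c' (K' \<union> L')"
  shows "c = c'"
proof (rule ccontr)
  assume ne: "c \<noteq> c'"
  have "c' \<in> insert c (K \<union> L)" unfolding eq by simp
  then have c': "c' \<in> K \<union> L" using ne by simp
  have dis: "K \<inter> L = {}" using F by (auto simp: outs_def ins_def)
  have "card (K \<union> L) \<ge> 2" using F assms(1) dis by (simp add: card_Un_disjoint)
  then have "\<not> K \<union> L \<subseteq> {c'}" using card_mono[of "{c'}" "K \<union> L"] by auto
  then obtain x where x: "x \<in> K \<union> L" "x \<noteq> c'" by auto
  then have "x \<in> insert c' (K' \<union> L')" unfolding eq[symmetric] by simp
  then have "x \<in> K' \<union> L'" using x by simp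
  then have "adj E c' x" using F' by (auto simp: outs_def ins_def adj_def)
  then show False using F(7) c' x by (auto simp: indep_def)
qed

text \<open>The centre is determined by the vertex set, and then the out- and in-leaves are its
  intersections with \<open>outs\<close> and \<open>ins\<close>. So copies may be counted by
  centre.\<close>

lemma bij_betw_stars_copies:
  assumes dg: "digraph V E" and s: "k + l \<ge> 2"
  shows "bij_betw verts (stars E V k l) (copies E V k l)"
proof -
  have irr: "\<And>x. (x, x) \<notin> E" and EV: "E \<subseteq> V \<times> V" and fV: "finite V" using dg by (auto simp: digraph_def)
  have fo: "finite (outs E c)" "finite (ins E c)" for c
    using EV by (auto simp: outs_def ins_def intro: finite_subset[OF _ fV])
  have sub: "outs E c \<subseteq> V" "ins E c \<subseteq> V" for c
    using EV by (auto simp: outs_def ins_def)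
  show ?thesis unfolding bij_betw_def
  proof
    show "inj_on verts (stars E V k l)"
    proof (rule inj_onI)
      fix F F' assume A: "F \<in> stars E V k l" "F' \<in> stars E V k l" "verts F = verts F'"
      obtain c K L where F: "F = (c, K, L)" by (metis surj_pair)
      obtain c' K' L' where F': "F' = (c', K', L')" by (metis surj_pair)
      have 1: "K \<subseteq> outs E c" "L \<subseteq> ins E c" "card K = k" "card L = l" "indep E (K \<union> L)"
        using A(1) by (auto simp: F stars_def sel_def)
      have 2: "K' \<subseteq> outs E c'" "L' \<subseteq> ins E c'"
        using A(2) by (auto simp: F' stars_def sel_def)
      have eq: "insert c (K \<union> L) = insert c' (K' \<union> L')" using A(3) by (simp add: F F' verts_def)
      have "finite K" "finite L" using finite_subset[OF 1(1) fo(1)] finite_subset[OF 1(2) fo(2)] .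
      then have cc: "c = c'"
        by (rule stars_centre_unique[OF s irr 1(1-4) _ _ 1(5) 2 eq])
      have "insert c (K \<union> L) \<inter> outs E c = K" "insert c (K \<union> L) \<inter> ins E c = L"
        using 1 irr by (auto simp: outs_def ins_def)
      moreover have "insert c' (K' \<union> L') \<inter> outs E c' = K'" "insert c' (K' \<union> L') \<inter> ins E c' = L'"
        using 2 irr by (auto simp: outs_def ins_def)
      moreover have "insert c (K \<union> L) \<inter> outs E c = insert c' (K' \<union> L') \<inter> outs E c'"
        "insert c (K \<union> L) \<inter> ins E c = insert c' (K' \<union> L') \<inter> ins E c'"
        unfolding eq unfolding cc by (rule refl)+
      ultimately show "F = F'" using cc F F' by simp
    qed
    show "verts ` stars E V k l = copies E V k l"
    proof
      show "verts ` stars E V k l \<subseteq> copies E V k l"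
      proof
        fix X assume "X \<in> verts ` stars E V k l"
        then obtain c K L where *: "c \<in> V" "K \<subseteq> outs E c" "L \<subseteq> ins E c" "card K = k" "card L = l" "indep E (K \<union> L)"
          "X = insert c (K \<union> L)"
          by (auto simp: stars_def sel_def verts_def)
        have "induced_iso E X (star_V k l) (star_E k l)"
          unfolding *(7) using * fo by (intro star_induced_iso irr) (auto intro: finite_subset)
        moreover have "X \<subseteq> V" using * sub by blast
        ultimately show "X \<in> copies E V k l" by (auto simp: copies_def)
      qed
      show "copies E V k l \<subseteq> verts ` stars E V k l"
      proof
        fix X assume X: "X \<in> copies E V k l"
        then have "induced_iso E X (star_V k l) (star_E k l)" by (simp add: copies_def)
        then obtain c K L where "c \<in> X" "X = insert c (K \<union> L)" "K \<subseteq> outs E c" "L \<subseteq> ins E c" "card K = k" "card L = l" "indep E (K \<union> L)"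
          by (rule induced_iso_star)
        moreover from this have "c \<in> V" using X by (auto simp: copies_def)
        ultimately show "X \<in> verts ` stars E V k l"
          by (intro image_eqI[of _ _ "(c, K, L)"]) (auto simp: stars_def sel_def verts_def)
      qed
    qed
  qed
qed

lemma finite_copies: "finite V \<Longrightarrow> finite (copies E V k l)"
  by (rule finite_subset[of _ "Pow V"]) (auto simp: copies_def)

lemma card_copies_member: "X \<in> copies E V k l \<Longrightarrow> card X = k + l + 1"
proof -
  assume "X \<in> copies E V k l"
  then obtain f where "bij_betw f X (star_V k l)" by (auto simp: copies_def induced_iso_def)
  then have "card X = card (star_V k l)" by (rule bij_betw_same_card)
  then show ?thesis by (simp add: star_V_def)
qed

lemma induced_iso_transfer:
  assumes g: "bij_betw g X Y" and arc: "\<And>x y. x \<in> X \<Longrightarrow> y \<in> X \<Longrightarrow> (x, y) \<in> E \<longleftrightarrow> (g x, g y) \<in> E'"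
    and iso: "induced_iso E' Y HV HE"
  shows "induced_iso E X HV HE"
proof -
  obtain f where f: "bij_betw f Y HV" "\<And>x y. x \<in> Y \<Longrightarrow> y \<in> Y \<Longrightarrow> (x, y) \<in> E' \<longleftrightarrow> (f x, f y) \<in> HE"
    using iso by (auto simp: induced_iso_def)
  have "bij_betw (f \<circ> g) X HV" using g f(1) by (rule bij_betw_trans)
  moreover have "\<And>x y. x \<in> X \<Longrightarrow> y \<in> X \<Longrightarrow> (x, y) \<in> E \<longleftrightarrow> ((f \<circ> g) x, (f \<circ> g) y) \<in> HE"
    using arc f(2) g by (auto simp: bij_betw_def)
  ultimately show ?thesis unfolding induced_iso_def by blast
qed

section \<open>Replacing a vertex by a twin of another one\<close>

definition clone :: "nat \<Rightarrow> nat \<Rightarrow> (nat \<times> nat) set \<Rightarrow> (nat \<times> nat) set" where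
  "clone u v E = {(x, y). (if x = u then v else x, if y = u then v else y) \<in> E}"

lemma digraph_clone: "digraph V E \<Longrightarrow> u \<in> V \<Longrightarrow> v \<in> V \<Longrightarrow> digraph V (clone u v E)"
  by (auto simp: digraph_def clone_def split: if_splits)

text \<open>Copies avoiding u survive, and copies through v that avoid u reappear with u in the
  place of v. Only the copies through both are not controlled.\<close>

lemma card_copies_clone:
  assumes dg: "digraph V E" and uv: "u \<in> V" "v \<in> V" "u \<noteq> v"
  shows "card (copies (clone u v E) V k l) + card {X \<in> copies E V k l. u \<in> X} + card {X \<in> copies E V k l. u \<in> X \<and> v \<in> X}
     \<ge> card (copies E V k l) + card {X \<in> copies E V k l. v \<in> X}"
proof -
  let ?E = "clone u v E"
  have fV: "finite V" using dg by (auto simp: digraph_def)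
  note fc = finite_copies[OF fV]
  define c0 c1 where "c0 = {X \<in> copies E V k l. u \<notin> X}" and "c1 = {X \<in> copies E V k l. v \<in> X \<and> u \<notin> X}"
  define sw where "sw X = insert u (X - {v})" for X :: "nat set"
  have sub1: "c0 \<subseteq> copies ?E V k l"
  proof
    fix X assume X: "X \<in> c0"
    have "induced_iso ?E X (star_V k l) (star_E k l)"
      by (rule induced_iso_transfer[of id X X ?E E]) (use X in \<open>auto simp: c0_def copies_def clone_def\<close>)
    then show "X \<in> copies ?E V k l" using X by (auto simp: c0_def copies_def)
  qed
  have sub2: "sw ` c1 \<subseteq> copies ?E V k l"
  proof
    fix Y assume "Y \<in> sw ` c1"
    then obtain X where X: "X \<in> c1" and Y: "Y = sw X" by auto
    let ?g = "\<lambda>x. if x = u then v else x"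
    have "bij_betw ?g Y X"
      unfolding bij_betw_def using X uv by (auto simp: Y sw_def c1_def inj_on_def image_iff)
    then have "induced_iso ?E Y (star_V k l) (star_E k l)"
      by (rule induced_iso_transfer[of ?g Y X ?E E]) (use X in \<open>auto simp: c1_def copies_def clone_def\<close>)
    then show "Y \<in> copies ?E V k l" using X uv by (auto simp: c1_def copies_def Y sw_def)
  qed
  have "inj_on sw c1"
  proof (rule inj_onI)
    fix X Y assume "X \<in> c1" "Y \<in> c1" "sw X = sw Y"
    moreover from this have "X = insert v (sw X - {u})" "Y = insert v (sw Y - {u})" using uv by (auto simp: c1_def sw_def)
    ultimately show "X = Y" by metis
  qed
  then have "card (sw ` c1) = card c1" by (rule card_image)
  moreover have "c0 \<inter> sw ` c1 = {}" by (auto simp: c0_def sw_def)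
  moreover have fin: "finite c0" "finite c1" using fc by (auto simp: c0_def c1_def)
  ultimately have "card c0 + card c1 = card (c0 \<union> sw ` c1)" by (simp add: card_Un_disjoint)
  also have "\<dots> \<le> card (copies ?E V k l)" using sub1 sub2 fc by (intro card_mono) auto
  finally have 1: "card c0 + card c1 \<le> card (copies ?E V k l)" .
  have "copies E V k l = c0 \<union> {X \<in> copies E V k l. u \<in> X}" by (auto simp: c0_def)
  then have 2: "card (copies E V k l) \<le> card c0 + card {X \<in> copies E V k l. u \<in> X}"
    by (metis card_Un_le)
  have "{X \<in> copies E V k l. v \<in> X} = c1 \<union> {X \<in> copies E V k l. u \<in> X \<and> v \<in> X}" by (auto simp: c1_def)
  then have 3: "card {X \<in> copies E V k l. v \<in> X} \<le> card c1 + card {X \<in> copies E V k l. u \<in> X \<and> v \<in> X}"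
    by (metis card_Un_le)
  from 1 2 3 show ?thesis by linarith
qed

text \<open>This is one order below the possible number of copies through a single vertex, so the
  error of the twin argument vanishes after normalization.\<close>

lemma card_copies_pair:
  assumes "finite V" "u \<in> V" "v \<in> V" "u \<noteq> v" "k + l \<ge> 1"
  shows "card {X \<in> copies E V k l. u \<in> X \<and> v \<in> X} \<le> card V ^ (k + l - 1)"
proof -
  have "card {X \<in> copies E V k l. u \<in> X \<and> v \<in> X} \<le> card {Y. Y \<subseteq> V \<and> card Y = k + l - 1}"
  proof (rule card_inj_on_le[where f = "\<lambda>X. X - {u, v}"])
    show "inj_on (\<lambda>X. X - {u, v}) {X \<in> copies E V k l. u \<in> X \<and> v \<in> X}"
      by (auto simp: inj_on_def)
    show "(\<lambda>X. X - {u, v}) ` {X \<in> copies E V k l. u \<in> X \<and> v \<in> X} \<subseteq> {Y. Y \<subseteq> V \<and> card Y = k + l - 1}"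
    proof clarify
      fix X assume X: "X \<in> copies E V k l" "u \<in> X" "v \<in> X"
      then have "card X = k + l + 1" "X \<subseteq> V" by (auto simp: card_copies_member copies_def)
      then have "card (X - {u, v}) = k + l + 1 - card {u, v}" using X by (subst card_Diff_subset) auto
      then show "X - {u, v} \<subseteq> V \<and> card (X - {u, v}) = k + l - 1" using \<open>X \<subseteq> V\<close> assms by auto
    qed
    show "finite {Y. Y \<subseteq> V \<and> card Y = k + l - 1}" using assms by simp
  qed
  also have "\<dots> = card V choose (k + l - 1)" using assms by (simp add: n_subsets)
  also have "\<dots> \<le> card V ^ (k + l - 1)"
    by (cases "k + l - 1 \<le> card V") (auto simp: binomial_le_pow binomial_eq_0)
  finally show ?thesis .
qed

text \<open>Replacing u by a twin of v cannot increase the number of copies in an extremal digraph.\<close>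

lemma extremal_copies_degree:
  assumes dg: "digraph V E" and uv: "u \<in> V" "v \<in> V" and s: "k + l \<ge> 1"
    and ext: "\<And>E'. digraph V E' \<Longrightarrow> card (copies E' V k l) \<le> card (copies E V k l)"
  shows "card {X \<in> copies E V k l. v \<in> X} \<le> card {X \<in> copies E V k l. u \<in> X} + card V ^ (k + l - 1)"
proof (cases "u = v")
  case False
  have "finite V" using dg by (simp add: digraph_def)
  then show ?thesis
  using card_copies_clone[OF dg uv False, of k l] ext[OF digraph_clone[OF dg uv]]
    card_copies_pair[OF _ uv False s, of E] by fastforce
qed simp

lemma sum_card_copies:
  assumes "finite V"
  shows "(\<Sum>v\<in>V. card {X \<in> copies E V k l. v \<in> X}) = (k + l + 1) * card (copies E V k l)"
proof (rule sum_multicount[of _ _ "\<lambda>v X. v \<in> X"])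
  show "\<forall>X\<in>copies E V k l. card {v \<in> V. v \<in> X} = k + l + 1"
  proof
    fix X assume X: "X \<in> copies E V k l"
    then have "{v \<in> V. v \<in> X} = X" by (auto simp: copies_def)
    then show "card {v \<in> V. v \<in> X} = k + l + 1" using card_copies_member[OF X] by simp
  qed
qed (use assms finite_copies in auto)

section \<open>Numerical estimates\<close>

text \<open>On [0,1], kap a b is the maximum of x^a (1-x)^b, and ww s is (s+1) times the maximum of x (1-x)^s; with
  s = k + l, s * ee s * kap k l bounds the normalized number of stars with a given centre and a given leaf.\<close>

definition kap :: "nat \<Rightarrow> nat \<Rightarrow> real" where
  "kap a b = real a ^ a * real b ^ b / real (a + b) ^ (a + b)"

definition ww :: "nat \<Rightarrow> real" where
  "ww s = (real s / (real s + 1)) ^ s"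

definition ee :: "nat \<Rightarrow> real" where
  "ee s = (real s / (real s - 1)) ^ (s - 1)"

lemma kap_commute: "kap a b = kap b a"
  by (simp add: kap_def add.commute mult.commute)

lemma kap_0: "kap 0 b = 1"
  by (cases "b = 0") (simp_all add: kap_def)

lemma kap_pos: "kap a b > 0"
proof -
  have "real a ^ a > 0" for a by (cases "a = 0") auto
  from this[of a] this[of b] this[of "a + b"] show ?thesis unfolding kap_def by (intro divide_pos_pos mult_pos_pos)
qed

text \<open>Weighted AM-GM in homogeneous form: with p and q measured in units of their optimal
  values, x \<le> exp (x - 1) is applied to each, and the exponents cancel.\<close>

lemma pow_mult_pow_le_kap:
  fixes p q :: real
  assumes "p \<ge> 0" "q \<ge> 0"
  shows "p ^ a * q ^ b \<le> kap a b * (p + q) ^ (a + b)"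
proof -
  consider "a = 0" | "b = 0" | "p + q = 0" "a > 0" | "a > 0" "b > 0" "p + q > 0"
    using assms by fastforce
  then show ?thesis
  proof cases
    case 1 then show ?thesis using assms by (simp add: kap_0 power_mono)
  next
    case 2 then show ?thesis using assms by (subst kap_commute) (simp add: kap_0 power_mono)
  next
    case 3 then have "p = 0" using assms by linarith
    then show ?thesis using 3 by (simp add: zero_power)
  next
    case 4
    define T where "T = p + q"
    define N where "N = real (a + b)"
    define x where "x = p * N / (a * T)"
    define y where "y = q * N / (b * T)"
    have pos: "T > 0" "N > 0" using 4 by (auto simp: T_def N_def)
    have ax: "a * x = p * N / T" and by': "b * y = q * N / T" using 4 pos by (auto simp: x_def y_def)
    have nn: "x \<ge> 0" "y \<ge> 0" using assms pos by (auto simp: x_def y_def)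
    have "x ^ a \<le> exp (x - 1) ^ a" "y ^ b \<le> exp (y - 1) ^ b"
      using nn exp_ge_add_one_self[of "x - 1"] exp_ge_add_one_self[of "y - 1"] by (auto intro!: power_mono)
    then have "x ^ a * y ^ b \<le> exp (x - 1) ^ a * exp (y - 1) ^ b"
      using nn by (intro mult_mono) auto
    also have "\<dots> = exp (a * (x - 1) + b * (y - 1))" by (simp add: exp_of_nat_mult exp_add)
    also have "a * (x - 1) + b * (y - 1) = (p + q) * N / T - N"
      by (simp add: right_diff_distrib ax by' N_def add_divide_distrib distrib_right)
    also have "\<dots> = 0" using pos by (simp add: T_def)
    finally have le: "x ^ a * y ^ b \<le> 1" by simp
    have "p = x * (a * T / N)" "q = y * (b * T / N)" using 4 pos by (auto simp: x_def y_def)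
    then have "p ^ a * q ^ b = (x * (a * T / N)) ^ a * (y * (b * T / N)) ^ b" by simp
    also have "\<dots> = x ^ a * y ^ b * (kap a b * T ^ (a + b))"
      by (simp add: power_mult_distrib power_divide power_add kap_def N_def)
    also have "\<dots> \<le> 1 * (kap a b * T ^ (a + b))"
      using le kap_pos[of a b] pos by (intro mult_right_mono) auto
    finally show ?thesis by (simp add: T_def)
  qed
qed

lemma ee_kap: "k + l \<ge> 2 \<Longrightarrow> real (k + l) * ee (k + l) * kap k l = real k ^ k * real l ^ l / real (k + l - 1) ^ (k + l - 1)"
  by (cases "k + l") (simp_all add: ee_def kap_def power_divide divide_simps)

text \<open>Since k (k-1)^(k-1) \<le> k^k. The right side is symmetric in k and l, so stars through
  a given leaf get the same bound whether it is an out-leaf or an in-leaf.\<close>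

lemma kap_out:
  assumes "k \<ge> 1" "k + l \<ge> 2"
  shows "k * kap (k - 1) l \<le> real (k + l) * ee (k + l) * kap k l"
proof -
  have "real k * real (k - 1) ^ (k - 1) \<le> real k * real k ^ (k - 1)"
    by (intro mult_left_mono power_mono) auto
  also have "\<dots> = real k ^ k" using assms by (cases k) auto
  finally have *: "real k * real (k - 1) ^ (k - 1) \<le> real k ^ k" .
  have "k * kap (k - 1) l = (real k * real (k - 1) ^ (k - 1)) * real l ^ l / real (k + l - 1) ^ (k + l - 1)"
    using assms by (simp add: kap_def)
  also have "\<dots> \<le> real k ^ k * real l ^ l / real (k + l - 1) ^ (k + l - 1)"
    using * by (intro divide_right_mono mult_right_mono) auto
  finally show ?thesis using ee_kap[OF assms(2)] by simp
qed

lemma kap_in: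
  assumes "l \<ge> 1" "k + l \<ge> 2"
  shows "l * kap k (l - 1) \<le> real (k + l) * ee (k + l) * kap k l"
  using kap_out[of l k] assms by (simp add: kap_commute add.commute)

section \<open>Bounds for exp 1, \<open>ww\<close> and \<open>ee\<close>\<close>

lemma one_minus_power_le_exp:
  fixes c :: real
  assumes "c \<le> s" "s \<ge> 1"
  shows "(1 - c / real s) ^ s \<le> exp (- c)"
proof -
  have "(1 - c / s) ^ s \<le> exp (- c / s) ^ s"
    using assms exp_ge_add_one_self[of "- c / s"] by (intro power_mono) (auto simp: field_simps)
  also have "\<dots> = exp (- c)" using assms by (simp add: exp_of_nat_mult[symmetric])
  finally show ?thesis .
qed

lemma exp_1_le: "exp 1 \<le> ((68/25)::real)"
proof -
  obtain t :: real where t: "\<bar>t\<bar> \<le> \<bar>1\<bar>" "exp 1 = (\<Sum>m<7. 1 ^ m / fact m) + exp t / fact 7 * 1 ^ 7"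
    using Maclaurin_exp_le[of 1 7] by blast
  have "exp t \<le> exp 1" using t(1) by simp
  then have "exp t \<le> 3" using exp_le by linarith
  then show ?thesis using t(2) by (simp add: fact_numeral lessThan_Suc eval_nat_numeral)
qed

lemma ww_pos: "s \<ge> 1 \<Longrightarrow> ww s > 0"
  by (simp add: ww_def)

text \<open>\<open>ww s\<close> is the inverse of (1 + 1/s)^s, which stays below e.\<close>

lemma ww_ge:
  assumes "s \<ge> 1" shows "ww s \<ge> (367/1000)"
proof -
  have "(1 + 1 / real s) ^ s \<le> exp (1 / s) ^ s"
    using exp_ge_add_one_self[of "1 / s"] by (intro power_mono) auto
  also have "\<dots> = exp 1" using assms by (simp add: exp_of_nat_mult[symmetric])
  also have "\<dots> \<le> (68/25)" using exp_1_le by simp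
  finally have 1: "(1 + 1 / real s) ^ s \<le> (68/25)" .
  have "ww s * (1 + 1 / real s) ^ s = 1"
  proof -
    have h: "real s / (real s + 1) * (1 + 1 / real s) = 1" using assms by (simp add: divide_simps)
    have "(real s / (real s + 1) * (1 + 1 / real s)) ^ s = 1" by (simp only: h power_one)
    then show ?thesis by (simp only: ww_def power_mult_distrib)
  qed
  moreover have "ww s * (1 + 1 / real s) ^ s \<le> ww s * (68/25)"
    using 1 ww_pos[OF assms] by (intro mult_left_mono) auto
  ultimately show ?thesis by simp
qed

lemma ee_nonneg: "s \<ge> 1 \<Longrightarrow> ee s \<ge> 0" by (simp add: ee_def)

text \<open>The sequence (1 + 1/n)^n increases: its terms at s - 1 and s are \<open>ee s\<close> and
  1 / \<open>ww s\<close>. The step is the Bernoulli inequality for (1 - 1/s^2)^s.\<close>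

lemma ee_ww:
  assumes "s \<ge> 2" shows "ee s * ww s \<le> 1"
proof -
  have b: "1 - 1 / real s \<le> (1 - 1 / real s ^ 2) ^ s"
  proof -
    have "1 / real s ^ 2 \<le> 1" using assms by simp
    then have "1 + s * (- (1 / real s ^ 2)) \<le> (1 + - (1 / real s ^ 2)) ^ s"
      by (intro Bernoulli_inequality) simp
    moreover have "s * (1 / real s ^ 2) = 1 / s" by (simp add: power2_eq_square)
    ultimately show ?thesis by simp
  qed
  have "ee s * ww s * (1 - 1 / real s ^ 2) ^ s * (real s / (real s - 1)) = 1"
  proof -
    have e: "ee s * (real s / (real s - 1)) = (real s / (real s - 1)) ^ s"
      using assms by (cases s) (auto simp: ee_def)
    have "ee s * ww s * (1 - 1 / real s ^ 2) ^ s * (real s / (real s - 1)) =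
       (real s / (real s - 1)) ^ s * ww s * (1 - 1 / real s ^ 2) ^ s" by (simp add: e[symmetric])
    also have "\<dots> = (real s / (real s - 1) * (real s / (real s + 1)) * (1 - 1 / real s ^ 2)) ^ s"
      by (simp only: ww_def power_mult_distrib)
    also have "real s / (real s - 1) * (real s / (real s + 1)) * (1 - 1 / real s ^ 2) = 1"
      using assms by (simp add: divide_simps) algebra
    finally show ?thesis by (simp only: power_one)
  qed
  moreover have "ee s * ww s \<le> ee s * ww s * ((1 - 1 / real s ^ 2) ^ s * (real s / (real s - 1)))"
  proof -
    have "1 = (1 - 1 / real s) * (real s / (real s - 1))" using assms by (simp add: field_simps)
    also have "\<dots> \<le> (1 - 1 / real s ^ 2) ^ s * (real s / (real s - 1))"
      using b assms by (intro mult_right_mono) auto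
    finally have ge1: "1 \<le> (1 - 1 / real s ^ 2) ^ s * (real s / (real s - 1))" .
    have "0 \<le> ee s * ww s" using ee_nonneg[of s] ww_pos[of s] assms by simp
    from mult_left_mono[OF ge1 this] show ?thesis by (simp only: mult_1_right)
  qed
  ultimately show ?thesis by (simp only: mult.assoc)
qed

lemma ee_le:
  assumes "s \<ge> 2" shows "ee s \<le> (109/40)"
proof -
  have "ee s * (367/1000) \<le> ee s * ww s" using ww_ge[of s] ee_nonneg[of s] assms by (intro mult_left_mono) auto
  then show ?thesis using ee_ww[OF assms] by simp
qed

lemma ee_ge:
  assumes "s \<ge> 6" shows "ee s \<ge> (12/5)"
proof -
  obtain n where n: "s = Suc n" "n \<ge> 5" using assms by (cases s) auto
  have b: "(1 + x) ^ n \<ge> 1 + n * x + real n * (real n - 1) / 2 * x ^ 2" if "x \<ge> 0" for x :: real and n :: nat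
  proof (induction n)
    case (Suc n)
    have "(1 + x) ^ Suc n \<ge> (1 + x) * (1 + n * x + real n * (real n - 1) / 2 * x ^ 2)"
      using Suc that by simp
    moreover have "(1 + x) * (1 + n * x + real n * (real n - 1) / 2 * x ^ 2) =
       1 + Suc n * x + real (Suc n) * (real (Suc n) - 1) / 2 * x ^ 2 + real n * (real n - 1) / 2 * x ^ 3"
      by (simp add: field_simps power2_eq_square power3_eq_cube)
    moreover have "real n * (real n - 1) / 2 * x ^ 3 \<ge> 0" using that by (cases n) auto
    ultimately show ?case by linarith
  qed simp
  have "ee s = (1 + 1 / real n) ^ n" using n by (simp add: ee_def field_simps)
  also have "\<dots> \<ge> 1 + n * (1 / n) + real n * (real n - 1) / 2 * (1 / n) ^ 2" by (rule b) simp
  also have "1 + n * (1 / n) + real n * (real n - 1) / 2 * (1 / n) ^ 2 = (5/2) - 1 / (2 * real n)"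
    using n by (simp add: field_simps power2_eq_square)
  finally have "ee s \<ge> (5/2) - 1 / (2 * real n)" .
  moreover have "1 / (2 * real n) \<le> 1 / 10" using n by (intro divide_left_mono) auto
  ultimately show ?thesis by simp
qed

text \<open>Passing from s to s + 1 multiplies the left side by ((s+1)/s)^j \<rho>, which is at most
  (7/6)^j \<rho> \<le> 1. This reduces estimates for all s \<ge> 6 to arithmetic at s = 6.\<close>

lemma decay:
  fixes \<rho> :: real
  assumes "s \<ge> 6" "0 \<le> \<rho>" "(7/6) ^ j * \<rho> \<le> 1"
  shows "real s ^ j * \<rho> ^ (s - 6) \<le> 6 ^ j"
  using assms(1)
proof (induction s rule: nat_induct_at_least)
  case (Suc s)
  have "real (Suc s) \<le> 7/6 * s" using Suc by simp
  then have "real (Suc s) ^ j \<le> (7/6 * s) ^ j" by (intro power_mono) auto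
  then have "real (Suc s) ^ j * \<rho> \<le> (7/6 * s) ^ j * \<rho>" using assms by (intro mult_right_mono) auto
  also have "\<dots> = (7/6) ^ j * \<rho> * real s ^ j" by (simp only: power_mult_distrib) simp
  also have "\<dots> \<le> 1 * real s ^ j" using assms by (intro mult_right_mono) auto
  finally have "real (Suc s) ^ j * \<rho> * \<rho> ^ (s - 6) \<le> s ^ j * \<rho> ^ (s - 6)"
    using assms by (intro mult_right_mono) auto
  moreover have e: "Suc s - 6 = Suc (s - 6)" using Suc by simp
  have "\<rho> ^ (Suc s - 6) = \<rho> * \<rho> ^ (s - 6)" by (simp only: e power_Suc)
  ultimately show ?case using Suc by (simp add: mult.assoc)
qed simp

lemma decay':
  fixes \<rho> x :: real
  assumes "s \<ge> 6" "0 \<le> x" "x \<le> \<rho>" "(7/6) ^ j * \<rho> \<le> 1" "i \<le> 6"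
  shows "real s ^ j * x ^ (s - i) \<le> 6 ^ j * \<rho> ^ (6 - i)"
proof -
  have "real s ^ j * x ^ (s - i) \<le> real s ^ j * \<rho> ^ (s - i)"
    using assms by (intro mult_left_mono power_mono) auto
  also have "\<dots> = real s ^ j * \<rho> ^ (s - 6) * \<rho> ^ (6 - i)"
    using assms by (simp add: power_add[symmetric])
  also have "\<dots> \<le> 6 ^ j * \<rho> ^ (6 - i)"
    using decay[of s \<rho> j] assms by (intro mult_right_mono) auto
  finally show ?thesis .
qed

lemma ee_decay:
  fixes \<rho> x :: real
  assumes "s \<ge> 6" "0 \<le> x" "x \<le> \<rho>" "(7/6) ^ j * \<rho> \<le> 1" "i \<le> 6"
  shows "ee s * (real s ^ j * x ^ (s - i)) \<le> (109/40) * (6 ^ j * \<rho> ^ (6 - i))"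
  by (rule mult_mono[OF ee_le decay'[OF assms]]) (use assms in auto)

section \<open>Numerical input for the degree classes\<close>

lemma exp_m: "exp (- (1/10)) \<le> ((181/200)::real)" "exp (- (1/20)) \<le> ((9513/10000)::real)" "exp (- (1/3)) \<le> ((18/25)::real)"
proof -
  have *: "exp (- x) \<le> c" if "0 \<le> x" "1 \<le> c * (1 + x + x\<^sup>2 / 2)" "c \<ge> 0" for x c :: real
  proof -
    have "1 \<le> c * exp x" using exp_lower_Taylor_quadratic[OF that(1)] that mult_left_mono[OF _ that(3)] order_trans by blast
    then show ?thesis by (simp add: exp_minus field_simps)
  qed
  show "exp (- (1/10)) \<le> ((181/200)::real)" by (rule *) (simp_all add: power2_eq_square)
  show "exp (- (1/20)) \<le> ((9513/10000)::real)" by (rule *) (simp_all add: power2_eq_square)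
  show "exp (- (1/3)) \<le> ((18/25)::real)" by (rule *) (simp_all add: power2_eq_square)
qed

text \<open>1 - (1 + c)/(s + 1) is s/(s + 1) times 1 - c/s: falling short of the optimal degree s/(s
  + 1) by c/(s + 1) costs a factor exp (- c).\<close>

lemma ww_shift:
  fixes c D :: real
  assumes "s \<ge> 1" "c \<le> s" "0 \<le> D" "D \<le> 1 - (1 + c) / (real s + 1)"
  shows "D ^ s \<le> ww s * exp (- c)"
proof -
  have "real s / (real s + 1) * (1 - c / s) = 1 - (1 + c) / (real s + 1)"
    using assms by (simp add: divide_simps)
  then have "D \<le> real s / (real s + 1) * (1 - c / s)" using assms by simp
  then have "D ^ s \<le> (real s / (real s + 1) * (1 - c / s)) ^ s" using assms by (intro power_mono) auto
  also have "\<dots> = ww s * (1 - c / s) ^ s" by (simp only: ww_def power_mult_distrib)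
  also have "\<dots> \<le> ww s * exp (- c)"
    using one_minus_power_le_exp[OF assms(2,1)] ww_pos[OF assms(1)] by (intro mult_left_mono) auto
  finally show ?thesis .
qed

text \<open>Multiplied by \<open>kap k l\<close>, the left side bounds the stars through a vertex of
  strict degree D, first as centre, then as leaf, and the right side is what every vertex of a
  balanced digraph must have. So no degree lies in this range.\<close>

lemma num_dichotomy:
  fixes D :: real
  assumes s: "s \<ge> 6" and D: "(23/50) \<le> D" "D < 1 - (11/10) / (real s + 1)"
  shows "D ^ s + real s * ee s * (D * (1 - D) ^ (s - 1)) < ww s"
proof -
  have w: "ww s \<ge> (367/1000)" using ww_ge[of s] s by simp
  have "(11/10) / (real s + 1) > 0" by simp
  then have D1: "D < 1" using D by linarith
  have pw: "D ^ s \<le> x ^ 6" if "D \<le> x" "x \<le> 1" for x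
  proof -
    have "D ^ s \<le> x ^ s" using that D by (intro power_mono) auto
    also have "\<dots> \<le> x ^ 6" using that D s by (intro power_decreasing) auto
    finally show ?thesis .
  qed
  have E: "real s * ee s * (D * (1 - D) ^ (s - 1)) \<le> (109/40) * q * (6 * \<rho> ^ 4)"
    if "1 - D \<le> \<rho>" "\<rho> \<le> (4/5)" "D * (1 - D) \<le> q" for \<rho> q
  proof -
    have q: "q \<ge> 0" using that D D1 mult_nonneg_nonneg[of D "1 - D"] by linarith
    have "real s * ee s * (D * (1 - D) ^ (s - 1)) = ee s * (D * (1 - D)) * (real s * (1 - D) ^ (s - 2))"
    proof -
      have "s - 1 = Suc (s - 2)" using s by simp
      then show ?thesis by (simp only: power_Suc) (simp add: mult_ac)
    qed
    also have "\<dots> \<le> ((109/40) * q) * (real s * (1 - D) ^ (s - 2))"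
      using ee_le[of s] ee_nonneg[of s] s D D1 that q by (intro mult_right_mono mult_mono) auto
    also have "\<dots> \<le> ((109/40) * q) * (6 * \<rho> ^ 4)"
      using decay'[of s "1 - D" \<rho> 1 2] s that D1 q by (intro mult_left_mono) auto
    finally show ?thesis .
  qed
  have qq: "D * (1 - D) \<le> (1/4)"
    using zero_le_power2[of "D - (1/2)"] by (simp add: power2_eq_square algebra_simps)
  \<comment> \<open>The margin is small in the first and the last interval; only near 1 is the
    comparison with \<open>ww s\<close> itself, instead of its numerical lower bound,
    required.\<close>
  consider "D \<le> (1/2)" | "(1/2) \<le> D" "D \<le> (3/5)" | "(3/5) \<le> D" "D \<le> (3/4)" | "(3/4) \<le> D" by linarith
  then show ?thesis
  proof cases
    case 1
    then show ?thesis using pw[of "(1/2)"] E[of "(27/50)" "(1/4)"] D qq w by (simp add: power_numeral_reduce)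
  next
    case 2
    then show ?thesis using pw[of "(3/5)"] E[of "(1/2)" "(1/4)"] D qq w by (simp add: power_numeral_reduce)
  next
    case 3
    have "D * (1 - D) \<le> (6/25)"
      using mult_nonneg_nonneg[of "D - (3/5)" "D - (2/5)"] 3 by (simp add: algebra_simps)
    then show ?thesis using 3 pw[of "(3/4)"] E[of "(2/5)" "(6/25)"] D w by (simp add: power_numeral_reduce)
  next
    case 4
    have "D * (1 - D) \<le> (3/16)"
    proof -
      have "0 \<le> (D - 3/4) * (D - 1/4)" using 4 by (intro mult_nonneg_nonneg) auto
      moreover have "D * (1 - D) = 3/16 - (D - 3/4) * (D - 1/4)" by (simp add: field_simps)
      ultimately show ?thesis by linarith
    qed
    then have "real s * ee s * (D * (1 - D) ^ (s - 1)) \<le> (1/50)"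
      using E[of "(1/4)" "(3/16)"] 4 by (simp add: power_numeral_reduce)
    moreover have "D ^ s \<le> ww s * exp (- (1/10))"
      using s D by (intro ww_shift) auto
    moreover have "ww s * exp (- (1/10)) \<le> ww s * (181/200)"
      using exp_m(1) w by (intro mult_left_mono) auto
    ultimately show ?thesis using w by linarith
  qed
qed

text \<open>This makes the errors at a vertex c of A a fraction (9/50)/s^2 of \<open>ww s\<close>.
  The factor 23/20 is 1 for the stars with leaf c plus 3/20 for the stars with centre c that have a
  leaf in A.\<close>

lemma num_lambda:
  assumes s: "s \<ge> 6"
  shows "real s ^ 2 * ((23/20) * (real s * ee s * ((11/10) / (real s + 1)) ^ (s - 1)) + (1 / (real s + 1)) ^ s) \<le> (9/50) * ww s"
proof -
  have w: "ww s \<ge> (367/1000)" using ww_ge[of s] s by simp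
  have x: "(11/10) / (real s + 1) \<le> (11/10) / 7" "1 / (real s + 1) \<le> 1 / 7" using s by (simp_all add: field_simps)
  have "ee s * (real s ^ 3 * ((11/10) / (real s + 1)) ^ (s - 1)) \<le> (109/40) * (6 ^ 3 * ((11/10) / 7) ^ 5)"
    using ee_decay[of s "(11/10) / (real s + 1)" "(11/10) / 7" 3 1] s x by (simp add: power_numeral_reduce)
  moreover have "real s ^ 2 * (1 / (real s + 1)) ^ s \<le> 6 ^ 2 * (1 / 7) ^ 6"
    using decay'[of s "1 / (real s + 1)" "1 / 7" 2 0] s x by (auto simp: power_numeral_reduce)
  moreover have alg: "S ^ 2 * ((23/20) * (S * e * X) + Y) = (23/20) * (e * (S ^ 3 * X)) + S ^ 2 * Y" for S e X Y :: real
    by (simp add: power2_eq_square power3_eq_cube algebra_simps)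
  moreover have "(23/20) * ((109/40) * (6 ^ 3 * ((11/10) / 7) ^ 5)) + 6 ^ 2 * (1 / 7) ^ 6 \<le> ((9/50) * (367/1000) :: real)"
    by (simp add: power_numeral_reduce)
  ultimately show ?thesis unfolding alg using w by linarith
qed

text \<open>First round of the bootstrap: \<beta> is the measure of the neighbours in B of a vertex
  of B, and 23/50 the only bound on degrees in B known so far.\<close>

lemma num_beta1:
  fixes \<beta> :: real
  assumes s: "s \<ge> 6" and b: "4 / (3 * (real s + 1)) < \<beta>" "\<beta> \<le> (23/50)"
  shows "(23/50) ^ s + (1 - \<beta>) ^ s + real s * ee s * (\<beta> * (23/50) ^ (s - 1)) < ww s"
proof -
  have w: "ww s \<ge> (367/1000)" using ww_ge[of s] s by simp
  have b0: "\<beta> \<ge> 0" using b by (smt (verit) divide_nonneg_nonneg of_nat_0_le_iff)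
  have "((23/50)::real) ^ s \<le> (23/50) ^ 6" using s by (intro power_decreasing) auto
  then have 1: "((23/50)::real) ^ s \<le> (19/2000)" by (simp add: power_numeral_reduce)
  have 2: "real s * ee s * (\<beta> * (23/50) ^ (s - 1)) \<le> (3369/10000) * \<beta>"
  proof -
    have "real s * ee s * (\<beta> * (23/50) ^ (s - 1)) = (ee s * (real s ^ 1 * (23/50) ^ (s - 1))) * \<beta>" by simp
    also have "\<dots> \<le> ((109/40) * (6 ^ 1 * (23/50) ^ 5)) * \<beta>"
      using ee_decay[of s "(23/50)" "(23/50)" 1 1] s b0 by (intro mult_right_mono) auto
    also have "\<dots> \<le> (3369/10000) * \<beta>" using b0 by (intro mult_right_mono) (auto simp: power_numeral_reduce)
    finally show ?thesis .
  qed
  show ?thesis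
  proof (cases "\<beta> \<le> (1/4)")
    case True
    have "(1 - \<beta>) ^ s \<le> ww s * exp (- (1/3))"
      using s b by (intro ww_shift) (auto simp: field_simps)
    also have "\<dots> \<le> ww s * (18/25)" using exp_m(3) w by (intro mult_left_mono) auto
    finally show ?thesis using 1 2 w True by linarith
  next
    case False
    have "(1 - \<beta>) ^ s \<le> (3/4) ^ s" using False b by (intro power_mono) auto
    also have "\<dots> \<le> (3/4) ^ 6" using s by (intro power_decreasing) auto
    finally have "(1 - \<beta>) ^ s \<le> (179/1000)" by (simp add: power_numeral_reduce)
    then show ?thesis using 1 2 w b by linarith
  qed
qed

text \<open>Second round: the first one and a \<le> (101/100)/(s+1) bound the degrees in B by
  (47/20)/(s+1), since 101/100 + 4/3 < 47/20.\<close>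

lemma num_beta2:
  fixes \<beta> :: real
  assumes s: "s \<ge> 6" and b: "(21/20) / (real s + 1) < \<beta>" "\<beta> \<le> 4 / (3 * (real s + 1))"
  shows "((47/20) / (real s + 1)) ^ s + (1 - \<beta>) ^ s + real s * ee s * (\<beta> * ((47/20) / (real s + 1)) ^ (s - 1)) < ww s"
proof -
  have w: "ww s \<ge> (367/1000)" using ww_ge[of s] s by simp
  have b0: "\<beta> \<ge> 0" using b by (smt (verit) divide_nonneg_nonneg of_nat_0_le_iff)
  have "4 / (3 * (real s + 1)) \<le> 4 / 21" using s by (intro divide_left_mono) auto
  then have b1: "\<beta> \<le> 4 / 21" using b by linarith
  have x: "(47/20) / (real s + 1) \<le> (47/20) / 7" using s by (simp add: field_simps)
  have "((47/20) / (real s + 1)) ^ s \<le> ((47/20) / 7) ^ s" using x by (intro power_mono) auto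
  also have "\<dots> \<le> ((47/20) / 7) ^ 6" using s by (intro power_decreasing) auto
  finally have 1: "((47/20) / (real s + 1)) ^ s \<le> (3/2000)" by (simp add: power_numeral_reduce)
  have 2: "real s * ee s * (\<beta> * ((47/20) / (real s + 1)) ^ (s - 1)) \<le> (7/500)"
  proof -
    have "real s * ee s * (\<beta> * ((47/20) / (real s + 1)) ^ (s - 1)) = (ee s * (real s ^ 1 * ((47/20) / (real s + 1)) ^ (s - 1))) * \<beta>" by simp
    also have "\<dots> \<le> ((109/40) * (6 ^ 1 * ((47/20) / 7) ^ 5)) * (4 / 21)"
    proof (rule mult_mono[OF _ b1])
      show "ee s * (real s ^ 1 * ((47/20) / (real s + 1)) ^ (s - 1)) \<le> (109/40) * (6 ^ 1 * ((47/20) / 7) ^ 5)"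
        using ee_decay[of s "(47/20) / (real s + 1)" "(47/20) / 7" 1 1] s x by simp
    qed (use b0 in auto)
    also have "\<dots> \<le> (7/500)" by (simp add: power_numeral_reduce)
    finally show ?thesis .
  qed
  have "(1 - \<beta>) ^ s \<le> ww s * exp (- (1/20))"
    using s b b1 by (intro ww_shift) (auto simp: field_simps)
  also have "\<dots> \<le> ww s * (9513/10000)" using exp_m(2) w by (intro mult_left_mono) auto
  finally show ?thesis using 1 2 w by linarith
qed

text \<open>Input for \<open>a_ge\<close>: the first summand stands for the stars centred in B, the
  second one for the deviation of the vertices of A from the average.\<close>

lemma num_nu:
  assumes s: "s \<ge> 6"
  shows "real s ^ 2 * ((real s + 1) * ((103/50) / (real s + 1)) ^ s + (11/10) * (1 / (real s + 1)) ^ s) \<le> (23/50) * ww s"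
proof -
  have w: "ww s \<ge> (367/1000)" using ww_ge[of s] s by simp
  have x: "(103/50) / (real s + 1) \<le> (103/50) / 7" "1 / (real s + 1) \<le> 1 / 7" using s by (simp_all add: field_simps)
  have "real s ^ 2 * ((103/50) / (real s + 1)) ^ (s - 1) \<le> 6 ^ 2 * ((103/50) / 7) ^ 5"
    using decay'[of s "(103/50) / (real s + 1)" "(103/50) / 7" 2 1] s x by (auto simp: power_numeral_reduce)
  moreover have "real s ^ 2 * (1 / (real s + 1)) ^ s \<le> 6 ^ 2 * (1 / 7) ^ 6"
    using decay'[of s "1 / (real s + 1)" "1 / 7" 2 0] s x by (auto simp: power_numeral_reduce)
  moreover have yeq: "(real s + 1) * ((103/50) / (real s + 1)) ^ s = (103/50) * ((103/50) / (real s + 1)) ^ (s - 1)"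
  proof -
    define y where "y = (103/50) / (real s + 1)"
    have "y ^ s = y * y ^ (s - 1)" using s by (cases s) auto
    moreover have "real s + 1 \<noteq> 0" by linarith
    then have "(real s + 1) * ((103/50) / (real s + 1)) = 103/50" by (metis nonzero_mult_div_cancel_left times_divide_eq_right)
    then have "(real s + 1) * y = 103/50" by (simp only: y_def)
    ultimately show ?thesis unfolding y_def[symmetric] by (metis mult.assoc)
  qed
  moreover have "(103/50) * (6 ^ 2 * ((103/50) / 7) ^ 5) + (11/10) * (6 ^ 2 * (1 / 7) ^ 6) \<le> ((23/50) * (367/1000) :: real)"
    by (simp add: power_numeral_reduce)
  moreover have alg: "S * (A + (11/10) * Y) = S * A + (11/10) * (S * Y)" "S * (B * (C::real)) = B * (S * C)" for S A Y B C :: real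
    by (simp_all add: algebra_simps)
  ultimately show ?thesis unfolding alg(1) yeq alg(2) using w by linarith
qed

section \<open>The two degree classes\<close>

text \<open>cc counts stars by their centre v; lf counts the stars that have v as a leaf.\<close>

context wdigraph
begin

definition cc :: "nat \<Rightarrow> nat \<Rightarrow> nat \<Rightarrow> real" where
  "cc k l v = cnt k l (Out v) (In v)"

definition thr :: "nat \<Rightarrow> nat \<Rightarrow> nat set \<Rightarrow> nat set \<Rightarrow> nat \<Rightarrow> real" where
  "thr k l P Q v = W k l {F \<in> sel E k l P Q. v \<in> fst F \<union> snd F}"

definition lf :: "nat \<Rightarrow> nat \<Rightarrow> nat \<Rightarrow> real" where
  "lf k l v = (\<Sum>c\<in>V. thr k l (Out c) (In c) v)"

lemma cnt_le_kap:
  assumes "finite P" "finite Q" "P \<inter> Q = {}"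
  shows "cnt k l P Q \<le> kap k l * m (P \<union> Q) ^ (k + l)"
  using cnt_le[OF assms(1,2), of k l] pow_mult_pow_le_kap[of "m P" "m Q" k l] m_Un[OF assms] by simp

lemma kap_nonneg: "0 \<le> kap i j" using kap_pos[of i j] by simp

text \<open>With v fixed as a leaf, one leaf fewer has to be chosen, and only in
  \<open>Far v\<close>. By \<open>kap_out\<close> and \<open>kap_in\<close> the constant does not
  depend on the kind of v.\<close>

lemma thr_le:
  assumes "finite P" "finite Q" "P \<inter> Q = {}" "v \<in> P \<union> Q" "k + l \<ge> 2"
  shows "thr k l P Q v \<le> r * (real (k + l) * ee (k + l) * kap k l) * m (Far v (P \<union> Q)) ^ (k + l - 1)"
proof -
  have far: "finite (Far v P)" "finite (Far v Q)" "Far v P \<inter> Far v Q = {}"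
    using assms by (auto simp: far_def)
  have mm: "m (Far v P \<union> Far v Q) = m (Far v (P \<union> Q))" by (simp add: far_Un)
  have nn: "0 \<le> r * (real (k + l) * ee (k + l) * kap k l) * m (Far v (P \<union> Q)) ^ (k + l - 1)"
    using r_pos ee_nonneg[of "k + l"] kap_nonneg[of k l] assms by simp
  show ?thesis
  proof (cases "v \<in> P")
    case True
    have "{F \<in> sel E k l P Q. v \<in> fst F \<union> snd F} = {F \<in> sel E k l P Q. v \<in> fst F}"
      using True assms by (auto simp: sel_def)
    note eq = this
    show ?thesis
    proof (cases "k = 0")
      case True
      have e: "{F \<in> sel E k l P Q. v \<in> fst F} = {}"
        using True assms(1) by (auto simp: sel_def dest: finite_subset)
      show ?thesis unfolding thr_def eq e W_def using nn by simp
    next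
      case False
      then have k1: "k \<ge> 1" by simp
      from eq have "thr k l P Q v \<le> r * k * cnt (k - 1) l (Far v P) (Far v Q)"
        unfolding thr_def using W_remove_out[OF assms(1-3) True k1, of l] by simp
      also have "\<dots> \<le> r * k * (kap (k - 1) l * m (Far v (P \<union> Q)) ^ (k - 1 + l))"
        using cnt_le_kap[OF far, of "k - 1" l] r_pos mm by (intro mult_left_mono) auto
      also have "\<dots> = r * (k * kap (k - 1) l) * m (Far v (P \<union> Q)) ^ (k + l - 1)" using k1 by simp
      also have "\<dots> \<le> r * (real (k + l) * ee (k + l) * kap k l) * m (Far v (P \<union> Q)) ^ (k + l - 1)"
        using kap_out[of k l] k1 assms r_pos by (intro mult_right_mono mult_left_mono) auto
      finally show ?thesis .
    qed
  next
    case False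
    then have v: "v \<in> Q" using assms by auto
    have "{F \<in> sel E k l P Q. v \<in> fst F \<union> snd F} = {F \<in> sel E k l P Q. v \<in> snd F}"
      using False assms by (auto simp: sel_def)
    note eq = this
    show ?thesis
    proof (cases "l = 0")
      case True
      have e: "{F \<in> sel E k l P Q. v \<in> snd F} = {}"
        using True assms(2) by (auto simp: sel_def dest: finite_subset)
      show ?thesis unfolding thr_def eq e W_def using nn by simp
    next
      case False
      then have l1: "l \<ge> 1" by simp
      from eq have "thr k l P Q v \<le> r * l * cnt k (l - 1) (Far v P) (Far v Q)"
        unfolding thr_def using W_remove_in[OF assms(1-3) v l1, of k] by simp
      also have "\<dots> \<le> r * l * (kap k (l - 1) * m (Far v (P \<union> Q)) ^ (k + (l - 1)))"
        using cnt_le_kap[OF far, of k "l - 1"] r_pos mm by (intro mult_left_mono) auto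
      also have "\<dots> = r * (l * kap k (l - 1)) * m (Far v (P \<union> Q)) ^ (k + l - 1)" using l1 by simp
      also have "\<dots> \<le> r * (real (k + l) * ee (k + l) * kap k l) * m (Far v (P \<union> Q)) ^ (k + l - 1)"
        using kap_in[of l k] l1 assms r_pos by (intro mult_right_mono mult_left_mono) auto
      finally show ?thesis .
    qed
  qed
qed

lemma thr_0: "v \<notin> P \<union> Q \<Longrightarrow> thr k l P Q v = 0"
proof -
  assume "v \<notin> P \<union> Q"
  then have e: "{F \<in> sel E k l P Q. v \<in> fst F \<union> snd F} = {}" by (auto simp: sel_def)
  show ?thesis unfolding thr_def e by (simp add: W_def)
qed

text \<open>The first bound serves for centres c of small degree, the second one for leaves v of
  large degree.\<close>

lemma m_Far_Nb_le: "m (Far v (Nb c)) \<le> m (Nb c)" "m (Far v (Nb c)) \<le> 1 - m (Nb v)"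
proof -
  show "m (Far v (Nb c)) \<le> m (Nb c)" by (rule m_mono) (simp_all add: far_subset)
  have "m (Far v (Nb c)) + m (Nb v) = m (Far v (Nb c) \<union> Nb v)"
    by (rule m_Un[symmetric]) (simp_all add: far_Int_nb)
  also have "\<dots> \<le> 1" using far_subset[of E v "Nb c"] Nb_V by (intro m_le_1) blast
  finally show "m (Far v (Nb c)) \<le> 1 - m (Nb v)" by simp
qed

lemma sum_r_const: "finite X \<Longrightarrow> (\<Sum>x\<in>X. r * c) = m X * c"
  by (simp add: m_def)

end

lemma finite_selF: "finite P \<Longrightarrow> finite Q \<Longrightarrow> finite {F \<in> sel E k l P Q. R F}"
  by (rule finite_subset[OF _ finite_sel[of P Q E k l]]) auto

text \<open>A digraph in which all vertices lie in about the same number of stars, as in an extremal digraph.\<close>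

locale balanced = wdigraph +
  fixes k l s :: nat and T :: real
  assumes l1: "l \<ge> 1" and kl: "k \<ge> l" and s6: "s \<ge> 6" and s_def: "s = k + l"
    and T_def: "T = (\<Sum>v\<in>V. r * cc k l v)"
    and T_ge: "kap k l * ww s \<le> (real s + 1) * T"
    and deg_ge: "\<And>v. v \<in> V \<Longrightarrow> cc k l v + lf k l v \<ge> kap k l * ww s"
    and deg_near: "\<And>v. v \<in> V \<Longrightarrow> \<bar>cc k l v + lf k l v - (real s + 1) * T\<bar> \<le> kap k l * (1 / (real s + 1)) ^ s"
begin

definition \<kappa> where "\<kappa> = kap k l"
definition G where "G = real s * ee s * \<kappa>"
abbreviation D where "D v \<equiv> m (Nb v)"
definition A where "A = {v \<in> V. D v \<ge> 1 - (11/10) / (real s + 1)}"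
definition B where "B = V - A"
definition a where "a = m A"
definition b where "b = m B"
definition bt where "bt v = m (Nb v \<inter> B)"
definition av where "av v = m (Nb v \<inter> A)"
text \<open>By \<open>lf_A\<close>, \<open>\<kappa> * lam\<close> bounds the stars in which a given
  vertex of A is a leaf.\<close>

definition lam where "lam = real s * ee s * ((11/10) / (real s + 1)) ^ (s - 1)"

lemma \<kappa>_pos: "\<kappa> > 0" by (simp add: \<kappa>_def kap_pos)
lemma s_real: "real s \<ge> 6" using s6 by simp
lemma ee_nn: "ee s \<ge> 0" using s6 by (intro ee_nonneg) simp
lemma G_nonneg: "G \<ge> 0" using \<kappa>_pos ee_nn by (simp add: G_def)
lemma lam_nonneg: "lam \<ge> 0" using ee_nn by (simp add: lam_def)
lemma w_ge: "ww s \<ge> (367/1000)" using s6 by (intro ww_ge) simp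
lemma k1: "k \<ge> 1" using l1 kl by simp

lemma AV: "A \<subseteq> V" and BV: "B \<subseteq> V" and AB: "A \<union> B = V" "A \<inter> B = {}"
  by (auto simp: A_def B_def)

lemma finAB [simp]: "finite A" "finite B"
  using finite_subset[OF AV] finite_subset[OF BV] by auto

lemma ab: "a + b = 1"
  using m_Un[of A B] AB m_V by (simp add: a_def b_def)

lemma a_nonneg: "a \<ge> 0" and b_nonneg: "b \<ge> 0"
  by (simp_all add: a_def b_def)

lemma a_le_1: "a \<le> 1" and b_le_1: "b \<le> 1" using ab a_nonneg b_nonneg by auto

lemma D_split: "D v = av v + bt v"
proof -
  have "Nb v = (Nb v \<inter> A) \<union> (Nb v \<inter> B)" using Nb_V[of v] AB by blast
  then have "D v = m ((Nb v \<inter> A) \<union> (Nb v \<inter> B))" by simp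
  also have "\<dots> = av v + bt v" unfolding av_def bt_def using AB by (intro m_Un) auto
  finally show ?thesis .
qed

lemma av_nonneg: "av v \<ge> 0" and bt_nonneg: "bt v \<ge> 0" and D_nonneg: "D v \<ge> 0"
  by (simp_all add: av_def bt_def)

lemma av_le: "av v \<le> a" unfolding av_def a_def by (rule m_mono) auto
lemma D_le_1: "D v \<le> 1" by (rule m_le_1[OF Nb_V])

lemma cc_le: "cc k l v \<le> \<kappa> * D v ^ s"
  unfolding cc_def \<kappa>_def s_def nb_def by (rule cnt_le_kap) (simp_all add: outs_ins_disjoint)

lemma cc_nonneg: "cc k l v \<ge> 0" by (simp add: cc_def)

lemma thr_le':
  assumes "finite P" "finite Q" "P \<inter> Q = {}" "v \<in> P \<union> Q"
  shows "thr k l P Q v \<le> r * G * m (Far v (P \<union> Q)) ^ (s - 1)"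
  using thr_le[OF assms, of k l, folded s_def] s6 k1 l1 by (simp add: G_def \<kappa>_def)

lemma thr_Nb_le: "v \<in> Nb c \<Longrightarrow> thr k l (Out c) (In c) v \<le> r * G * m (Far v (Nb c)) ^ (s - 1)"
  unfolding nb_def by (rule thr_le') (simp_all add: outs_ins_disjoint)

lemma lf_le: "lf k l v \<le> (\<Sum>c\<in>Nb v. r * G * m (Far v (Nb c)) ^ (s - 1))"
proof -
  have "lf k l v = (\<Sum>c\<in>Nb v. thr k l (Out c) (In c) v)"
    unfolding lf_def using Nb_V[of v] nb_sym[of v E]
    by (intro sum.mono_neutral_right) (auto intro!: thr_0 simp: nb_def)
  also have "\<dots> \<le> (\<Sum>c\<in>Nb v. r * G * m (Far v (Nb c)) ^ (s - 1))"
    using nb_sym[of _ E v] by (intro sum_mono thr_Nb_le) auto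
  finally show ?thesis .
qed

lemma lf_le_D: "lf k l v \<le> G * (D v * (1 - D v) ^ (s - 1))"
proof -
  have "lf k l v \<le> (\<Sum>c\<in>Nb v. r * G * m (Far v (Nb c)) ^ (s - 1))" by (rule lf_le)
  also have "\<dots> \<le> (\<Sum>c\<in>Nb v. r * (G * (1 - D v) ^ (s - 1)))"
    using G_nonneg r_pos m_Far_Nb_le(2)[of v]
    by (intro sum_mono) (auto simp: mult.assoc intro!: mult_left_mono power_mono)
  also have "\<dots> = D v * (G * (1 - D v) ^ (s - 1))" by (rule sum_r_const) simp
  finally show ?thesis by (simp add: mult_ac)
qed

section \<open>The degree gap and the bootstrap for the measures of A and B\<close>

lemma dichotomy:
  assumes "v \<in> V" "v \<notin> A" shows "D v < (23/50)"
proof (rule ccontr)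
  assume "\<not> D v < (23/50)"
  then have "D v ^ s + real s * ee s * (D v * (1 - D v) ^ (s - 1)) < ww s"
    using assms s6 by (intro num_dichotomy) (auto simp: A_def)
  then have "\<kappa> * (D v ^ s + real s * ee s * (D v * (1 - D v) ^ (s - 1))) < \<kappa> * ww s"
    using \<kappa>_pos by simp
  moreover have "\<kappa> * ww s \<le> \<kappa> * D v ^ s + G * (D v * (1 - D v) ^ (s - 1))"
    using deg_ge[OF assms(1)] cc_le[of v] lf_le_D[of v] unfolding \<kappa>_def by linarith
  ultimately show False by (simp add: G_def algebra_simps)
qed

lemma A_D: "c \<in> A \<Longrightarrow> 1 - D c \<le> (11/10) / (real s + 1)"
  by (auto simp: A_def)

lemma lf_A:
  assumes "c \<in> A" shows "lf k l c \<le> \<kappa> * lam"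
proof -
  have "lf k l c \<le> G * (D c * (1 - D c) ^ (s - 1))" by (rule lf_le_D)
  also have "\<dots> \<le> G * (1 * ((11/10) / (real s + 1)) ^ (s - 1))"
    using A_D[OF assms] D_le_1[of c] D_nonneg[of c] G_nonneg
    by (intro mult_left_mono mult_mono power_mono) auto
  finally show ?thesis by (simp add: G_def lam_def mult_ac)
qed

text \<open>The average number of stars through a vertex, as each star has s + 1 vertices.\<close>

definition Z where "Z = (real s + 1) * T"

lemma Z_ge: "Z \<ge> \<kappa> * ww s" using T_ge by (simp add: Z_def \<kappa>_def)

definition eps where "eps = (1 / (real s + 1)) ^ s"

lemma eps_nonneg: "eps \<ge> 0" by (simp add: eps_def)

lemma deg_Z: "v \<in> V \<Longrightarrow> cc k l v + lf k l v \<ge> Z - \<kappa> * eps" "v \<in> V \<Longrightarrow> cc k l v + lf k l v \<le> Z + \<kappa> * eps"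
  using deg_near[of v] by (auto simp: Z_def \<kappa>_def eps_def)

lemma s2: "real s ^ 2 \<ge> 36" using s_real power_mono[of 6 "real s" 2] by simp

lemma lam_eps: "real s ^ 2 * ((23/20) * lam + eps) \<le> (9/50) * ww s"
  using num_lambda[OF s6] by (simp add: lam_def eps_def)

lemma lam_small: "(23/20) * lam + eps \<le> (1/200) * ww s"
proof -
  define X where "X = (23/20) * lam + eps"
  have "36 * X \<le> real s ^ 2 * X"
    using s2 lam_nonneg eps_nonneg by (intro mult_right_mono) (auto simp: X_def)
  then have "36 * X \<le> (9/50) * ww s" using lam_eps by (simp only: X_def)
  then have "X \<le> (1/200) * ww s" by simp
  then show ?thesis by (simp only: X_def)
qed

lemma cc_A: "c \<in> A \<Longrightarrow> cc k l c \<ge> Z - \<kappa> * (lam + eps)"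
  using deg_Z(1)[of c] lf_A[of c] AV by (auto simp: algebra_simps)

lemma sum_A_B: "T = (\<Sum>v\<in>A. r * cc k l v) + (\<Sum>v\<in>B. r * cc k l v)"
  unfolding T_def using AB finAB by (metis sum.union_disjoint)

text \<open>Vertices of A are the centres of almost all stars through them, hence of almost Z each.
  All stars together amount to T = Z/(s+1).\<close>

lemma a_le: "a \<le> (101/100) / (real s + 1)"
proof -
  have "a * ((199/200) * Z) \<le> T"
  proof -
    have "\<kappa> * (lam + eps) \<le> \<kappa> * ((1/200) * ww s)"
      using lam_small lam_nonneg \<kappa>_pos by (intro mult_left_mono) auto
    then have le: "cc k l c \<ge> (199/200) * Z" if "c \<in> A" for c
      using cc_A[OF that] Z_ge by linarith
    have "a * ((199/200) * Z) = (\<Sum>v\<in>A. r * ((199/200) * Z))" unfolding a_def by (rule sum_r_const[symmetric]) simp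
    also have "\<dots> \<le> (\<Sum>v\<in>A. r * cc k l v)" using le r_pos by (intro sum_mono mult_left_mono) auto
    also have "\<dots> \<le> T" unfolding sum_A_B using r_pos by (simp add: sum_nonneg cc_nonneg)
    finally show ?thesis .
  qed
  then have "(a * (199/200) * (real s + 1)) * T \<le> 1 * T" by (simp add: Z_def algebra_simps)
  moreover have "\<kappa> * ww s > 0" using \<kappa>_pos w_ge by simp
  then have "Z > 0" using Z_ge by linarith
  then have "T > 0" by (simp add: Z_def zero_less_mult_iff)
  ultimately have "a * (199/200) * (real s + 1) \<le> 1" by (rule mult_right_le_imp_le)
  moreover have "a * (real s + 1) \<ge> 0" using a_nonneg by simp
  ultimately have "a * (real s + 1) \<le> (101/100)" by linarith
  then show ?thesis by (subst pos_le_divide_eq) auto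
qed

lemma G_kap: "G * kap 1 (s - 1) = \<kappa>"
proof -
  have "real s * ee s * kap 1 (s - 1) = 1"
    using ee_kap[of 1 "s - 1"] s6 by simp
  then show ?thesis by (simp add: G_def)
qed

text \<open>The stars with leaf v are split by the class of their centre. Centres in A give at most
  G av (1 - D)^(s-1); since av + (1 - D) = 1 - bt, AM-GM and \<open>G_kap\<close> turn this into
  \<open>\<kappa> * (1 - bt v) ^ s\<close>. Centres in B have degree at most y, which leaves little
  room for the other leaves.\<close>

lemma deg_B_bound:
  assumes v: "v \<in> B" and y: "\<And>c. c \<in> B \<Longrightarrow> D c \<le> y"
  shows "ww s \<le> y ^ s + (1 - bt v) ^ s + real s * ee s * (bt v * y ^ (s - 1))"
proof -
  have vV: "v \<in> V" using v BV by auto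
  have far: "m (Far v (Nb c)) ^ (s - 1) \<le> (1 - D v) ^ (s - 1)" "c \<in> B \<Longrightarrow> m (Far v (Nb c)) ^ (s - 1) \<le> y ^ (s - 1)" for c
    using m_Far_Nb_le[where v = v and c = c] y[of c] by (auto intro!: power_mono)
  have "Nb v = (Nb v \<inter> A) \<union> (Nb v \<inter> B)" using Nb_V[of v] AB by blast
  then have "(\<Sum>c\<in>Nb v. r * G * m (Far v (Nb c)) ^ (s - 1)) =
      (\<Sum>c\<in>(Nb v \<inter> A) \<union> (Nb v \<inter> B). r * G * m (Far v (Nb c)) ^ (s - 1))" by simp
  also have "\<dots> =  (\<Sum>c\<in>Nb v \<inter> A. r * G * m (Far v (Nb c)) ^ (s - 1)) + (\<Sum>c\<in>Nb v \<inter> B. r * G * m (Far v (Nb c)) ^ (s - 1))"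
    using AB by (intro sum.union_disjoint) auto
  also have "\<dots> \<le> (\<Sum>c\<in>Nb v \<inter> A. r * (G * (1 - D v) ^ (s - 1))) + (\<Sum>c\<in>Nb v \<inter> B. r * (G * y ^ (s - 1)))"
    using far G_nonneg r_pos by (intro add_mono sum_mono) (auto simp: mult.assoc intro!: mult_left_mono)
  also have "\<dots> = G * (av v * (1 - D v) ^ (s - 1)) + G * (bt v * y ^ (s - 1))"
  proof -
    have "(\<Sum>c\<in>Nb v \<inter> A. r * x) = av v * x" "(\<Sum>c\<in>Nb v \<inter> B. r * x) = bt v * x" for x
      unfolding av_def bt_def by (rule sum_r_const, simp)+
    then show ?thesis by (simp del: sum_constant)
  qed
  finally have "lf k l v \<le> G * (av v * (1 - D v) ^ (s - 1)) + G * (bt v * y ^ (s - 1))"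
    using lf_le[of v] by linarith
  moreover have "av v * (1 - D v) ^ (s - 1) \<le> kap 1 (s - 1) * (1 - bt v) ^ s"
    using pow_mult_pow_le_kap[of "av v" "1 - D v" 1 "s - 1"] av_nonneg[of v] D_le_1[of v] D_split[of v] s6 by simp
  then have "G * (av v * (1 - D v) ^ (s - 1)) \<le> G * (kap 1 (s - 1) * (1 - bt v) ^ s)"
    using G_nonneg by (intro mult_left_mono) auto
  then have "G * (av v * (1 - D v) ^ (s - 1)) \<le> \<kappa> * (1 - bt v) ^ s"
    by (simp only: mult.assoc[symmetric] G_kap)
  moreover have "cc k l v \<le> \<kappa> * y ^ s"
  proof -
    have "D v ^ s \<le> y ^ s" using y[OF v] D_nonneg by (intro power_mono) auto
    then have "\<kappa> * D v ^ s \<le> \<kappa> * y ^ s" using \<kappa>_pos by simp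
    then show ?thesis using cc_le[of v] by linarith
  qed
  moreover have "\<kappa> * ww s \<le> cc k l v + lf k l v" using deg_ge[OF vV] by (simp add: \<kappa>_def)
  ultimately have "\<kappa> * ww s \<le> \<kappa> * (y ^ s + (1 - bt v) ^ s + real s * ee s * (bt v * y ^ (s - 1)))"
    by (simp add: G_def algebra_simps)
  then show ?thesis using \<kappa>_pos by simp
qed

lemma bt_le_D: "bt v \<le> D v" using D_split[of v] av_nonneg[of v] by simp

lemma bt_le1:
  assumes v: "v \<in> B" shows "bt v \<le> 4 / (3 * (real s + 1))"
proof (rule ccontr)
  assume *: "\<not> bt v \<le> 4 / (3 * (real s + 1))"
  have y: "D c \<le> (23/50)" if "c \<in> B" for c using dichotomy[of c] that by (auto simp: B_def)
  have "(23/50) ^ s + (1 - bt v) ^ s + real s * ee s * (bt v * (23/50) ^ (s - 1)) < ww s"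
    using * y[OF v] bt_le_D[of v] s6 by (intro num_beta1) auto
  then show False using deg_B_bound[OF v y] by simp
qed

lemma D_B1: "v \<in> B \<Longrightarrow> D v \<le> (47/20) / (real s + 1)"
proof -
  assume v: "v \<in> B"
  have "D v \<le> (101/100) / (real s + 1) + 4 / (3 * (real s + 1))"
    using bt_le1[OF v] a_le av_le[of v] D_split[of v] by linarith
  also have "\<dots> \<le> (47/20) / (real s + 1)"
  proof -
    define X where "X = 1 / (real s + 1)"
    have "c / (real s + 1) = c * X" "4 / (3 * (real s + 1)) = 4 / 3 * X" "X \<ge> 0" for c
      by (simp_all add: X_def)
    then show ?thesis by simp
  qed
  finally show ?thesis .
qed

lemma bt_le:
  assumes v: "v \<in> B" shows "bt v \<le> (21/20) / (real s + 1)"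
proof (rule ccontr)
  assume *: "\<not> bt v \<le> (21/20) / (real s + 1)"
  have "((47/20) / (real s + 1)) ^ s + (1 - bt v) ^ s + real s * ee s * (bt v * ((47/20) / (real s + 1)) ^ (s - 1)) < ww s"
    using * bt_le1[OF v] s6 by (intro num_beta2) auto
  then show False using deg_B_bound[OF v D_B1] by simp
qed

lemma D_B: "v \<in> B \<Longrightarrow> D v \<le> (103/50) / (real s + 1)"
proof -
  assume v: "v \<in> B"
  have "D v \<le> (101/100) / (real s + 1) + (21/20) / (real s + 1)"
    using bt_le[OF v] a_le av_le[of v] D_split[of v] by linarith
  also have "\<dots> = (103/50) / (real s + 1)"
  proof -
    define X where "X = 1 / (real s + 1)"
    have "c / (real s + 1) = c * X" for c by (simp add: X_def)
    then show ?thesis by simp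
  qed
  finally show ?thesis .
qed

text \<open>Stars centred in B are negligible by \<open>D_B\<close>, and a vertex of A is the centre
  of at most about Z stars; so A cannot be much smaller than T/Z = 1/(s+1).\<close>

lemma a_ge: "a \<ge> (1 - (23/50) / real s ^ 2) / (real s + 1)"
proof -
  define y where "y = ((103/50) / (real s + 1)) ^ s"
  have "(\<Sum>v\<in>A. r * cc k l v) \<le> (\<Sum>v\<in>A. r * (Z + \<kappa> * eps))"
  proof (intro sum_mono mult_left_mono)
    fix v assume "v \<in> A"
    then have v: "v \<in> V" using AV by auto
    have "0 \<le> lf k l v" unfolding lf_def thr_def by (intro sum_nonneg) simp
    then show "cc k l v \<le> Z + \<kappa> * eps" using deg_Z(2)[OF v] by linarith
  qed (use r_pos in auto)
  moreover have "(\<Sum>v\<in>B. r * cc k l v) \<le> (\<Sum>v\<in>B. r * (\<kappa> * y))"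
  proof (intro sum_mono mult_left_mono)
    fix v assume "v \<in> B"
    then have "D v ^ s \<le> y" unfolding y_def using D_B D_nonneg by (intro power_mono) auto
    then have "\<kappa> * D v ^ s \<le> \<kappa> * y" using \<kappa>_pos by simp
    then show "cc k l v \<le> \<kappa> * y" using cc_le[of v] by linarith
  qed (use r_pos in auto)
  ultimately have "T \<le> a * (Z + \<kappa> * eps) + b * (\<kappa> * y)"
    using sum_A_B sum_r_const[OF finAB(1), of "Z + \<kappa> * eps"] sum_r_const[OF finAB(2), of "\<kappa> * y"]
    unfolding a_def b_def by linarith
  also have "b * (\<kappa> * y) \<le> 1 * (\<kappa> * y)" using b_le_1 \<kappa>_pos by (intro mult_right_mono) (auto simp: y_def)
  finally have "T \<le> a * Z + a * \<kappa> * eps + \<kappa> * y" by (simp add: algebra_simps)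
  then have "(real s + 1) * T \<le> (real s + 1) * (a * Z + a * \<kappa> * eps + \<kappa> * y)" by (intro mult_left_mono) auto
  then have 1: "Z \<le> (real s + 1) * a * Z + \<kappa> * (((real s + 1) * a) * eps + (real s + 1) * y)"
    by (simp add: Z_def algebra_simps)
  have "(real s + 1) * a \<le> (101/100)" using a_le by (simp add: pos_le_divide_eq algebra_simps)
  then have "((real s + 1) * a) * eps \<le> (11/10) * eps" using eps_nonneg by (intro mult_right_mono) auto
  then have "((real s + 1) * a) * eps + (real s + 1) * y \<le> (23/50) / real s ^ 2 * ww s"
  proof -
    define R where "R = (real s + 1) * y + (11/10) * eps"
    assume "((real s + 1) * a) * eps \<le> (11/10) * eps"
    then have "((real s + 1) * a) * eps + (real s + 1) * y \<le> R" by (simp add: R_def)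
    moreover have "real s ^ 2 * R \<le> (23/50) * ww s" using num_nu[OF s6] by (simp only: R_def y_def eps_def)
    then have "R \<le> (23/50) * ww s / real s ^ 2" using s_real by (simp add: pos_le_divide_eq mult.commute)
    ultimately show ?thesis by simp
  qed
  then have "\<kappa> * (((real s + 1) * a) * eps + (real s + 1) * y) \<le> \<kappa> * ((23/50) / real s ^ 2 * ww s)"
    using \<kappa>_pos by (intro mult_left_mono) auto
  also have "\<dots> \<le> (23/50) / real s ^ 2 * Z"
    using mult_left_mono[OF Z_ge, of "(23/50) / real s ^ 2"] by (simp add: mult_ac)
  finally have "(1 - (23/50) / real s ^ 2) * Z \<le> (real s + 1) * a * Z" using 1 by (simp add: algebra_simps)
  moreover have "\<kappa> * ww s > 0" using \<kappa>_pos w_ge by simp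
  then have "Z > 0" using Z_ge by linarith
  ultimately have "1 - (23/50) / real s ^ 2 \<le> (real s + 1) * a" by (simp add: mult_le_cancel_right)
  then show ?thesis by (simp add: pos_divide_le_eq mult.commute)
qed

section \<open>Out- and in-neighbours in B of the vertices of A\<close>

definition p where "p c = m (Out c \<inter> B)"
definition q where "q c = m (In c \<inter> B)"

lemma pq_nonneg: "p c \<ge> 0" "q c \<ge> 0" by (simp_all add: p_def q_def)

lemma pq_bt: "p c + q c = bt c"
proof -
  have "Nb c \<inter> B = (Out c \<inter> B) \<union> (In c \<inter> B)" by (auto simp: nb_def)
  then show ?thesis unfolding p_def q_def bt_def using outs_ins_disjoint[of E c] by (simp add: m_Un[symmetric] inf_commute disjoint_iff)
qed

lemma bt_le_b: "bt c \<le> b" unfolding bt_def b_def by (rule m_mono) auto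

lemma cc_split_A:
  "cc k l x \<le> cnt k l (Out x \<inter> B) (In x \<inter> B) + (\<Sum>w\<in>Nb x \<inter> A. thr k l (Out x) (In x) w)"
proof -
  have sub: "sel E k l (Out x) (In x) \<subseteq> sel E k l (Out x \<inter> B) (In x \<inter> B) \<union>
      (\<Union>w\<in>Nb x \<inter> A. {F \<in> sel E k l (Out x) (In x). w \<in> fst F \<union> snd F})"
  proof
    fix F assume F: "F \<in> sel E k l (Out x) (In x)"
    obtain K L where KL: "F = (K, L)" by (metis surj_pair)
    have sb: "K \<subseteq> Out x" "L \<subseteq> In x" using F by (auto simp: KL sel_def)
    show "F \<in> sel E k l (Out x \<inter> B) (In x \<inter> B) \<union>
      (\<Union>w\<in>Nb x \<inter> A. {F \<in> sel E k l (Out x) (In x). w \<in> fst F \<union> snd F})"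
    proof (cases "(K \<union> L) \<inter> A = {}")
      case True
      then have "K \<subseteq> B" "L \<subseteq> B" using sb Out_V[of x] In_V[of x] AB by blast+
      then show ?thesis using F by (auto simp: KL sel_def)
    next
      case False
      then obtain w where "w \<in> K \<union> L" "w \<in> A" by auto
      then show ?thesis using F sb by (auto simp: KL nb_def)
    qed
  qed
  have "cc k l x \<le> W k l (sel E k l (Out x \<inter> B) (In x \<inter> B) \<union>
      (\<Union>w\<in>Nb x \<inter> A. {F \<in> sel E k l (Out x) (In x). w \<in> fst F \<union> snd F}))"
    unfolding cc_def cnt_def by (rule W_mono[OF sub]) (auto intro!: finite_sel finite_selF)
  also have "\<dots> \<le> cnt k l (Out x \<inter> B) (In x \<inter> B) + W k l (\<Union>w\<in>Nb x \<inter> A. {F \<in> sel E k l (Out x) (In x). w \<in> fst F \<union> snd F})"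
    unfolding cnt_def by (rule W_Un)
  also have "\<dots> \<le> cnt k l (Out x \<inter> B) (In x \<inter> B) + (\<Sum>w\<in>Nb x \<inter> A. thr k l (Out x) (In x) w)"
    unfolding thr_def by (intro add_left_mono W_UN) simp
  finally show ?thesis .
qed

text \<open>A leaf in A leaves a set of measure at most (11/10)/(s+1) for the other leaves, so
  almost all stars centred at c have their leaves in B, and there are at most
  \<open>p c ^ k * q c ^ l\<close> of those.\<close>

lemma pq_ge:
  assumes c: "c \<in> A" shows "p c ^ k * q c ^ l \<ge> \<kappa> * (ww s * (1 - (9/50) / real s ^ 2))"
proof -
  have "(\<Sum>w\<in>Nb c \<inter> A. thr k l (Out c) (In c) w) \<le> (\<Sum>w\<in>Nb c \<inter> A. r * (G * ((11/10) / (real s + 1)) ^ (s - 1)))"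
  proof (rule sum_mono)
    fix w assume w: "w \<in> Nb c \<inter> A"
    have "thr k l (Out c) (In c) w \<le> r * G * m (Far w (Nb c)) ^ (s - 1)" using w by (intro thr_Nb_le) auto
    also have "\<dots> \<le> r * G * ((11/10) / (real s + 1)) ^ (s - 1)"
      using m_Far_Nb_le(2)[of w c] A_D[of w] w r_pos G_nonneg by (intro mult_left_mono power_mono) auto
    finally show "thr k l (Out c) (In c) w \<le> r * (G * ((11/10) / (real s + 1)) ^ (s - 1))" by simp
  qed
  also have "\<dots> = av c * (G * ((11/10) / (real s + 1)) ^ (s - 1))" unfolding av_def by (rule sum_r_const) simp
  also have "\<dots> = av c * (\<kappa> * lam)" by (simp add: G_def lam_def)
  also have "\<dots> \<le> (3/20) * (\<kappa> * lam)"
  proof (rule mult_right_mono)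
    have "(101/100) / (real s + 1) \<le> (101/100) / 7" using s_real by (intro divide_left_mono) auto
    then show "av c \<le> (3/20)" using av_le[of c] a_le by simp
  qed (use \<kappa>_pos lam_nonneg in auto)
  finally have "cc k l c \<le> cnt k l (Out c \<inter> B) (In c \<inter> B) + (3/20) * (\<kappa> * lam)"
    using cc_split_A[of c] by linarith
  moreover have "cnt k l (Out c \<inter> B) (In c \<inter> B) \<le> p c ^ k * q c ^ l"
    unfolding p_def q_def by (rule cnt_le) auto
  ultimately have "p c ^ k * q c ^ l \<ge> Z - \<kappa> * ((23/20) * lam + eps)"
    using cc_A[OF c] by (simp add: algebra_simps)
  moreover have "(23/20) * lam + eps \<le> (9/50) / real s ^ 2 * ww s"
    using lam_eps s_real by (simp add: field_simps)
  then have "\<kappa> * ((23/20) * lam + eps) \<le> \<kappa> * ((9/50) / real s ^ 2 * ww s)" using \<kappa>_pos by (intro mult_left_mono) auto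
  ultimately show ?thesis using Z_ge by (simp add: algebra_simps)
qed

text \<open>By \<open>a_ge\<close>, b exceeds the optimal s/(s+1) at most by a factor 1 + u/s with u
  = (23/50)/s^2, and exp u (1 - u) \<le> 1.\<close>

lemma b_pow: "b ^ s * (1 - (23/50) / real s ^ 2) \<le> ww s"
proof -
  define u where "u = (23/50) / real s ^ 2"
  have u: "0 \<le> u" "u \<le> 1" using s2 by (auto simp: u_def divide_le_eq)
  have "real s / (real s + 1) * (1 + u / s) = 1 - (1 - u) / (real s + 1)"
    using s_real by (simp add: divide_simps)
  moreover have "b \<le> 1 - (1 - u) / (real s + 1)" using ab a_ge by (simp add: u_def)
  ultimately have "b ^ s \<le> (real s / (real s + 1) * (1 + u / s)) ^ s"
    using b_nonneg by (intro power_mono) auto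
  also have "\<dots> = ww s * (1 + u / s) ^ s" by (simp only: ww_def power_mult_distrib)
  also have "\<dots> \<le> ww s * exp u"
  proof (rule mult_left_mono)
    have "(1 + u / s) ^ s \<le> exp (u / s) ^ s" using u exp_ge_add_one_self[of "u / s"] by (intro power_mono) auto
    also have "\<dots> = exp u" using s_real by (simp add: exp_of_nat_mult[symmetric])
    finally show "(1 + u / s) ^ s \<le> exp u" .
  qed (use w_ge in auto)
  finally have "b ^ s * (1 - u) \<le> ww s * exp u * (1 - u)" using u by (intro mult_right_mono) auto
  also have "\<dots> \<le> ww s * exp u * exp (- u)"
    using exp_ge_add_one_self[of "- u"] w_ge by (intro mult_left_mono) auto
  also have "\<dots> = ww s" by (simp add: exp_minus)
  finally show ?thesis by (simp add: u_def)
qed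

text \<open>The relative errors 23/50 and 9/50 of \<open>b_pow\<close> and \<open>pq_ge\<close> add
  up to 64/100. Thus p and q are nearly optimal relative to b, both in their ratio and in their
  sum.\<close>

lemma pq_ge_b:
  assumes c: "c \<in> A" shows "p c ^ k * q c ^ l \<ge> \<kappa> * (b ^ s * (1 - (16/25) / real s ^ 2))"
proof -
  define x where "x = 1 / real s ^ 2"
  have x: "0 \<le> x" "x \<le> 1" using s2 by (auto simp: x_def divide_le_eq)
  have "1 - (16/25) * x \<le> (1 - (23/50) * x) * (1 - (9/50) * x)" using x by (simp add: algebra_simps)
  then have "b ^ s * (1 - (16/25) * x) \<le> b ^ s * ((1 - (23/50) * x) * (1 - (9/50) * x))"
    using b_nonneg by (intro mult_left_mono) auto
  also have "\<dots> = b ^ s * (1 - (23/50) * x) * (1 - (9/50) * x)" by simp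
  also have "\<dots> \<le> ww s * (1 - (9/50) * x)"
    using b_pow x by (intro mult_right_mono) (auto simp: x_def)
  finally have "\<kappa> * (b ^ s * (1 - (16/25) * x)) \<le> \<kappa> * (ww s * (1 - (9/50) * x))"
    using \<kappa>_pos by (intro mult_left_mono) auto
  then show ?thesis using pq_ge[OF c] by (simp add: x_def)
qed

end

section \<open>Stars by the position of their centre and leaves\<close>

lemma ee_pred_le: "s \<ge> 3 \<Longrightarrow> ee (s - 1) \<le> (109/40)"
  by (rule ee_le) simp

context wdigraph
begin

section \<open>Stars through two given leaves, and losses caused by adjacent candidates\<close>

definition thr2 :: "nat \<Rightarrow> nat \<Rightarrow> nat set \<Rightarrow> nat set \<Rightarrow> nat \<Rightarrow> nat \<Rightarrow> real" where
  "thr2 k l P Q w v = W k l {F \<in> sel E k l P Q. w \<in> fst F \<union> snd F \<and> v \<in> fst F \<union> snd F}"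

lemma thr2_out:
  assumes "finite P" "finite Q" "P \<inter> Q = {}" "w \<in> P" "v \<noteq> w" "k \<ge> 1"
  shows "thr2 k l P Q w v \<le> r * k * thr (k - 1) l (Far w P) (Far w Q) v"
proof -
  have "card {F \<in> sel E k l P Q. w \<in> fst F \<union> snd F \<and> v \<in> fst F \<union> snd F} \<le>
      card {F \<in> sel E (k - 1) l (Far w P) (Far w Q). v \<in> fst F \<union> snd F}"
  proof (rule card_inj_on_le[where f = "\<lambda>F. (fst F - {w}, snd F)"])
    show "inj_on (\<lambda>F. (fst F - {w}, snd F)) {F \<in> sel E k l P Q. w \<in> fst F \<union> snd F \<and> v \<in> fst F \<union> snd F}"
      using assms by (auto simp: inj_on_def sel_def)
    show "(\<lambda>F. (fst F - {w}, snd F)) ` {F \<in> sel E k l P Q. w \<in> fst F \<union> snd F \<and> v \<in> fst F \<union> snd F} \<subseteq>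
        {F \<in> sel E (k - 1) l (Far w P) (Far w Q). v \<in> fst F \<union> snd F}"
    proof
      fix F' assume "F' \<in> (\<lambda>F. (fst F - {w}, snd F)) ` {F \<in> sel E k l P Q. w \<in> fst F \<union> snd F \<and> v \<in> fst F \<union> snd F}"
      then obtain K L where F': "F' = (K - {w}, L)" and F: "(K, L) \<in> sel E k l P Q" "w \<in> K \<union> L" "v \<in> K \<union> L"
        by auto
      have w: "w \<in> K" using F assms by (auto simp: sel_def)
      have "finite K" using F assms by (auto simp: sel_def intro: finite_subset)
      then have "card (K - {w}) = k - 1" using w F by (auto simp: sel_def)
      then show "F' \<in> {F \<in> sel E (k - 1) l (Far w P) (Far w Q). v \<in> fst F \<union> snd F}"
        using F w assms by (auto simp: F' sel_def far_def indep_def)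
    qed
    show "finite {F \<in> sel E (k - 1) l (Far w P) (Far w Q). v \<in> fst F \<union> snd F}"
      using assms by (intro finite_selF) auto
  qed
  then have "W k l {F \<in> sel E k l P Q. w \<in> fst F \<union> snd F \<and> v \<in> fst F \<union> snd F} \<le>
     r ^ (k + l) * (fact k * fact l) * card {F \<in> sel E (k - 1) l (Far w P) (Far w Q). v \<in> fst F \<union> snd F}"
    unfolding W_def using r_pos by (intro mult_left_mono) auto
  also have "\<dots> = r * k * thr (k - 1) l (Far w P) (Far w Q) v"
    using \<open>k \<ge> 1\<close> by (cases k) (simp_all add: thr_def W_def algebra_simps)
  finally show ?thesis unfolding thr2_def .
qed

lemma thr2_swap: "thr2 k l P Q w v = thr2 l k Q P w v"
proof -
  have "{F \<in> sel E l k Q P. w \<in> fst F \<union> snd F \<and> v \<in> fst F \<union> snd F} =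
      prod.swap ` {F \<in> sel E k l P Q. w \<in> fst F \<union> snd F \<and> v \<in> fst F \<union> snd F}"
    by (auto simp: sel_def image_iff Un_commute)
  then show ?thesis by (simp add: thr2_def W_def card_image algebra_simps)
qed

text \<open>First w is fixed, then v among the remaining leaves. The constant 15/2 rounds up
  (109/40)^2, which bounds the product of the values of \<open>ee\<close> at k + l and k + l -
  1.\<close>

lemma thr2_le_aux:
  assumes "finite P" "finite Q" "P \<inter> Q = {}" "w \<in> P" "v \<noteq> w" "k + l \<ge> 3"
  shows "thr2 k l P Q w v \<le> r ^ 2 * ((15/2) * real (k + l) * real (k + l - 1) * kap k l) * m (Far w (P \<union> Q)) ^ (k + l - 2)"
proof (cases "k = 0")
  case True
  have e: "{F \<in> sel E k l P Q. w \<in> fst F \<union> snd F \<and> v \<in> fst F \<union> snd F} = {}"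
    using True assms by (auto simp: sel_def dest: finite_subset)
  show ?thesis unfolding thr2_def e using kap_nonneg[of k l] assms r_pos by (simp add: W_def)
next
  case False
  then have k: "k \<ge> 1" by simp
  let ?P = "Far w P" and ?Q = "Far w Q"
  have fin: "finite ?P" "finite ?Q" "?P \<inter> ?Q = {}" using assms by (auto simp: far_def)
  have un: "?P \<union> ?Q = Far w (P \<union> Q)" by (simp add: far_Un)
  have s: "k - 1 + l = k + l - 1" "k + l - 1 - 1 = k + l - 2" using k by auto
  have e1: "ee (k + l - 1) \<ge> 0" "ee (k + l) \<ge> 0" using assms by (auto intro: ee_nonneg)
  have k0: "kap (k - 1) l \<ge> 0" "kap k l \<ge> 0" by (rule kap_nonneg)+
  have 1: "thr (k - 1) l ?P ?Q v \<le> r * (real (k + l - 1) * ee (k + l - 1) * kap (k - 1) l) * m (Far w (P \<union> Q)) ^ (k + l - 2)"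
  proof (cases "v \<in> ?P \<union> ?Q")
    case True
    have "thr (k - 1) l ?P ?Q v \<le> r * (real (k - 1 + l) * ee (k - 1 + l) * kap (k - 1) l) * m (Far v (?P \<union> ?Q)) ^ (k - 1 + l - 1)"
      using True assms k by (intro thr_le fin) auto
    also have "\<dots> \<le> r * (real (k + l - 1) * ee (k + l - 1) * kap (k - 1) l) * m (Far w (P \<union> Q)) ^ (k + l - 2)"
      unfolding s un using assms r_pos e1 k0
      by (intro mult_left_mono power_mono m_mono far_subset) auto
    finally show ?thesis .
  next
    case False
    then have "thr (k - 1) l ?P ?Q v = 0" by (rule thr_0)
    then show ?thesis using r_pos e1 k0 by simp
  qed
  define X where "X = m (Far w (P \<union> Q)) ^ (k + l - 2)"
  have X: "X \<ge> 0" by (simp add: X_def)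
  have "thr2 k l P Q w v \<le> r * k * thr (k - 1) l ?P ?Q v"
    using assms k by (intro thr2_out) auto
  also have "\<dots> \<le> r * k * (r * (real (k + l - 1) * ee (k + l - 1) * kap (k - 1) l) * X)"
    using 1 r_pos unfolding X_def by (intro mult_left_mono) auto
  also have "\<dots> = r ^ 2 * ((k * kap (k - 1) l) * (real (k + l - 1) * ee (k + l - 1))) * X"
    by (simp add: power2_eq_square)
  also have "\<dots> \<le> r ^ 2 * ((real (k + l) * ee (k + l) * kap k l) * (real (k + l - 1) * ee (k + l - 1))) * X"
    using kap_out[of k l] k assms e1 X by (intro mult_right_mono mult_left_mono) auto
  also have "\<dots> = r ^ 2 * ((ee (k + l) * ee (k + l - 1)) * (real (k + l) * real (k + l - 1) * kap k l)) * X"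
    by simp
  also have "\<dots> \<le> r ^ 2 * ((15/2) * (real (k + l) * real (k + l - 1) * kap k l)) * X"
  proof -
    have "ee (k + l) * ee (k + l - 1) \<le> (109/40) * (109/40)"
      using ee_le[of "k + l"] ee_pred_le[of "k + l"] assms e1 by (intro mult_mono) auto
    then have "ee (k + l) * ee (k + l - 1) \<le> (15/2)" by simp
    then show ?thesis using X k0 by (intro mult_right_mono mult_left_mono) auto
  qed
  finally show ?thesis by (simp only: X_def mult.assoc)
qed

lemma thr2_le:
  assumes "finite P" "finite Q" "P \<inter> Q = {}" "w \<in> P \<union> Q" "v \<noteq> w" "k + l \<ge> 3"
  shows "thr2 k l P Q w v \<le> r ^ 2 * ((15/2) * real (k + l) * real (k + l - 1) * kap k l) * m (Far w (P \<union> Q)) ^ (k + l - 2)"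
proof (cases "w \<in> P")
  case True then show ?thesis using assms by (intro thr2_le_aux) auto
next
  case False
  then have "thr2 l k Q P w v \<le> r ^ 2 * ((15/2) * real (l + k) * real (l + k - 1) * kap l k) * m (Far w (Q \<union> P)) ^ (l + k - 2)"
    using assms by (intro thr2_le_aux) auto
  then show ?thesis by (simp add: thr2_swap[of k l] kap_commute[of l k] add.commute[of l k] Un_commute[of Q P])
qed

text \<open>The first leaf v is taken from P. The second one is taken from P with weight m P and
  from Q with weight m Q, so that the two contributions add up to the measure of all of
  \<open>Far v (P \<union> Q)\<close>; the other leaves are free. A second leaf in P exists because
  k \<ge> 2.\<close>

lemma cnt_pair_out:
  assumes "finite P" "finite Q" "P \<inter> Q = {}" "k \<ge> 2" "l \<ge> 1"
  shows "(m P + m Q) * cnt k l P Q \<le> m P ^ (k - 1) * m Q ^ l * (\<Sum>v\<in>P. r * m (Far v (P \<union> Q)))"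
proof -
  have mP: "m (Far v P) \<le> m P" "m (Far v Q) \<le> m Q" for v
    using assms by (simp_all add: m_mono[OF far_subset])
  have b1: "m P * cnt (k - 1) l (Far v P) (Far v Q) \<le> m P ^ (k - 1) * m Q ^ l * m (Far v P)" for v
  proof -
    have "cnt (k - 1) l (Far v P) (Far v Q) \<le> m (Far v P) ^ (k - 1) * m (Far v Q) ^ l"
      using assms by (intro cnt_le) auto
    also have "\<dots> = m (Far v P) * m (Far v P) ^ (k - 2) * m (Far v Q) ^ l"
      using assms power_Suc[of "m (Far v P)" "k - 2"] by (simp add: Suc_diff_Suc numeral_2_eq_2)
    also have "\<dots> \<le> m (Far v P) * m P ^ (k - 2) * m Q ^ l"
      using mP by (intro mult_mono power_mono) auto
    finally have "m P * cnt (k - 1) l (Far v P) (Far v Q) \<le> m P * (m (Far v P) * m P ^ (k - 2) * m Q ^ l)"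
      by (intro mult_left_mono) auto
    also have "\<dots> = m P ^ (k - 1) * m Q ^ l * m (Far v P)"
      using assms power_Suc[of "m P" "k - 2"] by (simp add: Suc_diff_Suc numeral_2_eq_2)
    finally show ?thesis .
  qed
  have b2: "m Q * cnt (k - 1) l (Far v P) (Far v Q) \<le> m P ^ (k - 1) * m Q ^ l * m (Far v Q)" for v
  proof -
    have "cnt (k - 1) l (Far v P) (Far v Q) \<le> m (Far v P) ^ (k - 1) * m (Far v Q) ^ l"
      using assms by (intro cnt_le) auto
    also have "\<dots> = m (Far v P) ^ (k - 1) * (m (Far v Q) ^ (l - 1) * m (Far v Q))"
      using assms power_Suc[of "m (Far v Q)" "l - 1"] by simp
    also have "\<dots> \<le> m P ^ (k - 1) * (m Q ^ (l - 1) * m (Far v Q))"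
      using mP by (intro mult_mono power_mono) auto
    finally have "m Q * cnt (k - 1) l (Far v P) (Far v Q) \<le> m Q * (m P ^ (k - 1) * (m Q ^ (l - 1) * m (Far v Q)))"
      by (intro mult_left_mono) auto
    also have "\<dots> = m P ^ (k - 1) * m Q ^ l * m (Far v Q)"
      using assms power_Suc[of "m Q" "l - 1"] by simp
    finally show ?thesis .
  qed
  have "(m P + m Q) * cnt k l P Q \<le> (m P + m Q) * (\<Sum>v\<in>P. r * cnt (k - 1) l (Far v P) (Far v Q))"
    using assms by (intro mult_left_mono cnt_expand_out) auto
  also have "\<dots> = (\<Sum>v\<in>P. r * (m P * cnt (k - 1) l (Far v P) (Far v Q) + m Q * cnt (k - 1) l (Far v P) (Far v Q)))"
    by (simp add: sum_distrib_left algebra_simps)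
  also have "\<dots> \<le> (\<Sum>v\<in>P. r * (m P ^ (k - 1) * m Q ^ l * m (Far v P) + m P ^ (k - 1) * m Q ^ l * m (Far v Q)))"
    using b1 b2 r_pos by (intro sum_mono mult_left_mono add_mono) auto
  also have "\<dots> = m P ^ (k - 1) * m Q ^ l * (\<Sum>v\<in>P. r * m (Far v (P \<union> Q)))"
  proof -
    have "m (Far v (P \<union> Q)) = m (Far v P) + m (Far v Q)" for v
      unfolding far_Un using assms by (intro m_Un) (auto simp: far_def)
    then show ?thesis by (simp add: sum_distrib_left algebra_simps)
  qed
  finally show ?thesis .
qed

text \<open>Now the first leaf is taken from P or Q, again with weights m P and m Q. The result is
  the trivial bound times the proportion of non-adjacent ordered pairs in P \<union> Q: each
  adjacent pair of candidates is a loss. In-leaves as first leaves require l \<ge> 2.\<close>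

lemma cnt_pair:
  assumes "finite P" "finite Q" "P \<inter> Q = {}" "k \<ge> 2" "l \<ge> 2"
  shows "(m P + m Q) ^ 2 * cnt k l P Q \<le> m P ^ k * m Q ^ l * (\<Sum>v\<in>P \<union> Q. r * m (Far v (P \<union> Q)))"
proof -
  have 1: "(m P + m Q) * cnt k l P Q \<le> m P ^ (k - 1) * m Q ^ l * (\<Sum>v\<in>P. r * m (Far v (P \<union> Q)))"
    using assms by (intro cnt_pair_out) auto
  have "(m Q + m P) * cnt l k Q P \<le> m Q ^ (l - 1) * m P ^ k * (\<Sum>v\<in>Q. r * m (Far v (Q \<union> P)))"
    using assms by (intro cnt_pair_out) auto
  then have 2: "(m P + m Q) * cnt k l P Q \<le> m P ^ k * m Q ^ (l - 1) * (\<Sum>v\<in>Q. r * m (Far v (P \<union> Q)))"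
    by (simp add: cnt_swap[of l k] add.commute Un_commute mult.commute)
  have "(m P + m Q) ^ 2 * cnt k l P Q = m P * ((m P + m Q) * cnt k l P Q) + m Q * ((m P + m Q) * cnt k l P Q)"
    by (simp add: power2_eq_square algebra_simps)
  also have "\<dots> \<le> m P * (m P ^ (k - 1) * m Q ^ l * (\<Sum>v\<in>P. r * m (Far v (P \<union> Q)))) +
      m Q * (m P ^ k * m Q ^ (l - 1) * (\<Sum>v\<in>Q. r * m (Far v (P \<union> Q))))"
    using 1 2 by (intro add_mono mult_left_mono) auto
  also have "\<dots> = (m P * m P ^ (k - 1)) * m Q ^ l * (\<Sum>v\<in>P. r * m (Far v (P \<union> Q))) +
      m P ^ k * (m Q * m Q ^ (l - 1)) * (\<Sum>v\<in>Q. r * m (Far v (P \<union> Q)))" by (simp only: mult_ac)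
  also have "\<dots> = m P ^ k * m Q ^ l * (\<Sum>v\<in>P. r * m (Far v (P \<union> Q))) +
      m P ^ k * m Q ^ l * (\<Sum>v\<in>Q. r * m (Far v (P \<union> Q)))"
    using assms power_Suc[of "m P" "k - 1"] power_Suc[of "m Q" "l - 1"] by simp
  also have "\<dots> = m P ^ k * m Q ^ l * (\<Sum>v\<in>P \<union> Q. r * m (Far v (P \<union> Q)))"
    using assms by (simp add: sum.union_disjoint distrib_left)
  finally show ?thesis .
qed

text \<open>Counting stars by an out-leaf w: this is where the concave envelope of x^k (1-x)^l enters, since
  its slope at 0 is the maximum of x^(k-1) (1-x)^l.\<close>

lemma sum_cnt_out:
  assumes X: "finite X" and Y: "finite Y" and k: "k \<ge> 1"
  shows "(\<Sum>x\<in>X. r * cnt k l (Out x \<inter> Y) (In x \<inter> Y)) \<le>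
     (\<Sum>w\<in>Y. r * (m (In w \<inter> X) * (kap (k - 1) l * m (Far w Y) ^ (k + l - 1))))"
proof -
  have "(\<Sum>x\<in>X. r * cnt k l (Out x \<inter> Y) (In x \<inter> Y)) \<le>
      (\<Sum>x\<in>X. \<Sum>w\<in>Out x \<inter> Y. r * (r * (kap (k - 1) l * m (Far w Y) ^ (k + l - 1))))"
  proof (rule sum_mono)
    fix x assume "x \<in> X"
    have dj: "(Out x \<inter> Y) \<inter> (In x \<inter> Y) = {}" using outs_ins_disjoint by blast
    have "cnt k l (Out x \<inter> Y) (In x \<inter> Y) \<le>
        (\<Sum>w\<in>Out x \<inter> Y. r * cnt (k - 1) l (Far w (Out x \<inter> Y)) (Far w (In x \<inter> Y)))"
      using dj k by (intro cnt_expand_out) auto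
    also have "\<dots> \<le> (\<Sum>w\<in>Out x \<inter> Y. r * (kap (k - 1) l * m (Far w Y) ^ (k + l - 1)))"
    proof (intro sum_mono mult_left_mono)
      fix w
      have "cnt (k - 1) l (Far w (Out x \<inter> Y)) (Far w (In x \<inter> Y)) \<le>
          kap (k - 1) l * m (Far w (Out x \<inter> Y) \<union> Far w (In x \<inter> Y)) ^ (k - 1 + l)"
        using outs_ins_disjoint by (intro cnt_le_kap) (auto simp: far_def)
      also have "\<dots> \<le> kap (k - 1) l * m (Far w Y) ^ (k - 1 + l)"
        using kap_nonneg Y by (intro mult_left_mono power_mono m_mono) (auto simp: far_def)
      finally show "cnt (k - 1) l (Far w (Out x \<inter> Y)) (Far w (In x \<inter> Y)) \<le> kap (k - 1) l * m (Far w Y) ^ (k + l - 1)"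
        using k by simp
    qed (use r_pos in auto)
    finally show "r * cnt k l (Out x \<inter> Y) (In x \<inter> Y) \<le>
        (\<Sum>w\<in>Out x \<inter> Y. r * (r * (kap (k - 1) l * m (Far w Y) ^ (k + l - 1))))"
      using r_pos by (simp only: sum_distrib_left[symmetric] mult_left_mono less_imp_le)
  qed
  also have "\<dots> = (\<Sum>x\<in>X. \<Sum>w\<in>{w \<in> Y. w \<in> Out x}. r * (r * (kap (k - 1) l * m (Far w Y) ^ (k + l - 1))))"
    by (intro sum.cong) auto
  also have "\<dots> = (\<Sum>w\<in>Y. \<Sum>x\<in>{x \<in> X. w \<in> Out x}. r * (r * (kap (k - 1) l * m (Far w Y) ^ (k + l - 1))))"
    by (rule sum.swap_restrict[OF X Y])
  also have "\<dots> = (\<Sum>w\<in>Y. r * (m (In w \<inter> X) * (kap (k - 1) l * m (Far w Y) ^ (k + l - 1))))"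
  proof (rule sum.cong)
    fix w assume "w \<in> Y"
    have "{x \<in> X. w \<in> Out x} = In w \<inter> X" by (auto simp: outs_def ins_def)
    then show "(\<Sum>x\<in>{x \<in> X. w \<in> Out x}. r * (r * (kap (k - 1) l * m (Far w Y) ^ (k + l - 1)))) =
      r * (m (In w \<inter> X) * (kap (k - 1) l * m (Far w Y) ^ (k + l - 1)))" by (simp add: m_def)
  qed simp
  finally show ?thesis .
qed

lemma sum_m_Int_swap:
  assumes "finite X" "finite Y" "\<And>x y. x \<in> X \<Longrightarrow> y \<in> Y \<Longrightarrow> y \<in> N x \<longleftrightarrow> x \<in> N' y"
  shows "(\<Sum>x\<in>X. r * (m (N x \<inter> Y) * f x)) = (\<Sum>y\<in>Y. r * (\<Sum>x\<in>N' y \<inter> X. r * f x))"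
proof -
  have "(\<Sum>x\<in>X. r * (m (N x \<inter> Y) * f x)) = (\<Sum>x\<in>X. \<Sum>y\<in>{y \<in> Y. y \<in> N x}. r * (r * f x))"
  proof (rule sum.cong)
    fix x assume "x \<in> X"
    have "{y \<in> Y. y \<in> N x} = N x \<inter> Y" by auto
    then show "r * (m (N x \<inter> Y) * f x) = (\<Sum>y\<in>{y \<in> Y. y \<in> N x}. r * (r * f x))" by (simp add: m_def)
  qed simp
  also have "\<dots> = (\<Sum>y\<in>Y. \<Sum>x\<in>{x \<in> X. y \<in> N x}. r * (r * f x))"
    by (rule sum.swap_restrict[OF assms(1,2)])
  also have "\<dots> = (\<Sum>y\<in>Y. r * (\<Sum>x\<in>N' y \<inter> X. r * f x))"
  proof (rule sum.cong)
    fix y assume "y \<in> Y"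
    then have "{x \<in> X. y \<in> N x} = N' y \<inter> X" using assms(3) by auto
    then show "(\<Sum>x\<in>{x \<in> X. y \<in> N x}. r * (r * f x)) = r * (\<Sum>x\<in>N' y \<inter> X. r * f x)"
      by (simp add: sum_distrib_left)
  qed simp
  finally show ?thesis .
qed

lemma sum_m_Int_swap1:
  assumes "finite X" "finite Y" "\<And>x y. x \<in> X \<Longrightarrow> y \<in> Y \<Longrightarrow> y \<in> N x \<longleftrightarrow> x \<in> N' y"
  shows "(\<Sum>x\<in>X. r * m (N x \<inter> Y)) = (\<Sum>y\<in>Y. r * m (N' y \<inter> X))"
  using sum_m_Int_swap[OF assms, of "\<lambda>_. 1"] by (simp add: m_def mult.commute)

end

lemma decay_pred:
  fixes \<rho> x :: real
  assumes "s \<ge> 6" "0 \<le> x" "x \<le> \<rho>" "\<rho> \<le> 5/6"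
  shows "(real s - 1) * x ^ (s - 2) \<le> 5 * \<rho> ^ 4"
proof -
  have "(real s - 1) * \<rho> ^ (s - 2) \<le> 5 * \<rho> ^ 4"
    using assms(1)
  proof (induction s rule: nat_induct_at_least)
    case (Suc s)
    have "(real (Suc s) - 1) * \<rho> \<le> (6/5 * (real s - 1)) * (5/6)"
      using Suc assms by (intro mult_mono) auto
    then have "(real (Suc s) - 1) * \<rho> * \<rho> ^ (s - 2) \<le> (real s - 1) * \<rho> ^ (s - 2)"
      using assms by (intro mult_right_mono) auto
    moreover have e: "Suc s - 2 = Suc (s - 2)" using Suc by simp
    ultimately show ?case using Suc unfolding e power_Suc by (simp add: mult.assoc)
  qed simp
  moreover have "(real s - 1) * x ^ (s - 2) \<le> (real s - 1) * \<rho> ^ (s - 2)"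
    using assms by (intro mult_left_mono power_mono) auto
  ultimately show ?thesis by linarith
qed

text \<open>Up to the factor \<open>\<kappa>\<close>, the first summand bounds \<open>Gam\<close>
  and the second one \<open>kp * a ^ (s - 1)\<close>. By \<open>sum_g_mu\<close>, 7/20 is what the
  main term loses per unit of \<open>mu\<close>.\<close>

lemma num_gam:
  assumes s: "s \<ge> 6"
  shows "(15/2) * real s * (real s - 1) * ((101/100) / (real s + 1) * ((11/10) / (real s + 1)) ^ (s - 2)
     + (21/20) / (real s + 1) * ((103/50) / (real s + 1)) ^ (s - 2)) + (109/20) * ((101/100) / (real s + 1)) ^ (s - 1) \<le> (7/20)"
proof -
  define y1 y2 y3 where "y1 = ((11/10) / (real s + 1)) ^ (s - 2)" and "y2 = ((103/50) / (real s + 1)) ^ (s - 2)"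
    and "y3 = ((101/100) / (real s + 1)) ^ (s - 1)"
  have nn: "0 \<le> y1" "0 \<le> y2" by (simp_all add: y1_def y2_def)
  have d: "(11/10) / (real s + 1) \<le> (11/10) / 7" "(103/50) / (real s + 1) \<le> (103/50) / 7" "(101/100) / (real s + 1) \<le> (101/100) / 7"
    using s by (simp_all add: field_simps)
  have 1: "(real s - 1) * y1 \<le> 5 * ((11/10) / 7) ^ 4" unfolding y1_def using s d by (intro decay_pred) auto
  have 2: "(real s - 1) * y2 \<le> 5 * ((103/50) / 7) ^ 4" unfolding y2_def using s d by (intro decay_pred) auto
  have "y3 \<le> ((101/100) / 7) ^ (s - 1)" unfolding y3_def using d by (intro power_mono) auto
  also have "\<dots> \<le> ((101/100) / 7) ^ 5" using s by (intro power_decreasing) auto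
  finally have 3: "y3 \<le> ((101/100) / 7) ^ 5" .
  have r: "real s * (1 / (real s + 1)) \<le> 1" by simp
  have "(15/2) * real s * (real s - 1) * ((101/100) / (real s + 1) * y1 + (21/20) / (real s + 1) * y2) =
     ((15/2) * ((101/100) * ((real s - 1) * y1) + (21/20) * ((real s - 1) * y2))) * (real s * (1 / (real s + 1)))"
  proof -
    define X where "X = 1 / (real s + 1)"
    have X: "c / (real s + 1) = c * X" for c by (simp add: X_def)
    have "c1 * S * R * (c2 * X * y1 + c3 * X * y2) = c1 * (c2 * (R * y1) + c3 * (R * y2)) * (S * X)"
      for c1 c2 c3 S R X y1 y2 :: real by (simp add: algebra_simps)
    then show ?thesis unfolding X mult_1 by this
  qed
  also have "\<dots> \<le> ((15/2) * ((101/100) * ((real s - 1) * y1) + (21/20) * ((real s - 1) * y2))) * 1"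
    using r nn s by (intro mult_left_mono) auto
  also have "\<dots> \<le> 33/100"
  proof -
    define u1 u2 where "u1 = (real s - 1) * y1" and "u2 = (real s - 1) * y2"
    show ?thesis using 1 2 unfolding u1_def[symmetric] u2_def[symmetric] by (simp add: power_numeral_reduce)
  qed
  finally have L: "(15/2) * real s * (real s - 1) * ((101/100) / (real s + 1) * y1 + (21/20) / (real s + 1) * y2) \<le> 33/100" .
  have y: "(109/20) * y3 \<le> 1/100" using 3 by (simp add: power_numeral_reduce)
  show ?thesis using add_mono[OF L y] unfolding y1_def y2_def y3_def by (rule order_trans) simp
qed

text \<open>Here a is the measure of A, z that of the neighbours in A of a leaf w, and Q essentially
  that of its in-neighbours in B. The neighbours in A may add z to the centres available for w but
  are removed from the candidates for the n other leaves; for a \<le> n Q the loss prevails.\<close>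

lemma star_exchange:
  fixes a z Q :: real
  assumes "0 \<le> z" "z \<le> a" "a \<le> real n * Q" "n \<ge> 1" "Q \<ge> 0"
  shows "(a - z) ^ n * (Q + z) \<le> a ^ n * Q"
proof (cases "a = 0")
  case True then show ?thesis using assms by (auto simp: power_0_left)
next
  case False
  define y where "y = z / a"
  have y: "0 \<le> y" "y \<le> 1" "z = y * a" using assms False by (auto simp: y_def divide_le_eq)
  have "y * a \<le> y * (real n * Q)" using assms y by (intro mult_left_mono) auto
  then have 1: "Q + z \<le> Q * (1 + real n * y)" using y by (simp add: algebra_simps)
  have "(1 - y) ^ n * (1 + real n * y) \<le> (1 - y) ^ n * (1 + y) ^ n"
    using Bernoulli_inequality[of y n] y by (intro mult_left_mono) auto
  also have "\<dots> = (1 - y ^ 2) ^ n" by (simp add: power_mult_distrib[symmetric] algebra_simps power2_eq_square)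
  also have "\<dots> \<le> 1" using y by (intro power_le_one) (auto simp: power_le_one)
  finally have 2: "(1 - y) ^ n * (1 + real n * y) \<le> 1" .
  have "(a - z) ^ n * (Q + z) \<le> (a - z) ^ n * (Q * (1 + real n * y))"
    using 1 assms by (intro mult_left_mono) auto
  also have "\<dots> = a ^ n * Q * ((1 - y) ^ n * (1 + real n * y))"
  proof -
    have e: "a - z = a * (1 - y)" using y by (simp add: algebra_simps)
    show ?thesis unfolding e by (simp add: power_mult_distrib)
  qed
  also have "\<dots> \<le> a ^ n * Q * 1" using 2 assms by (intro mult_left_mono) auto
  finally show ?thesis by simp
qed

context balanced
begin

text \<open>tt Y x counts the stars with centre x and all leaves in Y; mu is the measure of the set of
  pairs between A and B that are not joined by exactly one arc.\<close>

definition tt where "tt Y x = cnt k l (Out x \<inter> Y) (In x \<inter> Y)"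
definition kp where "kp = kap (k - 1) l"
definition mix where "mix x = W k l {F \<in> sel E k l (Out x) (In x). \<exists>w\<in>A. \<exists>v\<in>B. w \<in> fst F \<union> snd F \<and> v \<in> fst F \<union> snd F}"
definition mu where "mu = (\<Sum>c\<in>A. r * (b - bt c))"
definition G2 where "G2 = (15/2) * real s * (real s - 1) * \<kappa>"

lemma kp_nonneg: "kp \<ge> 0" unfolding kp_def by (rule kap_nonneg)

lemma kp_le: "kp \<le> (109/20) * \<kappa>"
proof -
  have "real k * kp \<le> real s * ee s * \<kappa>"
    using kap_out[of k l] k1 l1 by (simp add: kp_def \<kappa>_def s_def)
  also have "\<dots> \<le> (2 * real k) * (109/40) * \<kappa>"
    using kl s6 ee_le[of s] ee_nn \<kappa>_pos s_def by (intro mult_right_mono mult_mono) auto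
  finally have "real k * kp \<le> real k * ((109/20) * \<kappa>)" by simp
  then show ?thesis using k1 by simp
qed

lemma tt_le: "finite Y \<Longrightarrow> tt Y x \<le> \<kappa> * m (Nb x \<inter> Y) ^ s"
proof -
  assume "finite Y"
  have "Nb x \<inter> Y = (Out x \<inter> Y) \<union> (In x \<inter> Y)" by (auto simp: nb_def)
  then show ?thesis unfolding tt_def \<kappa>_def s_def using outs_ins_disjoint[of E x]
    by (simp only:) (rule cnt_le_kap; auto)
qed

lemma mu_nonneg: "mu \<ge> 0" unfolding mu_def using bt_le_b r_pos by (intro sum_nonneg) auto

lemma mu_B: "(\<Sum>v\<in>B. r * (a - av v)) = mu"
proof -
  have "(\<Sum>v\<in>B. r * av v) = (\<Sum>c\<in>A. r * bt c)"
    unfolding av_def bt_def by (rule sum_m_Int_swap1) (auto simp: nb_sym)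
  moreover have "(\<Sum>v\<in>B. r * a) = b * a" unfolding b_def by (rule sum_r_const) simp
  moreover have "(\<Sum>v\<in>A. r * b) = a * b" unfolding a_def by (rule sum_r_const) simp
  ultimately show ?thesis unfolding mu_def by (simp add: right_diff_distrib sum_subtractf del: sum_constant)
qed

lemma m_Far_le: "finite Y \<Longrightarrow> m (Far v Y) \<le> m Y - m (Nb v \<inter> Y)"
proof -
  assume Y: "finite Y"
  have "m (Far v Y) + m (Nb v \<inter> Y) = m (Far v Y \<union> (Nb v \<inter> Y))"
    using Y far_Int_nb[of E v Y] by (intro m_Un[symmetric]) auto
  also have "\<dots> \<le> m Y" using Y far_subset by (intro m_mono) auto
  finally show ?thesis by simp
qed

lemma far_mu: "(\<Sum>w\<in>A. r * m (Far w B)) \<le> mu" "(\<Sum>v\<in>B. r * m (Far v A)) \<le> mu"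
proof -
  show "(\<Sum>w\<in>A. r * m (Far w B)) \<le> mu" unfolding mu_def
    using m_Far_le[of B] r_pos by (intro sum_mono mult_left_mono) (auto simp: b_def bt_def)
  show "(\<Sum>v\<in>B. r * m (Far v A)) \<le> mu" unfolding mu_B[symmetric]
    using m_Far_le[of A] r_pos by (intro sum_mono mult_left_mono) (auto simp: a_def av_def)
qed

lemma cc_split: "cc k l x \<le> tt B x + tt A x + mix x"
proof -
  have sub: "sel E k l (Out x) (In x) \<subseteq> (sel E k l (Out x \<inter> B) (In x \<inter> B) \<union> sel E k l (Out x \<inter> A) (In x \<inter> A)) \<union>
    {F \<in> sel E k l (Out x) (In x). \<exists>w\<in>A. \<exists>v\<in>B. w \<in> fst F \<union> snd F \<and> v \<in> fst F \<union> snd F}"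
  proof
    fix F assume F: "F \<in> sel E k l (Out x) (In x)"
    obtain K L where KL: "F = (K, L)" by (metis surj_pair)
    have sb: "K \<subseteq> Out x" "L \<subseteq> In x" "K \<subseteq> A \<union> B" "L \<subseteq> A \<union> B"
      using F Out_V[of x] In_V[of x] AB by (auto simp: KL sel_def)
    consider "K \<union> L \<subseteq> A" | "K \<union> L \<subseteq> B" | "\<exists>w\<in>A. \<exists>v\<in>B. w \<in> K \<union> L \<and> v \<in> K \<union> L" using sb by blast
    then show "F \<in> (sel E k l (Out x \<inter> B) (In x \<inter> B) \<union> sel E k l (Out x \<inter> A) (In x \<inter> A)) \<union>
      {F \<in> sel E k l (Out x) (In x). \<exists>w\<in>A. \<exists>v\<in>B. w \<in> fst F \<union> snd F \<and> v \<in> fst F \<union> snd F}"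
      using F by cases (auto simp: KL sel_def)
  qed
  have "cc k l x \<le> W k l ((sel E k l (Out x \<inter> B) (In x \<inter> B) \<union> sel E k l (Out x \<inter> A) (In x \<inter> A)) \<union>
    {F \<in> sel E k l (Out x) (In x). \<exists>w\<in>A. \<exists>v\<in>B. w \<in> fst F \<union> snd F \<and> v \<in> fst F \<union> snd F})"
    unfolding cc_def cnt_def by (rule W_mono[OF sub]) (intro finite_UnI finite_sel finite_selF; simp)
  also have "\<dots> \<le> (W k l (sel E k l (Out x \<inter> B) (In x \<inter> B)) + W k l (sel E k l (Out x \<inter> A) (In x \<inter> A))) + mix x"
    unfolding mix_def by (rule order_trans[OF W_Un]) (intro add_right_mono W_Un)
  finally show ?thesis by (simp add: tt_def cnt_def)
qed

lemma thr2_Nb_le: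
  "w \<in> Nb x \<Longrightarrow> v \<noteq> w \<Longrightarrow> thr2 k l (Out x) (In x) w v \<le> r * (r * (G2 * m (Far w (Nb x)) ^ (s - 2)))"
proof -
  assume "w \<in> Nb x" "v \<noteq> w"
  then have "thr2 k l (Out x) (In x) w v \<le>
      r ^ 2 * ((15/2) * real (k + l) * real (k + l - 1) * kap k l) * m (Far w (Out x \<union> In x)) ^ (k + l - 2)"
    using s6 s_def by (intro thr2_le) (auto simp: nb_def outs_ins_disjoint)
  moreover have "real (k + l - 1) = real s - 1" using s6 s_def by simp
  ultimately show ?thesis unfolding G2_def \<kappa>_def nb_def
    by (simp add: s_def[symmetric] power2_eq_square mult_ac)
qed

lemma G2_nonneg: "G2 \<ge> 0" using s6 \<kappa>_pos by (simp add: G2_def)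

section \<open>Stars with leaves in both classes\<close>

definition Y1 where "Y1 = (11/10) / (real s + 1)"
definition Y2 where "Y2 = (103/50) / (real s + 1)"

text \<open>Such a star contains a non-adjacent pair w in A, v in B, and \<open>Far w\<close> has
  measure at most \<open>Y1\<close> because w has large degree. Summation over the non-adjacent
  pairs gives \<open>mu\<close>.\<close>

lemma mix_A: "mix x \<le> G2 * Y1 ^ (s - 2) * mu"
proof -
  have "mix x \<le> W k l (\<Union>w\<in>Nb x \<inter> A. \<Union>v\<in>Nb x \<inter> Far w B.
      {F \<in> sel E k l (Out x) (In x). w \<in> fst F \<union> snd F \<and> v \<in> fst F \<union> snd F})"
    unfolding mix_def
  proof (rule W_mono)
    show "{F \<in> sel E k l (Out x) (In x). \<exists>w\<in>A. \<exists>v\<in>B. w \<in> fst F \<union> snd F \<and> v \<in> fst F \<union> snd F} \<subseteq>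
       (\<Union>w\<in>Nb x \<inter> A. \<Union>v\<in>Nb x \<inter> Far w B. {F \<in> sel E k l (Out x) (In x). w \<in> fst F \<union> snd F \<and> v \<in> fst F \<union> snd F})"
    proof
      fix F assume "F \<in> {F \<in> sel E k l (Out x) (In x). \<exists>w\<in>A. \<exists>v\<in>B. w \<in> fst F \<union> snd F \<and> v \<in> fst F \<union> snd F}"
      then obtain w v where F: "F \<in> sel E k l (Out x) (In x)" "w \<in> A" "v \<in> B" "w \<in> fst F \<union> snd F" "v \<in> fst F \<union> snd F" by auto
      obtain K L where KL: "F = (K, L)" by (metis surj_pair)
      have "w \<in> Nb x" "v \<in> Nb x" "\<not> adj E w v" "v \<noteq> w" using F AB by (auto simp: KL sel_def nb_def indep_def)
      then show "F \<in> (\<Union>w\<in>Nb x \<inter> A. \<Union>v\<in>Nb x \<inter> Far w B. {F \<in> sel E k l (Out x) (In x). w \<in> fst F \<union> snd F \<and> v \<in> fst F \<union> snd F})"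
        using F by (auto simp: far_def)
    qed
  qed (intro finite_UN_I finite_selF finite_Int finFar; simp)
  also have "\<dots> \<le> (\<Sum>w\<in>Nb x \<inter> A. \<Sum>v\<in>Nb x \<inter> Far w B. thr2 k l (Out x) (In x) w v)"
    unfolding thr2_def by (rule order_trans[OF W_UN]) (auto intro!: sum_mono W_UN)
  also have "\<dots> \<le> (\<Sum>w\<in>Nb x \<inter> A. r * (m (Far w B) * (G2 * Y1 ^ (s - 2))))"
  proof (rule sum_mono)
    fix w assume w: "w \<in> Nb x \<inter> A"
    have "(\<Sum>v\<in>Nb x \<inter> Far w B. thr2 k l (Out x) (In x) w v) \<le> (\<Sum>v\<in>Nb x \<inter> Far w B. r * (r * (G2 * Y1 ^ (s - 2))))"
    proof (rule sum_mono)
      fix v assume v: "v \<in> Nb x \<inter> Far w B"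
      have "thr2 k l (Out x) (In x) w v \<le> r * (r * (G2 * m (Far w (Nb x)) ^ (s - 2)))"
        using v w by (intro thr2_Nb_le) (auto simp: far_def)
      also have "\<dots> \<le> r * (r * (G2 * Y1 ^ (s - 2)))"
        using m_Far_Nb_le(2)[of w x] A_D[of w] w r_pos G2_nonneg unfolding Y1_def
        by (intro mult_left_mono power_mono) auto
      finally show "thr2 k l (Out x) (In x) w v \<le> r * (r * (G2 * Y1 ^ (s - 2)))" .
    qed
    also have "\<dots> = m (Nb x \<inter> Far w B) * (r * (G2 * Y1 ^ (s - 2)))" by (rule sum_r_const) simp
    also have "\<dots> \<le> m (Far w B) * (r * (G2 * Y1 ^ (s - 2)))"
      using r_pos G2_nonneg by (intro mult_right_mono m_mono) (auto simp: Y1_def)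
    finally show "(\<Sum>v\<in>Nb x \<inter> Far w B. thr2 k l (Out x) (In x) w v) \<le> r * (m (Far w B) * (G2 * Y1 ^ (s - 2)))"
      by (simp add: mult_ac)
  qed
  also have "\<dots> \<le> (\<Sum>w\<in>A. r * (m (Far w B) * (G2 * Y1 ^ (s - 2))))"
    using r_pos G2_nonneg by (intro sum_mono2) (auto simp: Y1_def)
  also have "\<dots> = (\<Sum>w\<in>A. r * m (Far w B)) * (G2 * Y1 ^ (s - 2))" by (subst sum_distrib_right) (simp add: mult_ac)
  also have "\<dots> \<le> mu * (G2 * Y1 ^ (s - 2))" using far_mu(1) G2_nonneg by (intro mult_right_mono) (auto simp: Y1_def)
  finally show ?thesis by (simp add: mult_ac)
qed

text \<open>The sum over v is kept: interchanging it with the sum over x brings in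
  \<open>bt v\<close>, of order 1/(s+1), whereas summing the bound of \<open>mix_A\<close> over B
  would bring in b. The degree of x bounds the room for the other leaves.\<close>

lemma mix_B:
  assumes x: "x \<in> B"
  shows "mix x \<le> (\<Sum>v\<in>Nb x \<inter> B. r * (m (Far v A) * (G2 * Y2 ^ (s - 2))))"
proof -
  have "mix x \<le> W k l (\<Union>v\<in>Nb x \<inter> B. \<Union>w\<in>Nb x \<inter> Far v A.
      {F \<in> sel E k l (Out x) (In x). v \<in> fst F \<union> snd F \<and> w \<in> fst F \<union> snd F})"
    unfolding mix_def
  proof (rule W_mono)
    show "{F \<in> sel E k l (Out x) (In x). \<exists>w\<in>A. \<exists>v\<in>B. w \<in> fst F \<union> snd F \<and> v \<in> fst F \<union> snd F} \<subseteq>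
       (\<Union>v\<in>Nb x \<inter> B. \<Union>w\<in>Nb x \<inter> Far v A. {F \<in> sel E k l (Out x) (In x). v \<in> fst F \<union> snd F \<and> w \<in> fst F \<union> snd F})"
    proof
      fix F assume "F \<in> {F \<in> sel E k l (Out x) (In x). \<exists>w\<in>A. \<exists>v\<in>B. w \<in> fst F \<union> snd F \<and> v \<in> fst F \<union> snd F}"
      then obtain w v where F: "F \<in> sel E k l (Out x) (In x)" "w \<in> A" "v \<in> B" "w \<in> fst F \<union> snd F" "v \<in> fst F \<union> snd F" by auto
      obtain K L where KL: "F = (K, L)" by (metis surj_pair)
      have "w \<in> Nb x" "v \<in> Nb x" "\<not> adj E v w" "v \<noteq> w" using F AB by (auto simp: KL sel_def nb_def indep_def)
      then show "F \<in> (\<Union>v\<in>Nb x \<inter> B. \<Union>w\<in>Nb x \<inter> Far v A. {F \<in> sel E k l (Out x) (In x). v \<in> fst F \<union> snd F \<and> w \<in> fst F \<union> snd F})"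
        using F by (auto simp: far_def)
    qed
  qed (intro finite_UN_I finite_selF finite_Int finFar; simp)
  also have "\<dots> \<le> (\<Sum>v\<in>Nb x \<inter> B. \<Sum>w\<in>Nb x \<inter> Far v A. thr2 k l (Out x) (In x) v w)"
    unfolding thr2_def by (rule order_trans[OF W_UN]) (auto intro!: sum_mono W_UN)
  also have "\<dots> \<le> (\<Sum>v\<in>Nb x \<inter> B. r * (m (Far v A) * (G2 * Y2 ^ (s - 2))))"
  proof (rule sum_mono)
    fix v assume v: "v \<in> Nb x \<inter> B"
    have "(\<Sum>w\<in>Nb x \<inter> Far v A. thr2 k l (Out x) (In x) v w) \<le> (\<Sum>w\<in>Nb x \<inter> Far v A. r * (r * (G2 * Y2 ^ (s - 2))))"
    proof (rule sum_mono)
      fix w assume w: "w \<in> Nb x \<inter> Far v A"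
      have "thr2 k l (Out x) (In x) v w \<le> r * (r * (G2 * m (Far v (Nb x)) ^ (s - 2)))"
        using v w by (intro thr2_Nb_le) (auto simp: far_def)
      also have "\<dots> \<le> r * (r * (G2 * Y2 ^ (s - 2)))"
        using m_Far_Nb_le(1)[of v x] D_B[OF x] r_pos G2_nonneg unfolding Y2_def
        by (intro mult_left_mono power_mono) auto
      finally show "thr2 k l (Out x) (In x) v w \<le> r * (r * (G2 * Y2 ^ (s - 2)))" .
    qed
    also have "\<dots> = m (Nb x \<inter> Far v A) * (r * (G2 * Y2 ^ (s - 2)))" by (rule sum_r_const) simp
    also have "\<dots> \<le> m (Far v A) * (r * (G2 * Y2 ^ (s - 2)))"
      using r_pos G2_nonneg by (intro mult_right_mono m_mono) (auto simp: Y2_def)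
    finally show "(\<Sum>w\<in>Nb x \<inter> Far v A. thr2 k l (Out x) (In x) v w) \<le> r * (m (Far v A) * (G2 * Y2 ^ (s - 2)))"
      by (simp add: mult_ac)
  qed
  finally show ?thesis .
qed

definition Gam where "Gam = G2 * (a * Y1 ^ (s - 2) + (21/20) / (real s + 1) * Y2 ^ (s - 2))"

lemma sum_mix: "(\<Sum>x\<in>A. r * mix x) + (\<Sum>x\<in>B. r * mix x) \<le> Gam * mu"
proof -
  have "(\<Sum>x\<in>A. r * mix x) \<le> (\<Sum>x\<in>A. r * (G2 * Y1 ^ (s - 2) * mu))"
    using mix_A r_pos by (intro sum_mono mult_left_mono) auto
  also have "\<dots> = a * (G2 * Y1 ^ (s - 2) * mu)" unfolding a_def by (rule sum_r_const) simp
  finally have 1: "(\<Sum>x\<in>A. r * mix x) \<le> a * (G2 * Y1 ^ (s - 2) * mu)" .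
  have "(\<Sum>x\<in>B. r * mix x) \<le> (\<Sum>x\<in>B. r * (\<Sum>v\<in>Nb x \<inter> B. r * (m (Far v A) * (G2 * Y2 ^ (s - 2)))))"
    using mix_B r_pos by (intro sum_mono mult_left_mono) auto
  also have "\<dots> = (\<Sum>v\<in>B. r * (m (Nb v \<inter> B) * (m (Far v A) * (G2 * Y2 ^ (s - 2)))))"
    by (rule sum_m_Int_swap[symmetric]) (auto simp: nb_sym)
  also have "\<dots> \<le> (\<Sum>v\<in>B. r * ((21/20) / (real s + 1) * (m (Far v A) * (G2 * Y2 ^ (s - 2)))))"
    using bt_le G2_nonneg r_pos unfolding bt_def by (intro sum_mono mult_left_mono mult_right_mono) (auto simp: Y2_def)
  also have "\<dots> = (\<Sum>v\<in>B. r * m (Far v A)) * ((21/20) / (real s + 1) * (G2 * Y2 ^ (s - 2)))"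
    by (subst sum_distrib_right) (simp add: mult_ac)
  also have "\<dots> \<le> mu * ((21/20) / (real s + 1) * (G2 * Y2 ^ (s - 2)))"
    using far_mu(2) G2_nonneg by (intro mult_right_mono) (auto simp: Y2_def)
  finally show ?thesis using 1 by (simp add: Gam_def algebra_simps)
qed

lemma T_split: "T \<le> (\<Sum>c\<in>A. r * tt B c) + (\<Sum>u\<in>B. r * tt B u) + (\<Sum>x\<in>V. r * tt A x) + Gam * mu"
proof -
  have sp: "(\<Sum>x\<in>V. f x) = (\<Sum>x\<in>A. f x) + (\<Sum>x\<in>B. f x)" for f :: "nat \<Rightarrow> real"
    using AB finAB by (metis sum.union_disjoint)
  have "T \<le> (\<Sum>x\<in>V. r * (tt B x + tt A x + mix x))" unfolding T_def using cc_split r_pos by (intro sum_mono mult_left_mono) auto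
  also have "\<dots> = (\<Sum>x\<in>V. r * tt B x) + (\<Sum>x\<in>V. r * tt A x) + (\<Sum>x\<in>V. r * mix x)"
    by (simp add: distrib_left sum.distrib)
  finally show ?thesis using sum_mix by (simp add: sp)
qed

lemma Gam_kp: "Gam + kp * a ^ (s - 1) \<le> (7/20) * \<kappa>"
proof -
  have "Gam \<le> G2 * ((101/100) / (real s + 1) * Y1 ^ (s - 2) + (21/20) / (real s + 1) * Y2 ^ (s - 2))"
    unfolding Gam_def using a_le G2_nonneg by (intro mult_left_mono add_right_mono mult_right_mono) (auto simp: Y1_def)
  moreover have "kp * a ^ (s - 1) \<le> (109/20) * \<kappa> * ((101/100) / (real s + 1)) ^ (s - 1)"
    using kp_le a_le a_nonneg kp_nonneg \<kappa>_pos by (intro mult_mono power_mono) auto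
  moreover have "\<kappa> * ((15/2) * real s * (real s - 1) * ((101/100) / (real s + 1) * Y1 ^ (s - 2)
     + (21/20) / (real s + 1) * Y2 ^ (s - 2)) + (109/20) * ((101/100) / (real s + 1)) ^ (s - 1)) \<le> \<kappa> * (7/20)"
    using num_gam[OF s6] \<kappa>_pos unfolding Y1_def Y2_def by (intro mult_left_mono) auto
  moreover have "G2 * Z = \<kappa> * ((15/2) * real s * (real s - 1) * Z)" for Z by (simp add: G2_def)
  ultimately show ?thesis by (simp only: distrib_left)
qed

section \<open>Near-optimality of the bipartite digraph between A and B\<close>

lemma b_ge: "b \<ge> (real s - (1/100)) / (real s + 1)"
proof -
  have "1 - (101/100) / (real s + 1) = (real s - (1/100)) / (real s + 1)" by (simp add: divide_simps)
  then show ?thesis using ab a_le by linarith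
qed

lemma b_pos: "b > 0"
proof -
  have "(real s - (1/100)) / (real s + 1) > 0" using s6 by (intro divide_pos_pos) auto
  then show ?thesis using b_ge by linarith
qed

lemma s2': "1 / real s ^ 2 \<le> 1 / 36" "1 / real s ^ 2 \<ge> 0"
proof -
  show "1 / real s ^ 2 \<le> 1 / 36" by (rule divide_left_mono) (use s2 s6 in auto)
qed simp

lemma a_pos: "a > 0"
proof -
  have "(23/50) / real s ^ 2 = (23/50) * (1 / real s ^ 2)" by simp
  then have "(23/50) / real s ^ 2 < 1" using s2' by linarith
  then have "(1 - (23/50) / real s ^ 2) / (real s + 1) > 0" by (intro divide_pos_pos) auto
  then show ?thesis using a_ge by linarith
qed

lemma b_pow_ge: "n \<le> s \<Longrightarrow> b ^ n \<ge> (363/1000)"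
proof -
  assume n: "n \<le> s"
  have "(1 - (1/100) / real s) ^ s \<ge> 1 + s * (- ((1/100) / real s))"
    using Bernoulli_inequality[of "- ((1/100) / real s)" s] s6 by (simp add: divide_le_eq)
  then have "(1 - (1/100) / real s) ^ s \<ge> (99/100)" using s6 by simp
  then have "ww s * (99/100) \<le> ww s * (1 - (1/100) / real s) ^ s" using w_ge by (intro mult_left_mono) auto
  also have "\<dots> = (real s / (real s + 1) * (1 - (1/100) / real s)) ^ s" by (simp only: ww_def power_mult_distrib)
  also have "real s / (real s + 1) * (1 - (1/100) / real s) = (real s - (1/100)) / (real s + 1)"
  proof -
    have "real s * (1 - (1/100) / real s) = real s - (1/100)" using s6 by (simp add: right_diff_distrib)
    then show ?thesis by (simp only: times_divide_eq_left)
  qed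
  also have "((real s - (1/100)) / (real s + 1)) ^ s \<le> b ^ s" using b_ge s6 by (intro power_mono) auto
  also have "b ^ s \<le> b ^ n" using n b_nonneg b_le_1 by (intro power_decreasing) auto
  finally show ?thesis using w_ge by linarith
qed

text \<open>The value of d^k (1-d)^l at the out-share d = \<open>p c / bt c\<close>; its maximum is
  \<open>\<kappa>\<close>.\<close>

definition g where "g c = (p c / bt c) ^ k * (q c / bt c) ^ l"

lemma pq_g: "bt c > 0 \<Longrightarrow> p c ^ k * q c ^ l = g c * bt c ^ s"
  using power_add[of "bt c" k l, folded s_def] by (simp add: g_def power_divide)

lemma g_nonneg: "g c \<ge> 0" using pq_nonneg bt_nonneg by (simp add: g_def)

lemma g_le: "bt c > 0 \<Longrightarrow> g c \<le> \<kappa>"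
proof -
  assume bt: "bt c > 0"
  have "p c / bt c + q c / bt c = 1" using bt pq_bt[of c] by (simp add: add_divide_distrib[symmetric])
  then show ?thesis using pow_mult_pow_le_kap[of "p c / bt c" "q c / bt c" k l] pq_nonneg bt by (simp add: g_def \<kappa>_def)
qed

lemma bt_pos: "c \<in> A \<Longrightarrow> bt c > 0"
proof (rule ccontr)
  assume c: "c \<in> A" and "\<not> bt c > 0"
  then have "p c = 0" using pq_bt[of c] pq_nonneg[of c] bt_nonneg[of c] by linarith
  then have "p c ^ k * q c ^ l = 0" using k1 by simp
  moreover have "\<kappa> * (ww s * (1 - (9/50) / real s ^ 2)) > 0"
  proof -
    have "(9/50) / real s ^ 2 = (9/50) * (1 / real s ^ 2)" by simp
    then have "1 - (9/50) / real s ^ 2 > 0" using s2' by linarith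
    then show ?thesis using \<kappa>_pos w_ge by (intro mult_pos_pos) auto
  qed
  ultimately show False using pq_ge[OF c] by linarith
qed

text \<open>The small deficit in \<open>pq_ge_b\<close> may come from the ratio of p and q or from
  their sum; \<open>bt c\<close> \<le> b leaves it all to the ratio.\<close>

lemma g_ge:
  assumes c: "c \<in> A" shows "g c \<ge> \<kappa> * (1 - (16/25) / real s ^ 2)" "g c \<ge> (49/50) * \<kappa>"
proof -
  have "bt c ^ s \<le> b ^ s" using bt_le_b bt_nonneg by (intro power_mono) auto
  then have "g c * bt c ^ s \<le> g c * b ^ s" using g_nonneg by (intro mult_left_mono) auto
  then have "(\<kappa> * (1 - (16/25) / real s ^ 2)) * b ^ s \<le> g c * b ^ s"
    using pq_ge_b[OF c] pq_g[OF bt_pos[OF c]] by (simp add: mult_ac)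
  then show 1: "g c \<ge> \<kappa> * (1 - (16/25) / real s ^ 2)" using b_pos by simp
  have "\<kappa> * (49/50) \<le> \<kappa> * (1 - (16/25) / real s ^ 2)" using s2' \<kappa>_pos by (intro mult_left_mono) auto
  then show "g c \<ge> (49/50) * \<kappa>" using 1 by linarith
qed

text \<open>Here \<open>g c\<close> \<le> \<open>\<kappa>\<close> leaves the deficit of order 1/s^2
  to the sum \<open>bt c\<close>. An s-th root divides it by s, hence the s^3; 33/50 is slightly
  larger than 16/25.\<close>

lemma m_c_le:
  assumes c: "c \<in> A" shows "b - bt c \<le> (33/50) / real s ^ 3 * b"
proof (rule ccontr)
  assume *: "\<not> ?thesis"
  define x z where "x = 1 / real s ^ 2" and "z = (33/50) / real s ^ 3"
  have x: "0 \<le> x" "x \<le> 1 / 36" using s2' by (auto simp: x_def)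
  have sz: "real s * z = (33/50) * x" using s6 by (simp add: x_def z_def power2_eq_square power3_eq_cube)
  have z: "0 \<le> z" by (simp add: z_def)
  have z1: "z \<le> 1"
  proof -
    have "1 * z \<le> real s * z" using s6 z by (intro mult_right_mono) auto
    then show ?thesis using sz x by linarith
  qed
  have lt: "bt c < (1 - z) * b" using * by (simp add: z_def algebra_simps)
  have "\<kappa> * (b ^ s * (1 - (16/25) * x)) \<le> g c * bt c ^ s" using pq_ge_b[OF c] pq_g[OF bt_pos[OF c]] by (simp add: x_def)
  also have "\<dots> \<le> \<kappa> * bt c ^ s" using g_le[OF bt_pos[OF c]] bt_nonneg by (intro mult_right_mono) auto
  finally have "b ^ s * (1 - (16/25) * x) \<le> bt c ^ s" using \<kappa>_pos by simp
  also have "\<dots> < ((1 - z) * b) ^ s" using lt bt_nonneg s6 by (intro power_strict_mono) auto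
  also have "\<dots> = b ^ s * (1 - z) ^ s" by (simp add: power_mult_distrib)
  finally have "1 - (16/25) * x < (1 - z) ^ s" using b_pos by simp
  also have "(1 - z) ^ s = (1 - (real s * z) / real s) ^ s" using s6 by simp
  also have "\<dots> \<le> exp (- (real s * z))" using s6 z1 by (intro one_minus_power_le_exp) auto
  finally have "1 - (16/25) * x < exp (- ((33/50) * x))" using sz by simp
  moreover have "exp (- ((33/50) * x)) * (1 + (33/50) * x) \<le> exp (- ((33/50) * x)) * exp ((33/50) * x)"
    using exp_ge_add_one_self[of "(33/50) * x"] by (intro mult_left_mono) auto
  then have "exp (- ((33/50) * x)) * (1 + (33/50) * x) \<le> 1" by (simp add: exp_minus)
  moreover have "(1 - (16/25) * x) * (1 + (33/50) * x) < exp (- ((33/50) * x)) * (1 + (33/50) * x)"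
    using calculation(1) x by (intro mult_strict_right_mono) auto
  ultimately have "(1 - (16/25) * x) * (1 + (33/50) * x) < 1" by linarith
  moreover have "x * x \<le> x * (1 / 36)" using x by (intro mult_left_mono) auto
  \<comment> \<open>The product is 1 + x/50 - (264/625) x^2, which is at least 1 for 0 \<le> x \<le>
    1/36.\<close>
  ultimately show False using x by (simp add: algebra_simps)
qed

lemma bt_half: "c \<in> A \<Longrightarrow> b - bt c \<le> b / 2"
proof -
  assume c: "c \<in> A"
  have "real s ^ 3 \<ge> 6 ^ 3" using s6 by (intro power_mono) auto
  then have "(33/50) / real s ^ 3 \<le> 1 / 2" using s6 by (simp add: divide_le_eq)
  then have "(33/50) / real s ^ 3 * b \<le> 1 / 2 * b" using b_nonneg by (intro mult_right_mono) auto
  then show ?thesis using m_c_le[OF c] by linarith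
qed

end

section \<open>Stars with all leaves in A, and losses from arcs inside B\<close>

lemma power_split: "n \<le> s \<Longrightarrow> x ^ s = x ^ n * x ^ (s - n)" for x :: real
  by (simp add: power_add[symmetric])

context balanced
begin

text \<open>Stars are counted by an out-leaf w, and \<open>star_exchange\<close> shows that arcs
  inside A do not help. For centres in U, 1/3 of this count is mixed with 2/3 of the direct bound
  \<open>tU\<close>, which yields a gain in proportion to the arcs from U to A if \<rho> is small.
  The third that is kept leaves enough in-neighbours for the hypothesis \<open>hq\<close>, even if
  all in-neighbours of w in B belong to U.\<close>

lemma AA_out:
  assumes U: "U \<subseteq> B" and tU: "\<And>x. x \<in> U \<Longrightarrow> tt A x \<le> \<rho> * m (Out x \<inter> A)"
    and hq: "\<And>w. w \<in> A \<Longrightarrow> a \<le> (real s - 1) * (q w - 2/3 * m (In w \<inter> U))"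
  shows "(\<Sum>x\<in>V. r * tt A x) \<le> kp * a ^ (s - 1) * (\<Sum>w\<in>A. r * q w)
     - 2/3 * (kp * a ^ (s - 1) - \<rho>) * (\<Sum>w\<in>A. r * m (In w \<inter> U))"
proof -
  have finU: "finite U" and UV: "U \<subseteq> V" using U BV finite_subset[OF _ finAB(2)] by auto
  define h where "h w = kp * m (Far w A) ^ (s - 1)" for w
  define hU where "hU = (\<Sum>w\<in>A. r * (m (In w \<inter> U) * h w))"
  have cnt: "(\<Sum>x\<in>X. r * tt A x) \<le> (\<Sum>w\<in>A. r * (m (In w \<inter> X) * h w))" if "finite X" for X
    unfolding tt_def h_def kp_def using sum_cnt_out[OF that finAB(1) k1, of l] by (simp add: s_def)
  have 1: "(\<Sum>x\<in>V - U. r * tt A x) \<le> (\<Sum>w\<in>A. r * (m (In w \<inter> (V - U)) * h w))"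
    by (rule cnt) simp
  have 2: "(\<Sum>x\<in>U. r * tt A x) \<le> hU" unfolding hU_def by (rule cnt[OF finU])
  have 3: "(\<Sum>x\<in>U. r * tt A x) \<le> \<rho> * (\<Sum>w\<in>A. r * m (In w \<inter> U))"
  proof -
    have "(\<Sum>x\<in>U. r * tt A x) \<le> (\<Sum>x\<in>U. r * (\<rho> * m (Out x \<inter> A)))"
      using tU r_pos by (intro sum_mono mult_left_mono) auto
    also have "\<dots> = \<rho> * (\<Sum>x\<in>U. r * m (Out x \<inter> A))" by (simp add: sum_distrib_left mult_ac)
    also have "(\<Sum>x\<in>U. r * m (Out x \<inter> A)) = (\<Sum>w\<in>A. r * m (In w \<inter> U))"
      using finU by (intro sum_m_Int_swap1) (auto simp: outs_def ins_def)
    finally show ?thesis .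
  qed
  have "(\<Sum>x\<in>V. r * tt A x) = (\<Sum>x\<in>V - U. r * tt A x) + (\<Sum>x\<in>U. r * tt A x)"
    using UV by (intro sum.subset_diff) auto
  also have "\<dots> \<le> (\<Sum>w\<in>A. r * (m (In w \<inter> (V - U)) * h w)) + (1/3 * hU + 2/3 * (\<rho> * (\<Sum>w\<in>A. r * m (In w \<inter> U))))"
    using 1 2 3 by linarith
  also have "\<dots> = (\<Sum>w\<in>A. r * ((m (In w \<inter> (V - U)) + 1/3 * m (In w \<inter> U)) * h w)) + 2/3 * (\<rho> * (\<Sum>w\<in>A. r * m (In w \<inter> U)))"
    by (simp add: hU_def sum_distrib_left sum.distrib[symmetric] algebra_simps)
  also have "\<dots> \<le> (\<Sum>w\<in>A. r * (kp * (a ^ (s - 1) * (q w - 2/3 * m (In w \<inter> U))))) + 2/3 * (\<rho> * (\<Sum>w\<in>A. r * m (In w \<inter> U)))"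
  proof (intro add_right_mono sum_mono mult_left_mono)
    fix w assume w: "w \<in> A"
    have a0: "0 \<le> real s - 1" using s6 by simp
    have Q: "0 \<le> q w - 2/3 * m (In w \<inter> U)"
    proof (rule ccontr)
      assume "\<not> 0 \<le> q w - 2/3 * m (In w \<inter> U)"
      then have "(real s - 1) * (q w - 2/3 * m (In w \<inter> U)) \<le> 0" using a0 by (intro mult_nonneg_nonpos) auto
      then show False using hq[OF w] a_pos by linarith
    qed
    have "m (In w \<inter> (V - U)) + m (In w \<inter> U) = m ((In w \<inter> (V - U)) \<union> (In w \<inter> U))"
      using finU by (intro m_Un[symmetric]) auto
    also have "(In w \<inter> (V - U)) \<union> (In w \<inter> U) = (In w \<inter> A) \<union> (In w \<inter> B)" using In_V[of w] AB U by blast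
    also have "m \<dots> = m (In w \<inter> A) + q w" unfolding q_def using AB by (intro m_Un) auto
    also have "m (In w \<inter> A) \<le> av w" unfolding av_def by (intro m_mono) (auto simp: nb_def)
    finally have le: "m (In w \<inter> (V - U)) + 1/3 * m (In w \<inter> U) \<le> (q w - 2/3 * m (In w \<inter> U)) + av w" by simp
    have "h w \<le> kp * (a - av w) ^ (s - 1)" unfolding h_def a_def av_def
      using kp_nonneg m_Far_le[of A w] by (intro mult_left_mono power_mono) auto
    then have "(m (In w \<inter> (V - U)) + 1/3 * m (In w \<inter> U)) * h w \<le> ((q w - 2/3 * m (In w \<inter> U)) + av w) * (kp * (a - av w) ^ (s - 1))"
      using le Q av_nonneg kp_nonneg by (intro mult_mono) (auto simp: h_def)
    also have "\<dots> = kp * ((a - av w) ^ (s - 1) * ((q w - 2/3 * m (In w \<inter> U)) + av w))" by (simp add: mult_ac)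
    also have "\<dots> \<le> kp * (a ^ (s - 1) * (q w - 2/3 * m (In w \<inter> U)))"
      using hq[OF w] Q s6 av_le[of w] av_nonneg kp_nonneg
      by (intro mult_left_mono star_exchange) (auto simp: of_nat_diff)
    finally show "(m (In w \<inter> (V - U)) + 1/3 * m (In w \<inter> U)) * h w \<le> kp * (a ^ (s - 1) * (q w - 2/3 * m (In w \<inter> U)))" .
  qed (use r_pos in auto)
  also have "(\<Sum>w\<in>A. r * (kp * (a ^ (s - 1) * (q w - 2/3 * m (In w \<inter> U))))) =
      kp * a ^ (s - 1) * (\<Sum>w\<in>A. r * q w) - 2/3 * (kp * a ^ (s - 1)) * (\<Sum>w\<in>A. r * m (In w \<inter> U))"
  proof -
    have "(\<Sum>w\<in>A. r * (kp * (a ^ (s - 1) * (q w - 2/3 * m (In w \<inter> U))))) =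
        (\<Sum>w\<in>A. kp * a ^ (s - 1) * (r * q w) - 2/3 * (kp * a ^ (s - 1)) * (r * m (In w \<inter> U)))"
      by (intro sum.cong refl) (simp add: algebra_simps)
    then show ?thesis by (simp only: sum_subtractf sum_distrib_left)
  qed
  finally show ?thesis by (simp add: algebra_simps)
qed

definition EB where "EB = (\<Sum>v\<in>B. r * bt v)"

lemma EB_nonneg: "EB \<ge> 0" unfolding EB_def using bt_nonneg r_pos by (intro sum_nonneg) auto

lemma EB_le: "EB \<le> b * b"
proof -
  have "EB \<le> (\<Sum>v\<in>B. r * b)" unfolding EB_def using bt_le_b r_pos by (intro sum_mono) auto
  also have "\<dots> = b * b" unfolding b_def by (rule sum_r_const) simp
  finally show ?thesis .
qed

lemma sum_Far_B:
  assumes "X \<subseteq> B"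
  shows "(\<Sum>v\<in>X. r * m (Far v (Nb c \<inter> B))) \<le> (\<Sum>v\<in>X. r * (b - bt v))"
proof (intro sum_mono mult_left_mono)
  fix v
  have "m (Far v (Nb c \<inter> B)) \<le> m (Far v B)" by (intro m_mono far_mono) auto
  then show "m (Far v (Nb c \<inter> B)) \<le> b - bt v" using m_Far_le[of B v] by (simp add: b_def bt_def)
qed (use r_pos in auto)

text \<open>\<open>cnt_pair\<close> with the two defects made linear: pairs missing between c and B,
  and arcs inside B. The latter appear with the factor 1/2 since \<open>bt c\<close> \<ge>
  b/2.\<close>

lemma tt_B_A:
  assumes c: "c \<in> A" and l2: "l \<ge> 2"
  shows "tt B c \<le> g c * (b ^ s - b ^ (s - 1) * (b - bt c) - b ^ (s - 2) * EB / 2)"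
proof -
  note bt = bt_pos[OF c]
  have un: "(Out c \<inter> B) \<union> (In c \<inter> B) = Nb c \<inter> B" by (auto simp: nb_def)
  have "bt c ^ 2 * tt B c \<le> p c ^ k * q c ^ l * (\<Sum>v\<in>Nb c \<inter> B. r * m (Far v (Nb c \<inter> B)))"
    using cnt_pair[of "Out c \<inter> B" "In c \<inter> B" k l] l2 kl outs_ins_disjoint[of E c] pq_bt[of c]
    unfolding tt_def un by (auto simp: p_def q_def)
  also have "\<dots> \<le> p c ^ k * q c ^ l * (b * b - EB)"
  proof (rule mult_left_mono)
    have "(\<Sum>v\<in>Nb c \<inter> B. r * m (Far v (Nb c \<inter> B))) \<le> (\<Sum>v\<in>Nb c \<inter> B. r * (b - bt v))"
      by (rule sum_Far_B) auto
    also have "\<dots> \<le> (\<Sum>v\<in>B. r * (b - bt v))" using bt_le_b r_pos by (intro sum_mono2) auto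
    also have "\<dots> = (\<Sum>v\<in>B. r * b) - EB" by (simp add: EB_def right_diff_distrib sum_subtractf)
    also have "(\<Sum>v\<in>B. r * b) = b * b" unfolding b_def by (rule sum_r_const) simp
    finally show "(\<Sum>v\<in>Nb c \<inter> B. r * m (Far v (Nb c \<inter> B))) \<le> b * b - EB" .
  qed (use pq_nonneg in auto)
  also have "p c ^ k * q c ^ l = g c * bt c ^ s" by (rule pq_g[OF bt])
  also have "bt c ^ s = bt c ^ 2 * bt c ^ (s - 2)" using s6 by (intro power_split) simp
  finally have "bt c ^ 2 * tt B c \<le> bt c ^ 2 * (g c * bt c ^ (s - 2) * (b * b - EB))" by (simp add: mult_ac)
  then have "tt B c \<le> g c * bt c ^ (s - 2) * (b * b - EB)" using bt by simp
  also have "\<dots> \<le> g c * (b ^ (s - 3) * bt c) * (b * b - EB)"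
  proof (intro mult_right_mono mult_left_mono)
    have "bt c ^ (s - 2) = bt c ^ (s - 3) * bt c" using s6 power_Suc2[of "bt c" "s - 3"] by (simp add: Suc_diff_Suc numeral_3_eq_3 numeral_2_eq_2)
    also have "\<dots> \<le> b ^ (s - 3) * bt c" using bt_le_b bt by (intro mult_right_mono power_mono) auto
    finally show "bt c ^ (s - 2) \<le> b ^ (s - 3) * bt c" .
  qed (use g_nonneg EB_le in auto)
  also have "\<dots> = g c * (b ^ (s - 3) * (bt c * (b * b - EB)))" by (simp add: mult_ac)
  also have "\<dots> \<le> g c * (b ^ (s - 3) * (b ^ 3 - b ^ 2 * (b - bt c) - b * EB / 2))"
  proof (intro mult_left_mono)
    have "(b - bt c) * EB \<le> b / 2 * EB" using bt_half[OF c] EB_nonneg by (intro mult_right_mono) auto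
    then show "bt c * (b * b - EB) \<le> b ^ 3 - b ^ 2 * (b - bt c) - b * EB / 2"
      by (simp add: algebra_simps power2_eq_square power3_eq_cube)
  qed (use g_nonneg b_nonneg in auto)
  also have "b ^ (s - 3) * (b ^ 3 - b ^ 2 * (b - bt c) - b * EB / 2) = b ^ s - b ^ (s - 1) * (b - bt c) - b ^ (s - 2) * EB / 2"
  proof -
    have "b ^ s = b ^ (s - 3) * b ^ 3" "b ^ (s - 1) = b ^ (s - 3) * b ^ 2" "b ^ (s - 2) = b ^ (s - 3) * b"
    proof -
      have e: "s - (s - 3) = 3" "(s - 1) - (s - 3) = 2" "(s - 2) - (s - 3) = 1" using s6 by auto
      show "b ^ s = b ^ (s - 3) * b ^ 3" using power_split[of "s - 3" s b] e(1) by simp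
      show "b ^ (s - 1) = b ^ (s - 3) * b ^ 2" using power_split[of "s - 3" "s - 1" b] e(2) by simp
      show "b ^ (s - 2) = b ^ (s - 3) * b" using power_split[of "s - 3" "s - 2" b] e(3) by simp
    qed
    then show ?thesis by (simp add: algebra_simps)
  qed
  finally show ?thesis .
qed

definition X1 where "X1 = 1 / (real s + 1)"

lemma X1: "X1 \<ge> 0" "X1 \<le> 1 / 7" "a \<le> (101/100) * X1" "a \<ge> (49/50) * X1" "v \<in> B \<Longrightarrow> bt v \<le> (21/20) * X1"
proof -
  show "X1 \<ge> 0" by (simp add: X1_def)
  show "X1 \<le> 1 / 7" unfolding X1_def using s6 by (intro divide_left_mono) auto
  show "a \<le> (101/100) * X1" using a_le by (simp add: X1_def)
  show "v \<in> B \<Longrightarrow> bt v \<le> (21/20) * X1" using bt_le by (simp add: X1_def)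
  have "(23/50) / real s ^ 2 = (23/50) * (1 / real s ^ 2)" by simp
  then have "(49/50) \<le> 1 - (23/50) / real s ^ 2" using s2' by linarith
  then have "(49/50) / (real s + 1) \<le> (1 - (23/50) / real s ^ 2) / (real s + 1)" by (intro divide_right_mono) auto
  then have "(49/50) / (real s + 1) \<le> a" using a_ge by linarith
  then show "a \<ge> (49/50) * X1" by (simp add: X1_def)
qed

lemma tt_B_B_sum:
  assumes "X \<subseteq> B"
  shows "(\<Sum>u\<in>X. r * tt B u) \<le> \<kappa> * ((21/20) * X1) ^ (s - 1) * (\<Sum>u\<in>X. r * bt u)"
proof -
  have "(\<Sum>u\<in>X. r * tt B u) \<le> (\<Sum>u\<in>X. r * (\<kappa> * (((21/20) * X1) ^ (s - 1) * bt u)))"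
  proof (intro sum_mono mult_left_mono)
    fix u assume u: "u \<in> X"
    have "tt B u \<le> \<kappa> * bt u ^ s" unfolding bt_def by (rule tt_le) simp
    also have "bt u ^ s = bt u ^ (s - 1) * bt u" using s6 by (cases s) auto
    also have "\<kappa> * (bt u ^ (s - 1) * bt u) \<le> \<kappa> * (((21/20) * X1) ^ (s - 1) * bt u)"
      using X1(5)[of u] u assms bt_nonneg[of u] \<kappa>_pos by (intro mult_left_mono mult_right_mono power_mono) auto
    finally show "tt B u \<le> \<kappa> * (((21/20) * X1) ^ (s - 1) * bt u)" .
  qed (use r_pos in auto)
  also have "\<dots> = \<kappa> * ((21/20) * X1) ^ (s - 1) * (\<Sum>u\<in>X. r * bt u)" by (subst sum_distrib_left) (simp add: mult_ac)
  finally show ?thesis .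
qed

lemma sum_A_const: "(\<Sum>c\<in>A. r * c0) = a * c0" unfolding a_def by (rule sum_r_const) simp

lemma sum_g_mu: "(\<Sum>c\<in>A. r * (g c * (b ^ (s - 1) * (b - bt c)))) \<ge> (7/20) * \<kappa> * mu"
proof -
  have "(7/20) * \<kappa> * mu = (\<Sum>c\<in>A. r * ((7/20) * \<kappa> * (b - bt c)))" by (simp add: mu_def sum_distrib_left mult_ac)
  also have "\<dots> \<le> (\<Sum>c\<in>A. r * (g c * (b ^ (s - 1) * (b - bt c))))"
  proof (intro sum_mono mult_left_mono)
    fix c assume c: "c \<in> A"
    have "(49/50) * \<kappa> * (363/1000) \<le> g c * b ^ (s - 1)"
      using g_ge(2)[OF c] b_pow_ge[of "s - 1"] \<kappa>_pos g_nonneg by (intro mult_mono) auto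
    then have "(7/20) * \<kappa> \<le> g c * b ^ (s - 1)" using \<kappa>_pos by linarith
    then have "(7/20) * \<kappa> * (b - bt c) \<le> g c * b ^ (s - 1) * (b - bt c)" using bt_le_b by (intro mult_right_mono) auto
    then show "(7/20) * \<kappa> * (b - bt c) \<le> g c * (b ^ (s - 1) * (b - bt c))" by simp
  qed (use r_pos in auto)
  finally show ?thesis .
qed

text \<open>The pairs missing between A and B cost the main term at least (7/20) \<kappa>
  \<open>mu\<close>, which pays for the mixed stars. The arcs inside B cost at least (17/100)
  \<kappa> a \<open>EB\<close>, which pays for the stars inside B because those carry a factor of
  order 1/(s+1)^(s-1).\<close>

lemma T_le_l2:
  assumes l2: "l \<ge> 2"
  shows "T \<le> (\<Sum>c\<in>A. r * (g c * b ^ s)) + (\<Sum>x\<in>V. r * tt A x)"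
proof -
  have "(\<Sum>c\<in>A. r * tt B c) \<le> (\<Sum>c\<in>A. r * (g c * (b ^ s - b ^ (s - 1) * (b - bt c) - b ^ (s - 2) * EB / 2)))"
    using tt_B_A[OF _ l2] r_pos by (intro sum_mono mult_left_mono) auto
  also have "\<dots> = (\<Sum>c\<in>A. r * (g c * b ^ s)) - (\<Sum>c\<in>A. r * (g c * (b ^ (s - 1) * (b - bt c)))) - (\<Sum>c\<in>A. r * (g c * (b ^ (s - 2) * EB / 2)))"
    by (simp add: sum_subtractf[symmetric] algebra_simps)
  finally have 0: "(\<Sum>c\<in>A. r * tt B c) \<le> (\<Sum>c\<in>A. r * (g c * b ^ s)) - (\<Sum>c\<in>A. r * (g c * (b ^ (s - 1) * (b - bt c)))) - (\<Sum>c\<in>A. r * (g c * (b ^ (s - 2) * EB / 2)))" .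
  have "(\<Sum>c\<in>A. r * ((17/100) * \<kappa> * EB)) \<le> (\<Sum>c\<in>A. r * (g c * (b ^ (s - 2) * EB / 2)))"
  proof (intro sum_mono mult_left_mono)
    fix c assume c: "c \<in> A"
    have "(49/50) * \<kappa> * (363/1000) \<le> g c * b ^ (s - 2)"
      using g_ge(2)[OF c] b_pow_ge[of "s - 2"] \<kappa>_pos g_nonneg by (intro mult_mono) auto
    then have "(17/50) * \<kappa> \<le> g c * b ^ (s - 2)" using \<kappa>_pos by linarith
    then have "(17/50) * \<kappa> * EB \<le> g c * b ^ (s - 2) * EB" using EB_nonneg by (intro mult_right_mono) auto
    then show "(17/100) * \<kappa> * EB \<le> g c * (b ^ (s - 2) * EB / 2)" by simp
  qed (use r_pos in auto)
  then have 1: "(\<Sum>c\<in>A. r * tt B c) \<le> (\<Sum>c\<in>A. r * (g c * b ^ s)) - (7/20) * \<kappa> * mu - a * ((17/100) * \<kappa> * EB)"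
    using 0 sum_g_mu unfolding sum_A_const by linarith
  have "(\<Sum>u\<in>B. r * tt B u) \<le> \<kappa> * ((21/20) * X1) ^ (s - 1) * EB"
    unfolding EB_def by (rule tt_B_B_sum) simp
  also have "\<dots> \<le> \<kappa> * (a * (17/100)) * EB"
  proof (intro mult_right_mono mult_left_mono)
    have "s - 1 = Suc (s - 2)" using s6 by simp
    then have "((21/20) * X1) ^ (s - 1) = (21/20) * X1 * ((21/20) * X1) ^ (s - 2)" by (simp only: power_Suc)
    also have "\<dots> \<le> (21/20) * X1 * ((21/20) * X1) ^ 1"
      using X1(1,2) s6 by (intro mult_left_mono power_decreasing) auto
    also have "\<dots> \<le> (21/20) * X1 * (3/20)" using X1(1,2) by (intro mult_left_mono) auto
    also have "\<dots> \<le> a * (17/100)" using X1(4) X1(1) by linarith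
    finally show "((21/20) * X1) ^ (s - 1) \<le> a * (17/100)" .
  qed (use \<kappa>_pos EB_nonneg in auto)
  finally have 2: "(\<Sum>u\<in>B. r * tt B u) \<le> a * ((17/100) * \<kappa> * EB)" by (simp add: mult_ac)
  have "kp * a ^ (s - 1) \<ge> 0" using kp_nonneg a_nonneg by simp
  then have "Gam \<le> (7/20) * \<kappa>" using Gam_kp by linarith
  then have "Gam * mu \<le> (7/20) * \<kappa> * mu" using mu_nonneg by (intro mult_right_mono) auto
  then show ?thesis using T_split 1 2 by linarith
qed

lemma sum_g_le: "(\<Sum>c\<in>A. r * (g c * b ^ s)) \<le> a * (\<kappa> * b ^ s)"
proof -
  have "(\<Sum>c\<in>A. r * (g c * b ^ s)) \<le> (\<Sum>c\<in>A. r * (\<kappa> * b ^ s))"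
    using g_le bt_pos r_pos b_nonneg by (intro sum_mono mult_left_mono mult_right_mono) auto
  then show ?thesis by (simp only: sum_A_const)
qed

text \<open>Arcs inside A permit stars centred in A, a set of measure a, but by
  \<open>cnt_pair\<close> they cost at least as much per centre in B, a set of measure b \<ge>
  a.\<close>

lemma AA_l2:
  assumes l2: "l \<ge> 2"
  shows "(\<Sum>x\<in>V. r * tt A x) \<le> b * (\<kappa> * a ^ s)"
proof -
  define EA where "EA = (\<Sum>w\<in>A. r * av w)"
  have EA: "0 \<le> EA" unfolding EA_def using av_nonneg r_pos by (intro sum_nonneg) auto
  have "EA \<le> (\<Sum>w\<in>A. r * a)" unfolding EA_def using av_le r_pos by (intro sum_mono) auto
  then have EA': "EA \<le> a * a" by (simp only: sum_A_const)
  have tB: "tt A u \<le> \<kappa> * a ^ (s - 2) * (a * a - EA)" if "u \<in> B" for u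
  proof (cases "av u = 0")
    case True
    have "tt A u \<le> \<kappa> * av u ^ s" unfolding av_def by (rule tt_le) simp
    then have "tt A u \<le> 0" using True s6 by (simp add: zero_power)
    moreover have "0 \<le> \<kappa> * a ^ (s - 2) * (a * a - EA)" using \<kappa>_pos a_nonneg EA' by simp
    ultimately show ?thesis by linarith
  next
    case False
    then have av: "av u > 0" using av_nonneg[of u] by linarith
    have un: "(Out u \<inter> A) \<union> (In u \<inter> A) = Nb u \<inter> A" by (auto simp: nb_def)
    have dj: "(Out u \<inter> A) \<inter> (In u \<inter> A) = {}" using outs_ins_disjoint[of E u] by auto
    have avs: "m (Out u \<inter> A) + m (In u \<inter> A) = av u" unfolding av_def un[symmetric] using dj by (intro m_Un[symmetric]) auto
    have "av u ^ 2 * tt A u \<le> m (Out u \<inter> A) ^ k * m (In u \<inter> A) ^ l * (\<Sum>v\<in>Nb u \<inter> A. r * m (Far v (Nb u \<inter> A)))"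
      using cnt_pair[of "Out u \<inter> A" "In u \<inter> A" k l] l2 kl dj avs unfolding tt_def un by auto
    also have "\<dots> \<le> (\<kappa> * av u ^ s) * (a * a - EA)"
    proof (rule mult_mono)
      show "m (Out u \<inter> A) ^ k * m (In u \<inter> A) ^ l \<le> \<kappa> * av u ^ s"
        using pow_mult_pow_le_kap[of "m (Out u \<inter> A)" "m (In u \<inter> A)" k l] avs by (simp add: \<kappa>_def s_def)
      have "(\<Sum>v\<in>Nb u \<inter> A. r * m (Far v (Nb u \<inter> A))) \<le> (\<Sum>v\<in>Nb u \<inter> A. r * (a - av v))"
      proof (intro sum_mono mult_left_mono)
        fix v
        have "m (Far v (Nb u \<inter> A)) \<le> m (Far v A)" by (intro m_mono far_mono) auto
        then show "m (Far v (Nb u \<inter> A)) \<le> a - av v" using m_Far_le[of A v] by (simp add: a_def av_def)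
      qed (use r_pos in auto)
      also have "\<dots> \<le> (\<Sum>v\<in>A. r * (a - av v))" using av_le r_pos by (intro sum_mono2) auto
      also have "\<dots> = (\<Sum>v\<in>A. r * a) - EA" by (simp add: EA_def right_diff_distrib sum_subtractf)
      finally show "(\<Sum>v\<in>Nb u \<inter> A. r * m (Far v (Nb u \<inter> A))) \<le> a * a - EA" by (simp only: sum_A_const)
    qed (use \<kappa>_pos av r_pos in \<open>auto intro!: sum_nonneg\<close>)
    also have "av u ^ s = av u ^ 2 * av u ^ (s - 2)" using s6 by (intro power_split) simp
    finally have "av u ^ 2 * tt A u \<le> av u ^ 2 * (\<kappa> * av u ^ (s - 2) * (a * a - EA))" by (simp add: mult_ac)
    then have "tt A u \<le> \<kappa> * av u ^ (s - 2) * (a * a - EA)" using av by simp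
    also have "\<dots> \<le> \<kappa> * a ^ (s - 2) * (a * a - EA)"
      using av_le[of u] av EA' \<kappa>_pos by (intro mult_right_mono mult_left_mono power_mono) auto
    finally show ?thesis .
  qed
  have tA: "tt A w \<le> \<kappa> * a ^ (s - 1) * av w" for w
  proof -
    have "tt A w \<le> \<kappa> * av w ^ s" unfolding av_def by (rule tt_le) simp
    also have "av w ^ s = av w ^ (s - 1) * av w" using s6 by (cases s) auto
    also have "\<kappa> * (av w ^ (s - 1) * av w) \<le> \<kappa> * (a ^ (s - 1) * av w)"
      using av_le[of w] av_nonneg[of w] \<kappa>_pos by (intro mult_left_mono mult_right_mono power_mono) auto
    finally show ?thesis by simp
  qed
  have "(\<Sum>x\<in>V. r * tt A x) = (\<Sum>x\<in>A. r * tt A x) + (\<Sum>x\<in>B. r * tt A x)"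
    using AB finAB by (metis sum.union_disjoint)
  also have "(\<Sum>x\<in>A. r * tt A x) \<le> (\<Sum>x\<in>A. r * (\<kappa> * a ^ (s - 1) * av x))"
    using tA r_pos by (intro sum_mono mult_left_mono) auto
  also have "\<dots> = \<kappa> * a ^ (s - 1) * EA" by (simp add: EA_def sum_distrib_left mult_ac)
  also have "(\<Sum>x\<in>B. r * tt A x) \<le> (\<Sum>x\<in>B. r * (\<kappa> * a ^ (s - 2) * (a * a - EA)))"
    using tB r_pos by (intro sum_mono mult_left_mono) auto
  also have "\<dots> = b * (\<kappa> * a ^ (s - 2) * (a * a - EA))" unfolding b_def by (rule sum_r_const) simp
  finally have *: "(\<Sum>x\<in>V. r * tt A x) \<le> \<kappa> * a ^ (s - 1) * EA + b * (\<kappa> * a ^ (s - 2) * (a * a - EA))" by simp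
  have "a \<le> b" using X1 ab by linarith
  then have "a * (\<kappa> * a ^ (s - 2) * EA) \<le> b * (\<kappa> * a ^ (s - 2) * EA)"
    using \<kappa>_pos a_nonneg EA by (intro mult_right_mono) auto
  moreover have "a ^ (s - 1) = a * a ^ (s - 2)" "a ^ s = a * (a * a ^ (s - 2))"
  proof -
    have "s - 1 - 1 = s - 2" by simp
    then show "a ^ (s - 1) = a * a ^ (s - 2)" using s6 power_split[of 1 "s - 1" a] by simp
    show "a ^ s = a * (a * a ^ (s - 2))" using s6 power_split[of 2 s a] by (simp add: power2_eq_square)
  qed
  ultimately show ?thesis using * by (simp add: algebra_simps)
qed

text \<open>Both terms carry the maximal constant \<open>\<kappa>\<close>; this is the desired bound
  for k = l, where share 1/2 is optimal for both kinds of centres.\<close>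

lemma T_le_eq: "l \<ge> 2 \<Longrightarrow> T \<le> \<kappa> * (a * (1 - a) ^ s + (1 - a) * a ^ s)"
proof -
  assume l2: "l \<ge> 2"
  have e: "1 - a = b" using ab by simp
  have "\<kappa> * (a * b ^ s + b * a ^ s) = a * (\<kappa> * b ^ s) + b * (\<kappa> * a ^ s)" by (simp add: algebra_simps)
  then show ?thesis unfolding e using T_le_l2[OF l2] sum_g_le AA_l2[OF l2] by linarith
qed

lemma bt_lower:
  assumes c: "c \<in> A" shows "bt c \<ge> (99/100) * (real s * X1)"
proof (rule ccontr)
  assume *: "\<not> ?thesis"
  have "\<kappa> * (ww s * (1 - (9/50) / real s ^ 2)) \<le> g c * bt c ^ s" using pq_ge[OF c] pq_g[OF bt_pos[OF c]] by simp
  also have "\<dots> \<le> \<kappa> * bt c ^ s" using g_le[OF bt_pos[OF c]] bt_nonneg by (intro mult_right_mono) auto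
  finally have 1: "ww s * (1 - (9/50) / real s ^ 2) \<le> bt c ^ s" using \<kappa>_pos by simp
  have "(9/50) / real s ^ 2 = (9/50) * (1 / real s ^ 2)" by simp
  then have "(199/200) \<le> 1 - (9/50) / real s ^ 2" using s2' by linarith
  then have "ww s * (199/200) \<le> ww s * (1 - (9/50) / real s ^ 2)" using w_ge by (intro mult_left_mono) auto
  moreover have "bt c ^ s \<le> ((99/100) * (real s * X1)) ^ s" using * bt_nonneg by (intro power_mono) auto
  moreover have "((99/100) * (real s * X1)) ^ s = (99/100) ^ s * ww s"
  proof -
    have e: "real s * X1 = real s / (real s + 1)" by (simp add: X1_def)
    show ?thesis unfolding e by (simp only: power_mult_distrib ww_def)
  qed
  moreover have "((99/100)::real) ^ s \<le> (99/100) ^ 1" using s6 by (intro power_decreasing) auto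
  then have "(99/100) ^ s * ww s \<le> (99/100) * ww s" using w_ge by (intro mult_right_mono) auto
  ultimately show False using 1 w_ge by linarith
qed

text \<open>An in-share below 1/(3s) would make \<open>g c\<close> at most \<kappa> (e/3)^l, against
  near-optimality. With \<open>bt_lower\<close> the constant becomes 1/3 times 99/100.\<close>

lemma q_lower:
  assumes c: "c \<in> A" shows "q c \<ge> (33/100) * X1"
proof -
  define \<eta> where "\<eta> = q c / bt c"
  note bt = bt_pos[OF c]
  have \<eta>: "\<eta> \<ge> 0" "p c / bt c = 1 - \<eta>" using pq_nonneg bt pq_bt[of c] by (auto simp: \<eta>_def field_simps)
  then have \<eta>1: "\<eta> \<le> 1" using pq_nonneg[of c] bt by (metis diff_ge_0_iff_ge divide_nonneg_pos)
  have "\<eta> \<ge> 1 / (3 * real s)"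
  proof (rule ccontr)
    assume *: "\<not> ?thesis"
    define y where "y = \<eta> * real s / real l"
    have y: "0 \<le> y" "y \<le> 1 / 3"
    proof -
      have "\<eta> * real s \<le> 1 / 3" using * s6 by (simp add: field_simps)
      moreover have "\<eta> * real s / real l \<le> \<eta> * real s / 1"
        using l1 \<eta>(1) by (intro divide_left_mono) auto
      then have "y \<le> \<eta> * real s" by (simp add: y_def)
      ultimately show "y \<le> 1 / 3" by linarith
    qed (use \<eta> in \<open>simp add: y_def\<close>)
    have sk: "real k \<le> real s" by (simp add: s_def)
    have "g c = (1 - \<eta>) ^ k * \<eta> ^ l" by (simp add: g_def \<eta>(2) \<eta>_def[symmetric])
    also have "\<dots> \<le> 1 * \<eta> ^ l" using \<eta> \<eta>1 by (intro mult_right_mono power_le_one) auto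
    also have "\<eta> ^ l = \<kappa> * ((real s / real k) ^ k * y ^ l)"
    proof -
      have e: "real s ^ k * real s ^ l = real s ^ s" by (simp add: s_def power_add)
      have n: "real k \<noteq> 0" "real l \<noteq> 0" "real s \<noteq> 0" using k1 l1 s6 by linarith+
      have "\<kappa> * ((real s / real k) ^ k * y ^ l) = \<eta> ^ l * ((real k ^ k / real k ^ k) * (real l ^ l / real l ^ l) * ((real s ^ k * real s ^ l) / real s ^ s))"
        by (simp add: \<kappa>_def kap_def s_def[symmetric] y_def power_divide power_mult_distrib)
      also have "\<dots> = \<eta> ^ l"
        unfolding e using n by (simp only: divide_self power_not_zero mult_1_right not_False_eq_True)
      finally show ?thesis by simp
    qed
    finally have "g c \<le> \<kappa> * ((real s / real k) ^ k * y ^ l)" by simp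
    moreover have "(real s / real k) ^ k \<le> (68/25) ^ l"
    proof -
      have "real s / real k = 1 + real l / real k" using k1 by (simp add: s_def field_simps)
      then have "(real s / real k) ^ k \<le> exp (real l / real k) ^ k"
        using exp_ge_add_one_self[of "real l / real k"] by (intro power_mono) auto
      also have "\<dots> = exp 1 ^ l" using k1 by (simp add: exp_of_nat_mult[symmetric])
      also have "\<dots> \<le> (68/25) ^ l" using exp_1_le by (intro power_mono) auto
      finally show ?thesis .
    qed
    then have "(real s / real k) ^ k * y ^ l \<le> (68/25) ^ l * (1 / 3) ^ l"
      using y by (intro mult_mono power_mono) auto
    moreover have "((68/25)::real) ^ l * (1 / 3) ^ l = ((68/25) / 3) ^ l" by (simp add: power_mult_distrib[symmetric])
    moreover have "((68/25) / 3 :: real) ^ l \<le> ((68/25) / 3) ^ 1" using l1 by (intro power_decreasing) auto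
    ultimately have "(real s / real k) ^ k * y ^ l \<le> (97/100)" by simp
    then have "\<kappa> * ((real s / real k) ^ k * y ^ l) \<le> \<kappa> * (97/100)" using \<kappa>_pos by (intro mult_left_mono) auto
    then have "g c \<le> \<kappa> * (97/100)" using \<open>g c \<le> \<kappa> * ((real s / real k) ^ k * y ^ l)\<close> by linarith
    then show False using g_ge(2)[OF c] \<kappa>_pos by linarith
  qed
  then have "1 / (3 * real s) * ((99/100) * (real s * X1)) \<le> \<eta> * bt c"
    using bt_lower[OF c] \<eta> X1(1) by (intro mult_mono) auto
  moreover have "\<eta> * bt c = q c" using bt by (simp add: \<eta>_def)
  moreover have "1 / (3 * real s) * ((99/100) * (real s * X1)) = (33/100) * X1" using s6 by simp
  ultimately show ?thesis by simp
qed

section \<open>Comparison with the maximized function\<close>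

definition obj where "obj \<alpha> d = \<alpha> * (1 - \<alpha>) ^ s * d ^ k * (1 - d) ^ l + kp * (1 - \<alpha>) * \<alpha> ^ s * (1 - d)"

lemma pow_opt:
  assumes "0 \<le> d" "d \<le> 1" shows "d ^ k * (1 - d) ^ l \<le> (real k / real s) ^ k * (1 - real k / real s) ^ l"
proof -
  have "d ^ k * (1 - d) ^ l \<le> kap k l" using pow_mult_pow_le_kap[of d "1 - d" k l] assms by simp
  also have "\<dots> = (real k / real s) ^ k * (real l / real s) ^ l" by (simp add: kap_def s_def power_divide power_add)
  also have "real l / real s = 1 - real k / real s" using s6 by (simp add: s_def field_simps)
  finally show ?thesis .
qed

text \<open>The bound on T is an average over c in A of terms that are at most
  \<open>obj a d\<close>, d the out-share of c, since \<open>q c\<close> \<le> (1-d) b. A share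
  above k/s may be lowered to k/s, as both terms grow.\<close>

lemma T_le_obj:
  assumes T: "T \<le> (\<Sum>c\<in>A. r * (g c * b ^ s)) + kp * a ^ (s - 1) * (\<Sum>w\<in>A. r * q w)"
    and M: "\<And>d. 0 \<le> d \<Longrightarrow> d \<le> real k / real s \<Longrightarrow> obj a d \<le> M"
  shows "T \<le> M"
proof -
  have b: "b = 1 - a" using ab by simp
  have pw: "a ^ s = a * a ^ (s - 1)" using s6 by (cases s) auto
  have c: "a * (g c * b ^ s + kp * a ^ (s - 1) * q c) \<le> M" if c: "c \<in> A" for c
  proof -
    define d where "d = p c / bt c"
    note bt = bt_pos[OF c]
    have q: "q c / bt c = 1 - d" using bt pq_bt[of c] by (simp add: d_def field_simps)
    have d: "0 \<le> d" using bt pq_nonneg by (simp add: d_def)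
    have "0 \<le> q c / bt c" using bt pq_nonneg by simp
    then have d1: "d \<le> 1" using q by simp
    have "q c = (1 - d) * bt c" using q bt by (simp add: field_simps)
    also have "\<dots> \<le> (1 - d) * b" using bt_le_b d1 by (intro mult_left_mono) auto
    finally have "a * (g c * b ^ s + kp * a ^ (s - 1) * q c) \<le> a * (g c * b ^ s + kp * a ^ (s - 1) * ((1 - d) * b))"
      using a_nonneg kp_nonneg by (intro mult_left_mono add_left_mono) auto
    also have "\<dots> = obj a d" by (simp add: obj_def g_def q d_def[symmetric] b pw algebra_simps)
    finally have le: "a * (g c * b ^ s + kp * a ^ (s - 1) * q c) \<le> obj a d" .
    show ?thesis
    proof (cases "d \<le> real k / real s")
      case True then show ?thesis using le M[OF d] by linarith
    next
      case False
      have "a * (1 - a) ^ s * (d ^ k * (1 - d) ^ l) \<le> a * (1 - a) ^ s * ((real k / real s) ^ k * (1 - real k / real s) ^ l)"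
        using pow_opt[OF d d1] a_nonneg a_le_1 by (intro mult_left_mono) auto
      moreover have "kp * (1 - a) * a ^ s * (1 - d) \<le> kp * (1 - a) * a ^ s * (1 - real k / real s)"
        using False kp_nonneg a_nonneg a_le_1 by (intro mult_left_mono) auto
      ultimately have "obj a d \<le> obj a (real k / real s)" by (simp add: obj_def mult.assoc)
      then show ?thesis using le M[of "real k / real s"] by simp
    qed
  qed
  have "(\<Sum>c\<in>A. r * (a * (g c * b ^ s + kp * a ^ (s - 1) * q c))) \<le> (\<Sum>c\<in>A. r * M)"
    using c r_pos by (intro sum_mono mult_left_mono) auto
  then have "a * ((\<Sum>c\<in>A. r * (g c * b ^ s)) + kp * a ^ (s - 1) * (\<Sum>w\<in>A. r * q w)) \<le> a * M"
    unfolding sum_A_const by (simp add: sum_distrib_left sum.distrib algebra_simps)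
  then have "(\<Sum>c\<in>A. r * (g c * b ^ s)) + kp * a ^ (s - 1) * (\<Sum>w\<in>A. r * q w) \<le> M" using a_pos by simp
  then show ?thesis using T by linarith
qed

lemma T_le_gt_l2:
  assumes l2: "l \<ge> 2"
  shows "T \<le> (\<Sum>c\<in>A. r * (g c * b ^ s)) + kp * a ^ (s - 1) * (\<Sum>w\<in>A. r * q w)"
proof -
  have "(\<Sum>x\<in>V. r * tt A x) \<le> kp * a ^ (s - 1) * (\<Sum>w\<in>A. r * q w)
     - 2/3 * (kp * a ^ (s - 1) - 0) * (\<Sum>w\<in>A. r * m (In w \<inter> {}))"
  proof (rule AA_out)
    fix w assume w: "w \<in> A"
    define Y where "Y = (real s - 1) * X1"
    have "(real s - 1) * ((33/100) * X1) \<le> (real s - 1) * q w" using q_lower[OF w] s6 by (intro mult_left_mono) auto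
    then have "(33/100) * Y \<le> (real s - 1) * q w" by (simp add: Y_def)
    moreover have "5 * X1 \<le> Y" unfolding Y_def using s6 X1(1) by (intro mult_right_mono) auto
    ultimately have "a \<le> (real s - 1) * q w" using X1(1,3) by linarith
    then show "a \<le> (real s - 1) * (q w - 2/3 * m (In w \<inter> {}))" by (simp add: m_def)
  qed auto
  also have "\<dots> = kp * a ^ (s - 1) * (\<Sum>w\<in>A. r * q w)" by (simp add: m_def)
  finally show ?thesis using T_le_l2[OF l2] by linarith
qed

end

section \<open>Stars with one in-leaf\<close>

text \<open>The estimate behind \<open>EN_charge\<close>, with 42/5 = 8 (21/20). Since (21/20)/(s+1)
  \<le> 3/20 = (3/10)(1/2), the power splits into two: one absorbs s, the other one s -
  17/10.\<close>

lemma num_chi: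
  assumes s: "s \<ge> 6"
  shows "(42/5) * (1 + (109/40) * real s) * ((real s - (17/10)) * ((21/20) / (real s + 1)) ^ (s - 2)) \<le> (33/100)"
proof -
  have 1: "real s ^ 1 * (3/10) ^ (s - 2) \<le> 6 ^ 1 * (3/10) ^ (6 - 2)"
    using s by (intro decay') auto
  have 2: "(real s - (17/10)) * (1/2) ^ (s - 2) \<le> (43/10) * (1/2) ^ 4"
    using s
  proof (induction s rule: nat_induct_at_least)
    case (Suc s)
    have e: "Suc s - 2 = Suc (s - 2)" using Suc by simp
    have "(real (Suc s) - (17/10)) * (1/2) ^ (Suc s - 2) = (real (Suc s) - (17/10)) * (1/2) * (1/2) ^ (s - 2)"
      unfolding e power_Suc by (simp only: mult.assoc)
    also have "\<dots> \<le> (real s - (17/10)) * (1/2) ^ (s - 2)"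
      using Suc by (intro mult_right_mono) auto
    also have "\<dots> \<le> (43/10) * (1/2) ^ 4" by (rule Suc)
    finally show ?case .
  qed simp
  have "((21/20) / (real s + 1)) ^ (s - 2) \<le> (3/20) ^ (s - 2)"
    using s by (intro power_mono) (auto simp: divide_le_eq)
  also have "\<dots> = (3/10) ^ (s - 2) * (1/2) ^ (s - 2)" by (simp add: power_mult_distrib[symmetric])
  finally have 3: "((21/20) / (real s + 1)) ^ (s - 2) \<le> (3/10) ^ (s - 2) * (1/2) ^ (s - 2)" .
  have "(42/5) * (1 + (109/40) * real s) * ((real s - (17/10)) * ((21/20) / (real s + 1)) ^ (s - 2))
     \<le> (42/5) * ((723/250) * real s) * ((real s - (17/10)) * ((3/10) ^ (s - 2) * (1/2) ^ (s - 2)))"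
    using s 3 by (intro mult_mono) auto
  also have "\<dots> = (42/5) * (723/250) * ((real s ^ 1 * (3/10) ^ (s - 2)) * ((real s - (17/10)) * (1/2) ^ (s - 2)))" by simp
  also have "\<dots> \<le> (42/5) * (723/250) * ((6 ^ 1 * (3/10) ^ (6 - 2)) * ((43/10) * (1/2) ^ 4))"
    using s by (intro mult_left_mono mult_mono[OF 1 2]) auto
  also have "\<dots> \<le> (33/100)" by (simp add: power_numeral_reduce)
  finally show ?thesis .
qed

lemma exp_9_5: "exp (9/5) \<le> ((303/50)::real)"
proof -
  have "exp (9/5 :: real) ^ 5 = exp 1 ^ 9" by (simp add: exp_of_nat_mult[symmetric])
  also have "\<dots> \<le> (68/25) ^ 9" using exp_1_le by (intro power_mono) auto
  also have "\<dots> \<le> (303/50) ^ 5" by (simp add: power_numeral_reduce)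
  finally have "exp (9/5 :: real) ^ 5 \<le> (303/50) ^ 5" .
  then show ?thesis by (rule power_le_imp_le_base[of _ 4, simplified]) auto
qed

text \<open>y exp (1 - y) increases up to y = 1 and decreases from there on. Later y is s times an
  in-share, so that y = 1 is the optimum for l = 1.\<close>

lemma times_exp_le_left:
  fixes y y0 :: real
  assumes "0 \<le> y" "y \<le> y0" "y0 \<le> 1"
  shows "y * exp (1 - y) \<le> y0 * exp (1 - y0)"
proof -
  have "y \<le> y0 * (1 + (y - y0))"
  proof -
    have "y0 * (1 + (y - y0)) - y = (1 - y0) * (y0 - y)" by (simp add: algebra_simps)
    then show ?thesis using mult_nonneg_nonneg[of "1 - y0" "y0 - y"] assms by linarith
  qed
  also have "\<dots> \<le> y0 * exp (y - y0)" using assms exp_ge_add_one_self[of "y - y0"] by (intro mult_left_mono) auto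
  finally have "y * exp (1 - y) \<le> y0 * exp (y - y0) * exp (1 - y)" by (intro mult_right_mono) auto
  also have "\<dots> = y0 * exp (1 - y0)" by (simp add: exp_add[symmetric])
  finally show ?thesis .
qed

lemma times_exp_le_right:
  fixes y u :: real
  assumes "0 \<le> u" "1 + u \<le> y"
  shows "y * exp (1 - y) \<le> (1 + u) * exp (- u)"
proof -
  define t where "t = y - (1 + u)"
  have t: "0 \<le> t" "y = 1 + u + t" using assms by (auto simp: t_def)
  have "y \<le> (1 + u) * (1 + t)" using t assms by (simp add: algebra_simps)
  also have "\<dots> \<le> (1 + u) * exp t" using assms exp_ge_add_one_self[of t] by (intro mult_left_mono) auto
  finally have "y * exp (1 - y) \<le> (1 + u) * exp t * exp (1 - y)" by (intro mult_right_mono) auto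
  also have "\<dots> = (1 + u) * exp (- u)" by (simp add: t exp_add[symmetric])
  finally show ?thesis .
qed

text \<open>The expansion starts with 1 - u^2/2; the coefficient 19/50 leaves room for the higher
  terms on this interval.\<close>

lemma one_plus_times_exp_minus:
  fixes u :: real
  assumes "0 \<le> u" "u \<le> (11/50)"
  shows "(1 + u) * exp (- u) \<le> 1 - (19/50) * u ^ 2"
proof -
  have "u ^ 2 * ((19/50) * u + (19/100) * u ^ 2) \<le> u ^ 2 * (3/25)"
  proof (rule mult_left_mono)
    have "u ^ 2 \<le> (11/50) ^ 2" using assms by (intro power_mono) auto
    then show "(19/50) * u + (19/100) * u ^ 2 \<le> (3/25)" using assms by (simp add: power_numeral_reduce)
  qed simp
  then have "1 + u \<le> (1 - (19/50) * u ^ 2) * (1 + u + u ^ 2 / 2)"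
    by (simp add: algebra_simps power2_eq_square)
  also have "\<dots> \<le> (1 - (19/50) * u ^ 2) * exp u"
  proof (rule mult_left_mono)
    have "u ^ 2 \<le> (11/50) ^ 2" using assms by (intro power_mono) auto
    then show "0 \<le> 1 - (19/50) * u ^ 2" by (simp add: power_numeral_reduce)
  qed (use exp_lower_Taylor_quadratic[OF assms(1)] in simp)
  finally show ?thesis by (simp add: exp_minus field_simps)
qed

locale balanced1 = balanced +
  assumes l_1: "l = 1"
begin

lemma k_s: "k = s - 1" "real k = real s - 1" "k \<ge> 5" using s_def l_1 s6 by auto

lemma pow_l: "x ^ l = x" for x :: real by (subst l_1) simp

lemma real_l: "real l = 1" using l_1 by simp

lemma pow_k: "x ^ k = x * x ^ (k - 1)" for x :: real
  using power_split[OF k1, of x] by simp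

text \<open>For in-share y/s, \<open>g c\<close> equals \<kappa> y (1 + (1-y)/k)^k. The exponential
  bounds this in a form that does not involve s.\<close>

lemma g_le_exp:
  assumes c: "c \<in> A"
  defines "y \<equiv> real s * (q c / bt c)"
  shows "g c \<le> \<kappa> * (y * exp (1 - y))" "y \<ge> 0"
proof -
  define \<eta> where "\<eta> = q c / bt c"
  note bt = bt_pos[OF c]
  have e: "p c / bt c = 1 - \<eta>" using bt pq_bt[of c] by (simp add: \<eta>_def field_simps)
  have \<eta>: "0 \<le> \<eta>" using pq_nonneg bt by (simp add: \<eta>_def)
  have "0 \<le> p c / bt c" using pq_nonneg bt by simp
  then have \<eta>1: "\<eta> \<le> 1" using e by simp
  have y: "y = real s * \<eta>" by (simp add: y_def \<eta>_def)
  show "y \<ge> 0" using \<eta> by (simp add: y)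
  have kp: "real k > 0" using k1 by simp
  have x: "1 + (1 - y) / real k = real s * (1 - \<eta>) / real k"
    using kp by (simp add: y k_s(2) field_simps)
  have "g c = (1 - \<eta>) ^ k * \<eta>" by (simp only: g_def e \<eta>_def[symmetric] pow_l)
  also have "\<dots> = \<kappa> * (y * (1 + (1 - y) / real k) ^ k)"
  proof -
    have ss: "real s ^ k * real s = real s ^ s" using power_add[of "real s" k l, folded s_def] by (simp only: pow_l)
    have \<kappa>: "\<kappa> = real k ^ k / real s ^ s" by (simp only: \<kappa>_def kap_def s_def[symmetric] pow_l real_l mult_1_right)
    have nz: "real k ^ k \<noteq> 0" "real s ^ s \<noteq> 0" using kp s6 by auto
    have "\<kappa> * (y * (1 + (1 - y) / real k) ^ k) = (real k ^ k / real k ^ k) * ((real s ^ k * real s) / real s ^ s) * ((1 - \<eta>) ^ k * \<eta>)"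
      unfolding x \<kappa> unfolding y
      by (simp only: power_mult_distrib power_divide times_divide_eq_right times_divide_eq_left mult_ac divide_divide_eq_left)
    also have "\<dots> = (1 - \<eta>) ^ k * \<eta>" unfolding ss using nz by (simp only: divide_self mult_1_left not_False_eq_True)
    finally show ?thesis by simp
  qed
  also have "\<dots> \<le> \<kappa> * (y * exp (1 - y))"
  proof (intro mult_left_mono)
    have "0 \<le> 1 + (1 - y) / real k" unfolding x using \<eta>1 kp by simp
    then have "(1 + (1 - y) / real k) ^ k \<le> exp ((1 - y) / real k) ^ k"
      using exp_ge_add_one_self[of "(1 - y) / real k"] by (intro power_mono) auto
    also have "\<dots> = exp (1 - y)" using kp by (simp add: exp_of_nat_mult[symmetric])
    finally show "(1 + (1 - y) / real k) ^ k \<le> exp (1 - y)" .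
  qed (use \<kappa>_pos \<eta> y in auto)
  finally show "g c \<le> \<kappa> * (y * exp (1 - y))" .
qed

text \<open>Both bounds come from \<open>g_ge\<close>: y below 7/10 would give at most (97/100)
  \<kappa>, and y above 1 + (13/10)/s would lose (19/50)(169/100)/s^2, slightly more than
  (16/25)/s^2.\<close>

lemma q_bounds:
  assumes c: "c \<in> A"
  shows "q c \<ge> (69/100) * X1" "q c \<le> (1 + (13/10) / real s) * (b / real s)"
proof -
  define y where "y = real s * (q c / bt c)"
  note gy = g_le_exp[OF c, folded y_def]
  note bt = bt_pos[OF c]
  have sp: "real s > 0" using s6 by simp
  have qy: "q c = y * bt c / real s" using bt sp by (simp add: y_def)
  have "y \<ge> (7/10)"
  proof (rule ccontr)
    assume "\<not> y \<ge> (7/10)"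
    then have "y * exp (1 - y) \<le> (7/10) * exp (1 - (7/10))" using gy by (intro times_exp_le_left) auto
    also have "exp (1 - (7/10) :: real) = exp (1/10) ^ 3" by (simp add: exp_of_nat_mult[symmetric])
    also have "exp (1/10) ^ 3 \<le> (10 / 9 :: real) ^ 3"
    proof (rule power_mono)
      have "1 - (1/10) \<le> exp (- (1/10) :: real)" using exp_ge_add_one_self[of "- (1/10) :: real"] by simp
      then have "exp (1/10) * (1 - (1/10)) \<le> exp (1/10) * exp (- (1/10) :: real)" by (intro mult_left_mono) auto
      then show "exp (1/10) \<le> (10 / 9 :: real)" by (simp add: exp_minus)
    qed simp
    finally have "y * exp (1 - y) \<le> (97/100)" by (simp add: power_numeral_reduce)
    then have "\<kappa> * (y * exp (1 - y)) \<le> \<kappa> * (97/100)" using \<kappa>_pos by (intro mult_left_mono) auto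
    then show False using gy(1) g_ge(2)[OF c] \<kappa>_pos by linarith
  qed
  then have "(7/10) * ((99/100) * (real s * X1)) \<le> y * bt c" using bt_lower[OF c] X1(1) by (intro mult_mono) auto
  then have "(7/10) * ((99/100) * X1) \<le> q c" unfolding qy using sp by (simp add: field_simps)
  then show "q c \<ge> (69/100) * X1" using X1(1) by linarith
  have "y \<le> 1 + (13/10) / real s"
  proof (rule ccontr)
    assume *: "\<not> ?thesis"
    define u where "u = (13/10) / real s"
    have "(13/10) / real s \<le> (13/10) / 6" using s6 by (intro divide_left_mono) auto
    then have u: "0 \<le> u" "u \<le> (11/50)" by (auto simp: u_def)
    have "y * exp (1 - y) \<le> (1 + u) * exp (- u)" using * u by (intro times_exp_le_right) (auto simp: u_def)
    also have "\<dots> \<le> 1 - (19/50) * u ^ 2" by (rule one_plus_times_exp_minus[OF u])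
    also have "u ^ 2 = (169/100) * (1 / real s ^ 2)" by (simp add: u_def power_divide power2_eq_square)
    finally have "y * exp (1 - y) \<le> 1 - (19/50) * ((169/100) * (1 / real s ^ 2))" .
    also have "\<dots> < 1 - (16/25) / real s ^ 2"
    proof -
      have "1 / real s ^ 2 > 0" using s6 by simp
      moreover have "(16/25) / real s ^ 2 = (16/25) * (1 / real s ^ 2)" by simp
      ultimately show ?thesis by linarith
    qed
    finally have "\<kappa> * (y * exp (1 - y)) < \<kappa> * (1 - (16/25) / real s ^ 2)" using \<kappa>_pos by simp
    then show False using gy(1) g_ge(1)[OF c] by linarith
  qed
  then have "y * bt c \<le> (1 + (13/10) / real s) * b" using bt_le_b[of c] bt gy(2) by (intro mult_mono) auto
  then have "y * bt c / real s \<le> (1 + (13/10) / real s) * b / real s" using sp by (intro divide_right_mono) auto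
  then show "q c \<le> (1 + (13/10) / real s) * (b / real s)" by (simp add: qy)
qed

text \<open>The vertices of U are in-neighbours of almost all of A, so that U is about as small as A and its vertices
  are the centres of few stars with leaves in A. All other arcs inside B are charged to EN.\<close>

definition \<theta> where "\<theta> = 1 / (8 * real k)"
definition U where "U = {v \<in> B. m (In v \<inter> A) \<le> \<theta> * a}"
definition u where "u = m U"
definition QU where "QU = (\<Sum>w\<in>A. r * m (In w \<inter> U))"
definition EN where "EN = (\<Sum>v\<in>B - U. r * bt v)"

lemma UB: "U \<subseteq> B" by (auto simp: U_def)
lemma finU [simp]: "finite U" using finite_subset[OF UB] by simp

lemma \<theta>: "0 \<le> \<theta>" "\<theta> \<le> 1/40"
proof -
  show "0 \<le> \<theta>" by (simp add: \<theta>_def)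
  show "\<theta> \<le> 1/40" unfolding \<theta>_def using k_s by (intro divide_left_mono) auto
qed

lemma EN_nonneg: "EN \<ge> 0" unfolding EN_def using bt_nonneg r_pos by (intro sum_nonneg) auto

lemma u_nonneg: "u \<ge> 0" by (simp add: u_def)

lemma QU_eq: "QU = (\<Sum>x\<in>U. r * m (Out x \<inter> A))"
  unfolding QU_def by (rule sum_m_Int_swap1) (auto simp: outs_def ins_def)

text \<open>A vertex of U sends arcs to all of A except for its in-neighbours there, at most
  \<theta> a, and the vertices not joined to it by exactly one arc; the latter add up to at most
  \<open>mu\<close>.\<close>

lemma QU_ge: "QU \<ge> u * ((1 - \<theta>) * a) - mu"
proof -
  have "u * ((1 - \<theta>) * a) - mu \<le> u * ((1 - \<theta>) * a) - (\<Sum>x\<in>U. r * (a - av x))"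
  proof -
    have "(\<Sum>x\<in>U. r * (a - av x)) \<le> (\<Sum>x\<in>B. r * (a - av x))"
      using UB av_le r_pos by (intro sum_mono2) auto
    then show ?thesis using mu_B by simp
  qed
  also have "\<dots> = (\<Sum>x\<in>U. r * ((1 - \<theta>) * a)) - (\<Sum>x\<in>U. r * (a - av x))"
    unfolding u_def by (subst sum_r_const) auto
  also have "\<dots> = (\<Sum>x\<in>U. r * (av x - \<theta> * a))"
    unfolding sum_subtractf[symmetric] by (intro sum.cong refl) (simp add: algebra_simps)
  also have "\<dots> \<le> QU" unfolding QU_eq
  proof (intro sum_mono mult_left_mono)
    fix x assume x: "x \<in> U"
    have "Nb x \<inter> A = (Out x \<inter> A) \<union> (In x \<inter> A)" by (auto simp: nb_def)
    then have "av x = m (Out x \<inter> A) + m (In x \<inter> A)" unfolding av_def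
      using outs_ins_disjoint[of E x] by (simp only:) (rule m_Un; auto)
    then show "av x - \<theta> * a \<le> m (Out x \<inter> A)" using x by (auto simp: U_def)
  qed (use r_pos in auto)
  finally show ?thesis .
qed

text \<open>Every w in A has about b/s, that is about a, in-neighbours in B by
  \<open>q_bounds\<close>, while almost all pairs between U and A are arcs into A. Double counting
  of these arcs bounds u.\<close>

lemma u_le: "u \<le> (1 + (9/5) / real s) * a"
proof -
  define e where "e = 1 / real s"
  have e: "0 \<le> e" "e \<le> 1/6" unfolding e_def using s6 by (auto intro!: divide_left_mono)
  have dv: "c / real s = c * e" "c / real s ^ 2 = c * e ^ 2" "c / real s ^ 3 = c * e ^ 3" for c
    by (simp_all add: e_def power_divide)
  define f where "f = 1 + (13/10) * e + (33/50) * e ^ 2"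
  have 1: "u * ((1 - \<theta>) * a) \<le> a * ((b / real s) * f)"
  proof -
    have "u * ((1 - \<theta>) * a) \<le> QU + mu" using QU_ge by simp
    also have "\<dots> \<le> (\<Sum>w\<in>A. r * (q w + (b - bt w)))"
    proof -
      have "m (In w \<inter> U) \<le> q w" for w unfolding q_def using UB by (intro m_mono) auto
      then have "QU \<le> (\<Sum>w\<in>A. r * q w)" unfolding QU_def using r_pos by (intro sum_mono mult_left_mono) auto
      then show ?thesis unfolding mu_def by (simp add: distrib_left sum.distrib)
    qed
    also have "\<dots> \<le> (\<Sum>w\<in>A. r * ((b / real s) * f))"
    proof (intro sum_mono mult_left_mono)
      fix w assume w: "w \<in> A"
      have "q w + (b - bt w) \<le> (1 + (13/10) / real s) * (b / real s) + (33/50) / real s ^ 3 * b"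
        using q_bounds(2)[OF w] m_c_le[OF w] by linarith
      also have "\<dots> = (b / real s) * f" unfolding dv f_def by (simp add: algebra_simps power2_eq_square power3_eq_cube)
      finally show "q w + (b - bt w) \<le> (b / real s) * f" .
    qed (use r_pos in auto)
    finally show ?thesis by (simp only: sum_A_const)
  qed
  then have "a * (u * (1 - \<theta>)) \<le> a * ((b / real s) * f)" by (simp add: mult_ac)
  then have 2: "u * (1 - \<theta>) \<le> (b / real s) * f" using a_pos by (rule mult_left_le_imp_le)
  have f: "0 \<le> f" using e by (simp add: f_def)
  have bs: "b / real s \<le> X1 * (1 + (23/50) * e ^ 3)"
  proof -
    have "b \<le> 1 - (1 - (23/50) * e ^ 2) * X1" using a_ge ab unfolding dv by (simp add: X1_def)
    moreover have "(real s + 1) * X1 = 1" by (simp add: X1_def)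
    ultimately have "b \<le> (real s + (23/50) * e ^ 2) * X1" by (simp add: algebra_simps)
    then have "b / real s \<le> (real s + (23/50) * e ^ 2) * X1 / real s" by (intro divide_right_mono) auto
    also have "\<dots> = X1 * (1 + (23/50) * e ^ 3)" using s6 by (simp add: e_def field_simps power2_eq_square power3_eq_cube)
    finally show ?thesis .
  qed
  have "\<theta> \<le> (3/20) * e"
  proof -
    have "real k \<ge> 5/6 * real s" using k_s s6 by simp
    then have "\<theta> \<le> 1 / (8 * (5/6 * real s))" unfolding \<theta>_def using s6 k_s by (intro divide_left_mono) auto
    then show ?thesis by (simp add: e_def)
  qed
  then have "u * (1 - (3/20) * e) \<le> u * (1 - \<theta>)" using u_nonneg by (intro mult_left_mono) auto
  also have "\<dots> \<le> X1 * (1 + (23/50) * e ^ 3) * f" using 2 mult_right_mono[OF bs f] by linarith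
  also have "\<dots> = X1 * ((1 + (23/50) * e ^ 3) * f)" by simp
  also have "\<dots> \<le> X1 * ((1 + (9/5) * e) * (1 - (23/50) * e ^ 2) * (1 - (3/20) * e))"
  proof (rule mult_left_mono)
    \<comment> \<open>In powers of e, the linear coefficients 13/10 on the left and 33/20 on the
      right leave (7/20) e for all other terms; these are reduced to multiples of e by e \<le>
      1/6.\<close>
    define e2 e3 where "e2 = e * e" and "e3 = e * e * e"
    have p: "0 \<le> e2" "0 \<le> e3" "e2 \<le> e / 6" "e3 \<le> e / 36" "e3 * e \<le> e / 216" "0 \<le> e3 * e" "e3 * e * e \<le> e / 1296" "0 \<le> e3 * e * e"
    proof -
      show e2: "e2 \<le> e / 6" using mult_left_mono[OF e(2) e(1)] by (simp add: e2_def)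
      show n: "0 \<le> e2" "0 \<le> e3" "0 \<le> e3 * e" "0 \<le> e3 * e * e" using e by (auto simp: e2_def e3_def)
      have "e3 \<le> e2 / 6" using mult_left_mono[OF e(2) n(1)] by (simp add: e2_def e3_def)
      then show e3: "e3 \<le> e / 36" using e2 by simp
      have "e3 * e \<le> e3 / 6" using mult_left_mono[OF e(2) n(2)] by simp
      then show e4: "e3 * e \<le> e / 216" using e3 by simp
      have "e3 * e * e \<le> e3 * e / 6" using mult_left_mono[OF e(2) n(3)] by simp
      then show "e3 * e * e \<le> e / 1296" using e4 by simp
    qed
    have L: "(1 + (23/50) * e ^ 3) * f = 1 + (13/10) * e + (33/50) * e2 + (23/50) * e3 + (299/500) * (e3 * e) + (759/2500) * (e3 * e * e)"
      by (simp add: f_def e2_def e3_def power2_eq_square power3_eq_cube algebra_simps)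
    have R: "(1 + (9/5) * e) * (1 - (23/50) * e ^ 2) * (1 - (3/20) * e) = 1 + (33/20) * e - (27/100) * e2 - (23/50) * e2 - (759/1000) * e3 + (621/5000) * (e3 * e)"
      by (simp add: e2_def e3_def power2_eq_square field_simps)
    show "(1 + (23/50) * e ^ 3) * f \<le> (1 + (9/5) * e) * (1 - (23/50) * e ^ 2) * (1 - (3/20) * e)"
      unfolding L R using p e by linarith
  qed (rule X1(1))
  also have "\<dots> = (1 + (9/5) * e) * ((1 - (23/50) * e ^ 2) * X1) * (1 - (3/20) * e)" by simp
  also have "\<dots> \<le> (1 + (9/5) * e) * a * (1 - (3/20) * e)"
  proof (intro mult_right_mono mult_left_mono)
    show "(1 - (23/50) * e ^ 2) * X1 \<le> a" using a_ge unfolding dv by (simp add: X1_def)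
  qed (use e in auto)
  finally have "u * (1 - (3/20) * e) \<le> (1 + (9/5) * e) * a * (1 - (3/20) * e)" .
  then have "u \<le> (1 + (9/5) * e) * a" by (rule mult_right_le_imp_le) (use e in auto)
  then show ?thesis by (simp add: e_def)
qed

text \<open>For l = 1, \<open>kp\<close> is 1/(k ee k), of the same order 1/k as \<theta>. The
  factor 8 in \<theta> makes the ratio at most (109/40)/8 < 341/1000.\<close>

lemma kp_\<theta>: "\<theta> \<le> (341/1000) * kp"
proof -
  define n where "n = k - 1"
  have n: "k = Suc n" "n \<ge> 4" using k_s(3) unfolding n_def by linarith+
  have "ee k * kp = 1 / real k"
  proof -
    have "ee k * kp = (real k / real n) ^ n * (real n ^ n / real k ^ k)"
    proof -
      have e: "k - 1 = n" "n + l = k" "real k - 1 = real n" using n real_l l_1 by auto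
      show ?thesis unfolding ee_def kp_def kap_def e pow_l real_l mult_1_right by (rule refl)
    qed
    also have "\<dots> = (real n ^ n / real n ^ n) * (real k ^ n / real k ^ k)" by (simp add: power_divide)
    also have "\<dots> = 1 / real k" using n by simp
    finally show ?thesis .
  qed
  moreover have "ee k * kp \<le> (109/40) * kp" using ee_le[of k] k_s kp_nonneg by (intro mult_right_mono) auto
  ultimately have "1 / real k \<le> (109/40) * kp" by simp
  then show ?thesis using kp_nonneg by (simp add: \<theta>_def)
qed

text \<open>The tangent touches at in-share 1/k, but a centre in U has at most \<theta> a
  in-neighbours in A, with \<theta> = 1/(8k). So \<open>AA_out\<close> applies with \<rho> =
  \<theta> a^(s-1), at most 341/1000 of \<open>kp * a ^ (s - 1)\<close>, and gains 2/3 (1 -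
  341/1000) > 439/1000 per unit of \<open>QU\<close>.\<close>

lemma AA_l1: "(\<Sum>x\<in>V. r * tt A x) \<le> kp * a ^ (s - 1) * (\<Sum>w\<in>A. r * q w) - (439/1000) * (kp * a ^ (s - 1)) * QU"
proof -
  have "(\<Sum>x\<in>V. r * tt A x) \<le> kp * a ^ (s - 1) * (\<Sum>w\<in>A. r * q w)
     - 2/3 * (kp * a ^ (s - 1) - \<theta> * a ^ (s - 1)) * (\<Sum>w\<in>A. r * m (In w \<inter> U))"
  proof (rule AA_out[OF UB])
    fix x assume x: "x \<in> U"
    define P where "P = m (Out x \<inter> A)"
    define Q where "Q = m (In x \<inter> A)"
    have PQ: "0 \<le> P" "0 \<le> Q" "P \<le> a" "Q \<le> \<theta> * a"
      using x by (auto simp: P_def Q_def a_def U_def intro!: m_mono)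
    have sp: "s - 1 = k" using k_s by auto
    have "tt A x \<le> P ^ k * Q ^ l" unfolding tt_def P_def Q_def by (rule cnt_le) auto
    also have "\<dots> = P * (P ^ (k - 1) * Q)" by (simp only: pow_k[of P] pow_l mult.assoc)
    also have "\<dots> \<le> P * (a ^ (k - 1) * (\<theta> * a))" using PQ a_nonneg by (intro mult_left_mono mult_mono power_mono) auto
    also have "\<dots> = \<theta> * a ^ (s - 1) * P" unfolding sp pow_k[of a] by (simp only: mult_ac)
    finally show "tt A x \<le> \<theta> * a ^ (s - 1) * m (Out x \<inter> A)" by (simp add: P_def)
  next
    fix w assume w: "w \<in> A"
    define Y where "Y = (real s - 1) * X1"
    have le: "m (In w \<inter> U) \<le> q w" unfolding q_def using UB by (intro m_mono) auto
    \<comment> \<open>At least a third of q w \<ge> (69/100) X1 remains, and 5 (23/100) exceeds the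
      101/100 in the bound on a.\<close>
    have "(real s - 1) * ((23/100) * X1) \<le> (real s - 1) * (q w - 2/3 * m (In w \<inter> U))"
      using q_bounds(1)[OF w] le s6 by (intro mult_left_mono) auto
    then have "(23/100) * Y \<le> (real s - 1) * (q w - 2/3 * m (In w \<inter> U))" by (simp add: Y_def)
    moreover have "5 * X1 \<le> Y" unfolding Y_def using s6 X1(1) by (intro mult_right_mono) auto
    ultimately show "a \<le> (real s - 1) * (q w - 2/3 * m (In w \<inter> U))" using X1(1,3) by linarith
  qed
  also have "\<dots> \<le> kp * a ^ (s - 1) * (\<Sum>w\<in>A. r * q w) - (439/1000) * (kp * a ^ (s - 1)) * QU"
  proof -
    have "\<theta> * a ^ (s - 1) \<le> (341/1000) * kp * a ^ (s - 1)" using kp_\<theta> a_nonneg by (intro mult_right_mono) auto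
    then have "\<theta> * a ^ (s - 1) \<le> (341/1000) * (kp * a ^ (s - 1))" by (simp only: mult.assoc)
    moreover have "0 \<le> kp * a ^ (s - 1)" using kp_nonneg a_nonneg by simp
    moreover have "t \<le> (341/1000) * h \<Longrightarrow> 0 \<le> h \<Longrightarrow> (439/1000) * h \<le> 2/3 * (h - t)" for t h :: real
    proof -
      assume th: "t \<le> (341/1000) * h" "0 \<le> h"
      have "2/3 * (h - t) - (439/1000) * h = 2/3 * ((341/1000) * h - t) + h / 3000" by (simp add: field_simps)
      moreover have "0 \<le> 2/3 * ((341/1000) * h - t)" using th by simp
      ultimately show ?thesis using th by linarith
    qed
    ultimately have "(439/1000) * (kp * a ^ (s - 1)) \<le> 2/3 * (kp * a ^ (s - 1) - \<theta> * a ^ (s - 1))" by blast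
    moreover have "0 \<le> QU" unfolding QU_def using r_pos by (intro sum_nonneg) auto
    ultimately have "(439/1000) * (kp * a ^ (s - 1)) * QU \<le> 2/3 * (kp * a ^ (s - 1) - \<theta> * a ^ (s - 1)) * QU"
      by (intro mult_right_mono) auto
    then show ?thesis by (simp add: QU_def)
  qed
  finally show ?thesis .
qed

section \<open>Charging the stars inside B\<close>

definition \<chi> where "\<chi> = \<kappa> * ((199/200) * ww s) / b ^ 2"

text \<open>With one in-leaf only \<open>cnt_pair_out\<close> is available, so an arc inside B is
  noticed only from an end that is an out-neighbour of c. The loss per unit is p^(k-1) q / bt, for
  which \<open>\<chi>\<close> is a lower bound common to all c in A.\<close>

lemma tt_B_A1:
  assumes c: "c \<in> A"
  shows "tt B c \<le> g c * b ^ s - g c * (b ^ (s - 1) * (b - bt c)) - \<chi> * (\<Sum>v\<in>Out c \<inter> B. r * bt v)"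
proof -
  note bt = bt_pos[OF c]
  define S where "S = (\<Sum>v\<in>Out c \<inter> B. r * bt v)"
  have S: "0 \<le> S" unfolding S_def using r_pos bt_nonneg by (intro sum_nonneg) auto
  have un: "(Out c \<inter> B) \<union> (In c \<inter> B) = Nb c \<inter> B" by (auto simp: nb_def)
  have ks: "p c ^ (k - 1) * p c = p c ^ k" using k1 by (cases k) auto
  have "bt c * tt B c \<le> p c ^ (k - 1) * q c ^ l * (\<Sum>v\<in>Out c \<inter> B. r * m (Far v (Nb c \<inter> B)))"
    using cnt_pair_out[of "Out c \<inter> B" "In c \<inter> B" k l] l1 k_s outs_ins_disjoint[of E c] pq_bt[of c]
    unfolding tt_def un by (auto simp: p_def q_def)
  also have "\<dots> \<le> p c ^ (k - 1) * q c ^ l * (p c * b - S)"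
  proof (rule mult_left_mono)
    have "(\<Sum>v\<in>Out c \<inter> B. r * m (Far v (Nb c \<inter> B))) \<le> (\<Sum>v\<in>Out c \<inter> B. r * (b - bt v))"
      by (rule sum_Far_B) auto
    also have "\<dots> = (\<Sum>v\<in>Out c \<inter> B. r * b) - S" by (simp add: S_def right_diff_distrib sum_subtractf)
    also have "(\<Sum>v\<in>Out c \<inter> B. r * b) = p c * b" unfolding p_def by (rule sum_r_const) simp
    finally show "(\<Sum>v\<in>Out c \<inter> B. r * m (Far v (Nb c \<inter> B))) \<le> p c * b - S" .
  qed (use pq_nonneg in auto)
  also have "\<dots> = p c ^ (k - 1) * p c * q c ^ l * b - p c ^ (k - 1) * q c ^ l * S" by (simp add: algebra_simps)
  also have "p c ^ (k - 1) * p c * q c ^ l = g c * bt c ^ s" unfolding ks by (rule pq_g[OF bt])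
  finally have 1: "bt c * tt B c \<le> g c * bt c ^ s * b - p c ^ (k - 1) * q c ^ l * S" .
  have 2: "\<chi> * S * bt c \<le> p c ^ (k - 1) * q c ^ l * S"
  proof -
    have pb: "p c \<le> b" using bt_le_b[of c] pq_bt[of c] pq_nonneg(2)[of c] by linarith
    have "\<chi> * bt c * b ^ 2 = \<kappa> * (ww s * (199/200)) * bt c" using b_pos by (simp add: \<chi>_def)
    also have "\<dots> \<le> \<kappa> * (ww s * (1 - (9/50) / real s ^ 2)) * b"
    proof (intro mult_mono mult_left_mono)
      have "(9/50) / real s ^ 2 = (9/50) * (1 / real s ^ 2)" by simp
      then show "(199/200) \<le> 1 - (9/50) / real s ^ 2" using s2' by linarith
      then show "0 \<le> \<kappa> * (ww s * (1 - (9/50) / real s ^ 2))" using \<kappa>_pos w_ge by simp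
    qed (use \<kappa>_pos w_ge bt_le_b bt in auto)
    also have "\<dots> \<le> p c ^ k * q c ^ l * b" using pq_ge[OF c] b_nonneg by (intro mult_right_mono) auto
    also have "p c ^ k = p c ^ (k - 1) * p c" by (rule ks[symmetric])
    also have "p c ^ (k - 1) * p c * q c ^ l * b \<le> p c ^ (k - 1) * b * q c ^ l * b"
      using pq_nonneg b_nonneg pb by (intro mult_right_mono mult_left_mono) auto
    also have "\<dots> = p c ^ (k - 1) * q c ^ l * b ^ 2" by (simp add: power2_eq_square)
    finally have "\<chi> * bt c \<le> p c ^ (k - 1) * q c ^ l" using b_pos by simp
    then have "\<chi> * bt c * S \<le> p c ^ (k - 1) * q c ^ l * S" using S by (rule mult_right_mono)
    then show ?thesis by (simp add: mult_ac)
  qed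
  have 3: "g c * bt c ^ s * b \<le> bt c * (g c * b ^ s - g c * (b ^ (s - 1) * (b - bt c)))"
  proof -
    have sp: "bt c ^ s = bt c * (bt c * bt c ^ (s - 2))" "b ^ s = b * (b * b ^ (s - 2))" "b ^ (s - 1) = b * b ^ (s - 2)"
      using power_split[of 2 s "bt c"] power_split[of 2 s b] power_split[of 1 "s - 1" b] s6
      by (auto simp: power2_eq_square numeral_2_eq_2)
    have "g c * bt c ^ s * b = g c * (bt c * (bt c * b)) * bt c ^ (s - 2)" by (simp add: sp)
    also have "\<dots> \<le> g c * (bt c * (bt c * b)) * b ^ (s - 2)"
      using g_nonneg bt b_nonneg bt_le_b by (intro mult_left_mono power_mono) auto
    also have "\<dots> = bt c * (g c * b ^ s - g c * (b ^ (s - 1) * (b - bt c)))" unfolding sp by (simp add: algebra_simps)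
    finally show ?thesis .
  qed
  have "bt c * tt B c \<le> bt c * (g c * b ^ s - g c * (b ^ (s - 1) * (b - bt c)) - \<chi> * S)"
    using 1 2 3 by (simp add: algebra_simps)
  then show ?thesis using bt by (simp add: S_def)
qed

text \<open>Summed over c, the loss at v is weighted by the measure of its in-neighbours in A. This
  is more than \<theta> a outside U; the arcs inside U are not charged here.\<close>

lemma sum_tt_B_A1: "(\<Sum>c\<in>A. r * tt B c) \<le> (\<Sum>c\<in>A. r * (g c * b ^ s)) - (7/20) * \<kappa> * mu - \<chi> * (\<theta> * a * EN)"
proof -
  have "(\<Sum>c\<in>A. r * tt B c) \<le> (\<Sum>c\<in>A. r * (g c * b ^ s - g c * (b ^ (s - 1) * (b - bt c)) - \<chi> * (\<Sum>v\<in>Out c \<inter> B. r * bt v)))"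
    using tt_B_A1 r_pos by (intro sum_mono mult_left_mono) auto
  also have "\<dots> = (\<Sum>c\<in>A. r * (g c * b ^ s)) - (\<Sum>c\<in>A. r * (g c * (b ^ (s - 1) * (b - bt c)))) - \<chi> * (\<Sum>c\<in>A. r * (\<Sum>v\<in>Out c \<inter> B. r * bt v))"
  proof -
    have "(\<Sum>c\<in>A. r * (g c * b ^ s - g c * (b ^ (s - 1) * (b - bt c)) - \<chi> * (\<Sum>v\<in>Out c \<inter> B. r * bt v))) =
      (\<Sum>c\<in>A. r * (g c * b ^ s) - r * (g c * (b ^ (s - 1) * (b - bt c))) - \<chi> * (r * (\<Sum>v\<in>Out c \<inter> B. r * bt v)))"
      by (intro sum.cong refl) (simp add: algebra_simps)
    then show ?thesis by (simp only: sum_subtractf sum_distrib_left)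
  qed
  also have "(\<Sum>c\<in>A. r * (\<Sum>v\<in>Out c \<inter> B. r * bt v)) = (\<Sum>v\<in>B. r * (m (In v \<inter> A) * bt v))"
    by (rule sum_m_Int_swap[symmetric]) (auto simp: outs_def ins_def)
  finally have 1: "(\<Sum>c\<in>A. r * tt B c) \<le> (\<Sum>c\<in>A. r * (g c * b ^ s)) - (\<Sum>c\<in>A. r * (g c * (b ^ (s - 1) * (b - bt c)))) - \<chi> * (\<Sum>v\<in>B. r * (m (In v \<inter> A) * bt v))" .
  have "\<theta> * a * EN = (\<Sum>v\<in>B - U. r * (\<theta> * a * bt v))" unfolding EN_def by (subst sum_distrib_left) (simp add: mult_ac)
  also have "\<dots> \<le> (\<Sum>v\<in>B - U. r * (m (In v \<inter> A) * bt v))"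
    using r_pos bt_nonneg by (intro sum_mono mult_left_mono mult_right_mono) (auto simp: U_def)
  also have "\<dots> \<le> (\<Sum>v\<in>B. r * (m (In v \<inter> A) * bt v))"
    using r_pos bt_nonneg by (intro sum_mono2) auto
  finally have "\<chi> * (\<theta> * a * EN) \<le> \<chi> * (\<Sum>v\<in>B. r * (m (In v \<inter> A) * bt v))"
    using \<kappa>_pos w_ge by (intro mult_left_mono) (auto simp: \<chi>_def)
  then show ?thesis using 1 sum_g_mu by linarith
qed

text \<open>A star centred in U with a leaf outside U uses an arc that is charged to
  \<open>EN\<close>; only stars with all leaves in U remain.\<close>

lemma tt_B_U:
  assumes x: "x \<in> U"
  shows "tt B x \<le> tt U x + (\<Sum>v\<in>Nb x \<inter> (B - U). r * (G * ((21/20) * X1) ^ (s - 1)))"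
proof -
  let ?P = "Out x \<inter> B" and ?Q = "In x \<inter> B"
  have dj: "?P \<inter> ?Q = {}" using outs_ins_disjoint[of E x] by auto
  have un: "?P \<union> ?Q = Nb x \<inter> B" by (auto simp: nb_def)
  have sub: "sel E k l ?P ?Q \<subseteq> sel E k l (Out x \<inter> U) (In x \<inter> U) \<union>
      (\<Union>v\<in>Nb x \<inter> (B - U). {F \<in> sel E k l ?P ?Q. v \<in> fst F \<union> snd F})"
  proof
    fix F assume F: "F \<in> sel E k l ?P ?Q"
    obtain K L where KL: "F = (K, L)" by (metis surj_pair)
    have sb: "K \<subseteq> Out x" "L \<subseteq> In x" "K \<subseteq> B" "L \<subseteq> B" using F by (auto simp: KL sel_def)
    show "F \<in> sel E k l (Out x \<inter> U) (In x \<inter> U) \<union>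
      (\<Union>v\<in>Nb x \<inter> (B - U). {F \<in> sel E k l ?P ?Q. v \<in> fst F \<union> snd F})"
    proof (cases "K \<union> L \<subseteq> U")
      case True
      then show ?thesis using F sb by (auto simp: KL sel_def)
    next
      case False
      then obtain w where "w \<in> K \<union> L" "w \<notin> U" by auto
      then show ?thesis using F sb by (auto simp: KL nb_def)
    qed
  qed
  have "tt B x \<le> W k l (sel E k l (Out x \<inter> U) (In x \<inter> U) \<union>
      (\<Union>v\<in>Nb x \<inter> (B - U). {F \<in> sel E k l ?P ?Q. v \<in> fst F \<union> snd F}))"
    unfolding tt_def cnt_def by (rule W_mono[OF sub]) (intro finite_UnI finite_sel finite_UN_I finite_selF; simp)
  also have "\<dots> \<le> tt U x + W k l (\<Union>v\<in>Nb x \<inter> (B - U). {F \<in> sel E k l ?P ?Q. v \<in> fst F \<union> snd F})"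
    unfolding tt_def cnt_def by (rule W_Un)
  also have "\<dots> \<le> tt U x + (\<Sum>v\<in>Nb x \<inter> (B - U). thr k l ?P ?Q v)"
    unfolding thr_def by (intro add_left_mono W_UN) simp
  also have "\<dots> \<le> tt U x + (\<Sum>v\<in>Nb x \<inter> (B - U). r * (G * ((21/20) * X1) ^ (s - 1)))"
  proof (intro add_left_mono sum_mono)
    fix v assume v: "v \<in> Nb x \<inter> (B - U)"
    have xB: "x \<in> B" using x UB by auto
    have "thr k l ?P ?Q v \<le> r * G * m (Far v (?P \<union> ?Q)) ^ (s - 1)"
      using v dj un by (intro thr_le') auto
    also have "\<dots> \<le> r * G * ((21/20) * X1) ^ (s - 1)"
    proof (intro mult_left_mono power_mono)
      have "m (Far v (?P \<union> ?Q)) \<le> bt x" unfolding un bt_def by (intro m_mono far_subset) auto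
      then show "m (Far v (?P \<union> ?Q)) \<le> (21/20) * X1" using X1(5)[OF xB] by linarith
    qed (use r_pos G_nonneg in auto)
    finally show "thr k l ?P ?Q v \<le> r * (G * ((21/20) * X1) ^ (s - 1))" by simp
  qed
  finally show ?thesis .
qed

text \<open>By an out-leaf w: with z the measure of the neighbours of w in U, the centres have
  measure at most z and the candidates for the other leaves at most u - z. The product z (u-z)^(s-1)
  is bounded by \<open>kap 1 (s - 1)\<close> times u^s.\<close>

lemma sum_tt_U: "(\<Sum>x\<in>U. r * tt U x) \<le> kp * kap 1 (s - 1) * u ^ s * u"
proof -
  have "(\<Sum>x\<in>U. r * tt U x) \<le> (\<Sum>w\<in>U. r * (m (In w \<inter> U) * (kp * m (Far w U) ^ (s - 1))))"
    unfolding tt_def kp_def using sum_cnt_out[OF finU finU k1, of l, folded s_def] .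
  also have "\<dots> \<le> (\<Sum>w\<in>U. r * (kp * kap 1 (s - 1) * u ^ s))"
  proof (intro sum_mono mult_left_mono)
    fix w
    define z where "z = m (Nb w \<inter> U)"
    have z: "0 \<le> z" "z \<le> u" unfolding z_def u_def by (auto intro: m_mono)
    have "m (In w \<inter> U) * (kp * m (Far w U) ^ (s - 1)) \<le> z * (kp * (u - z) ^ (s - 1))"
    proof (intro mult_mono mult_left_mono power_mono)
      show "m (In w \<inter> U) \<le> z" unfolding z_def by (intro m_mono) (auto simp: nb_def)
      show "m (Far w U) \<le> u - z" unfolding u_def z_def by (rule m_Far_le) simp
    qed (use z kp_nonneg in auto)
    also have "\<dots> = kp * (z ^ 1 * (u - z) ^ (s - 1))" by simp
    also have "\<dots> \<le> kp * (kap 1 (s - 1) * (z + (u - z)) ^ (1 + (s - 1)))"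
      using z kp_nonneg by (intro mult_left_mono pow_mult_pow_le_kap) auto
    also have "\<dots> = kp * kap 1 (s - 1) * u ^ s" using s6 by simp
    finally show "m (In w \<inter> U) * (kp * m (Far w U) ^ (s - 1)) \<le> kp * kap 1 (s - 1) * u ^ s" .
  qed (use r_pos in auto)
  also have "\<dots> = u * (kp * kap 1 (s - 1) * u ^ s)" unfolding u_def by (rule sum_r_const) simp
  finally show ?thesis by (simp add: mult_ac)
qed

lemma sum_tt_B_B1: "(\<Sum>x\<in>B. r * tt B x) \<le> (\<kappa> + G) * ((21/20) * X1) ^ (s - 1) * EN + kp * kap 1 (s - 1) * u ^ s * u"
proof -
  have "(\<Sum>x\<in>B. r * tt B x) = (\<Sum>x\<in>B - U. r * tt B x) + (\<Sum>x\<in>U. r * tt B x)"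
    using UB by (intro sum.subset_diff) auto
  also have "(\<Sum>x\<in>B - U. r * tt B x) \<le> \<kappa> * ((21/20) * X1) ^ (s - 1) * EN"
    unfolding EN_def by (rule tt_B_B_sum) auto
  also have "(\<Sum>x\<in>U. r * tt B x) \<le> (\<Sum>x\<in>U. r * (tt U x + (\<Sum>v\<in>Nb x \<inter> (B - U). r * (G * ((21/20) * X1) ^ (s - 1)))))"
    using tt_B_U r_pos by (intro sum_mono mult_left_mono) auto
  also have "\<dots> = (\<Sum>x\<in>U. r * tt U x) + (\<Sum>x\<in>U. r * (\<Sum>v\<in>Nb x \<inter> (B - U). r * (G * ((21/20) * X1) ^ (s - 1))))"
    by (simp add: distrib_left sum.distrib del: sum_constant)
  also have "(\<Sum>x\<in>U. r * (\<Sum>v\<in>Nb x \<inter> (B - U). r * (G * ((21/20) * X1) ^ (s - 1)))) =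
      (\<Sum>v\<in>B - U. r * (m (Nb v \<inter> U) * (G * ((21/20) * X1) ^ (s - 1))))"
    by (rule sum_m_Int_swap[symmetric]) (auto simp: nb_sym)
  also have "\<dots> \<le> (\<Sum>v\<in>B - U. r * (bt v * (G * ((21/20) * X1) ^ (s - 1))))"
    unfolding bt_def using r_pos G_nonneg X1(1) UB by (intro sum_mono mult_left_mono mult_right_mono m_mono) auto
  also have "\<dots> = G * ((21/20) * X1) ^ (s - 1) * EN" unfolding EN_def by (subst sum_distrib_left) (simp add: mult_ac)
  finally show ?thesis using sum_tt_U by (simp add: algebra_simps)
qed

lemma EN_charge: "(\<kappa> + G) * ((21/20) * X1) ^ (s - 1) \<le> \<chi> * (\<theta> * a)"
proof -
  define Y where "Y = ((21/20) * X1) ^ (s - 2)"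
  define c where "c = \<kappa> * (1 + (109/40) * real s) * ((21/20) * X1 * Y)"
  have Y: "0 \<le> Y" using X1(1) by (simp add: Y_def)
  have sp: "((21/20) * X1) ^ (s - 1) = (21/20) * X1 * Y" unfolding Y_def using power_split[of 1 "s - 1" "(21/20) * X1"] s6 by (simp add: numeral_2_eq_2)
  have b2: "(real s - 1) * b \<le> real s - (17/10)"
  proof -
    have "(23/50) / real s ^ 2 = (23/50) * (1 / real s ^ 2)" by simp
    then have "(987/1000) \<le> 1 - (23/50) / real s ^ 2" using s2' by linarith
    then have "(987/1000) / (real s + 1) \<le> a" using a_ge divide_right_mono[of "(987/1000)" "1 - (23/50) / real s ^ 2" "real s + 1"] by linarith
    then have "b \<le> 1 - (987/1000) / (real s + 1)" using ab by simp
    also have "\<dots> = (real s + (13/1000)) / (real s + 1)" by (simp add: field_simps)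
    finally have "(real s - 1) * b \<le> (real s - 1) * ((real s + (13/1000)) / (real s + 1))" using s6 by (intro mult_left_mono) auto
    also have "\<dots> \<le> real s - (17/10)"
    proof -
      have "(real s - 1) * (real s + (13/1000)) \<le> (real s - (17/10)) * (real s + 1)"
      proof -
        have "(real s - (17/10)) * (real s + 1) - (real s - 1) * (real s + (13/1000)) = (287/1000) * real s - (1687/1000)"
          by (simp add: field_simps)
        then show ?thesis using s_real by linarith
      qed
      then show ?thesis by (simp add: pos_divide_le_eq)
    qed
    finally show ?thesis .
  qed
  have "(\<kappa> + G) * ((21/20) * X1) ^ (s - 1) \<le> c"
  proof -
    have "\<kappa> + G = \<kappa> * (1 + ee s * real s)" by (simp add: G_def algebra_simps)
    also have "\<dots> \<le> \<kappa> * (1 + (109/40) * real s)" using ee_le[of s] s6 \<kappa>_pos by (intro mult_left_mono add_left_mono mult_right_mono) auto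
    finally show ?thesis unfolding sp c_def using X1(1) Y by (intro mult_right_mono) auto
  qed
  also have "c * (b ^ 2 * (8 * real k)) \<le> \<kappa> * ((199/200) * ww s) * a"
  proof -
    have "c * (b ^ 2 * (8 * real k)) = \<kappa> * X1 * ((42/5) * (1 + (109/40) * real s) * (((real s - 1) * b) * Y)) * b"
    proof -
      have e: "(42/5 :: real) = 8 * (21/20)" by simp
      show ?thesis unfolding c_def k_s(2) power2_eq_square e by (simp only: mult_ac)
    qed
    also have "\<dots> \<le> \<kappa> * X1 * ((42/5) * (1 + (109/40) * real s) * ((real s - (17/10)) * Y)) * b"
      using b2 Y X1(1) \<kappa>_pos b_nonneg by (intro mult_right_mono mult_left_mono) auto
    also have "\<dots> \<le> \<kappa> * X1 * (33/100) * 1"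
    proof (intro mult_mono mult_left_mono)
      show "(42/5) * (1 + (109/40) * real s) * ((real s - (17/10)) * Y) \<le> (33/100)"
        using num_chi[OF s6] by (simp add: Y_def X1_def)
    qed (use X1(1) \<kappa>_pos b_nonneg b_le_1 Y s6 in \<open>auto intro!: mult_nonneg_nonneg\<close>)
    also have "\<dots> \<le> \<kappa> * ((199/200) * ww s) * a"
    proof -
      have "(17/50) * X1 \<le> ((199/200) * ww s) * a"
      proof -
        have "((199/200) * (367/1000)) * ((49/50) * X1) \<le> ((199/200) * ww s) * a" using w_ge X1(1,4) by (intro mult_mono) auto
        then show ?thesis using X1(1) by linarith
      qed
      then have "(33/100) * X1 \<le> ((199/200) * ww s) * a" using X1(1) by linarith
      then have "\<kappa> * ((33/100) * X1) \<le> \<kappa> * (((199/200) * ww s) * a)" using \<kappa>_pos by (intro mult_left_mono) auto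
      then show ?thesis by (simp add: mult_ac)
    qed
    finally show ?thesis .
  qed
  then have "c \<le> \<kappa> * ((199/200) * ww s) * a / (b ^ 2 * (8 * real k))"
    using b_pos k_s by (subst pos_le_divide_eq) auto
  then have "c \<le> \<chi> * (\<theta> * a)" by (simp add: \<chi>_def \<theta>_def)
  finally show ?thesis .
qed

text \<open>The stars inside U are paid by the gain in \<open>AA_l1\<close>. By \<open>u_le\<close>,
  u^s \<le> exp (9/5) a^s, and \<open>kap 1 (s - 1)\<close> = 1/(s ee s) is at most 5/72; the margin
  is that of (139/2000)(303/50) against (439/1000)(39/40).\<close>

lemma U_charge: "kp * kap 1 (s - 1) * u ^ s * u \<le> (439/1000) * (kp * a ^ (s - 1)) * (u * ((1 - \<theta>) * a))"
proof -
  have "kap 1 (s - 1) \<le> (139/2000)"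
  proof -
    have "6 * (12/5) \<le> real s * ee s" using s6 ee_ge[OF s6] by (intro mult_mono) auto
    moreover have "real s * ee s * kap 1 (s - 1) = 1" using ee_kap[of 1 "s - 1"] s6 by simp
    moreover have "6 * (12/5) * kap 1 (s - 1) \<le> real s * ee s * kap 1 (s - 1)"
      using calculation(1) kap_nonneg by (intro mult_right_mono) auto
    ultimately show ?thesis by simp
  qed
  moreover have "u ^ s \<le> (303/50) * a ^ s"
  proof -
    have "u ^ s \<le> ((1 + (9/5) / real s) * a) ^ s" using u_le u_nonneg by (intro power_mono) auto
    also have "\<dots> = (1 + (9/5) / real s) ^ s * a ^ s" by (simp add: power_mult_distrib)
    also have "(1 + (9/5) / real s) ^ s \<le> exp ((9/5) / real s) ^ s"
      using exp_ge_add_one_self[of "(9/5) / real s"] by (intro power_mono) auto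
    also have "\<dots> = exp (9/5)" using s6 by (simp add: exp_of_nat_mult[symmetric])
    also have "\<dots> \<le> (303/50)" using exp_9_5 by simp
    finally show ?thesis using a_nonneg by (simp add: mult_right_mono)
  qed
  ultimately have "kap 1 (s - 1) * u ^ s \<le> (139/2000) * ((303/50) * a ^ s)" using kap_nonneg u_nonneg by (intro mult_mono) auto
  also have "\<dots> \<le> (439/1000) * (1 - \<theta>) * a ^ s"
    using \<theta> a_nonneg by (simp only: mult.assoc[symmetric]) (intro mult_right_mono; simp)
  finally have "kp * u * (kap 1 (s - 1) * u ^ s) \<le> kp * u * ((439/1000) * (1 - \<theta>) * a ^ s)"
    using kp_nonneg u_nonneg by (intro mult_left_mono) auto
  moreover have "a ^ s = a ^ (s - 1) * a" using s6 by (cases s) auto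
  ultimately show ?thesis by (simp add: algebra_simps)
qed

text \<open>Since \<open>QU_ge\<close> holds only up to \<open>mu\<close>, a further multiple of
  \<open>kp * a ^ (s - 1) * mu\<close> has to be paid by the pairs missing between A and B. This is
  why \<open>Gam_kp\<close> includes that summand.\<close>

lemma T_le_gt_l1: "T \<le> (\<Sum>c\<in>A. r * (g c * b ^ s)) + kp * a ^ (s - 1) * (\<Sum>w\<in>A. r * q w)"
proof -
  define h where "h = kp * a ^ (s - 1)"
  have h: "0 \<le> h" using kp_nonneg a_nonneg by (simp add: h_def)
  have 1: "(\<kappa> + G) * ((21/20) * X1) ^ (s - 1) * EN \<le> \<chi> * (\<theta> * a * EN)"
    using mult_right_mono[OF EN_charge EN_nonneg] by (simp add: mult_ac)
  have "(439/1000) * h * (u * ((1 - \<theta>) * a) - mu) \<le> (439/1000) * h * QU"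
    using QU_ge h by (intro mult_left_mono) auto
  moreover have "(439/1000) * h * mu \<le> h * mu" using h mu_nonneg by (simp add: mult_right_mono)
  ultimately have 2: "(439/1000) * h * (u * ((1 - \<theta>) * a)) - h * mu \<le> (439/1000) * h * QU"
    by (simp add: right_diff_distrib)
  have "(Gam + h) * mu \<le> ((7/20) * \<kappa>) * mu" using Gam_kp mu_nonneg unfolding h_def by (intro mult_right_mono) auto
  then have 3: "Gam * mu + h * mu \<le> (7/20) * \<kappa> * mu" by (simp add: distrib_right)
  show ?thesis
    using T_split sum_tt_B_A1 sum_tt_B_B1 AA_l1 1 2 3 U_charge unfolding h_def[symmetric] by linarith
qed

end

section \<open>Bipartite constructions\<close>

lemma fact_binomial_ge: "(p - k) ^ k \<le> fact k * (p choose k)"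
proof (induction k)
  case (Suc k)
  have "(p - Suc k) ^ Suc k \<le> (p - k) ^ k * (p - k)"
    by (simp add: mult.commute mult_le_mono power_mono)
  also have "\<dots> \<le> fact k * (p choose k) * (p - k)" using Suc by (rule mult_le_mono1)
  also have "\<dots> = fact k * (Suc k * (p choose Suc k))"
    by (simp only: binomial_absorption binomial_absorb_comp[symmetric]) (simp add: mult_ac)
  also have "\<dots> = fact (Suc k) * (p choose Suc k)" by (simp add: algebra_simps)
  finally show ?case .
qed simp

text \<open>Every block of g consecutive numbers meets each residue once and thus contains exactly h
  hits; the incomplete block is dropped.\<close>

lemma card_residues_ge:
  fixes c g h x y :: nat
  assumes "h \<le> g" "g > 0"
  shows "card {j \<in> {x..<x + y}. (c + j) mod g < h} \<ge> h * (y div g)"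
proof -
  have "card {j \<in> {x..<x + t * g}. (c + j) mod g < h} = h * t" for t
  proof (induction t)
    case (Suc t)
    define z where "z = x + t * g"
    have one: "card {j \<in> {z..<z + g}. (c + j) mod g < h} = h"
    proof -
      define f where "f j = (c + j) mod g" for j
      have inj: "inj_on f {z..<z + g}"
      proof (rule inj_onI)
        fix i j assume ij: "i \<in> {z..<z + g}" "j \<in> {z..<z + g}" "f i = f j"
        have aux: "i' = j'" if "i' \<le> j'" "j' < i' + g" "f i' = f j'" for i' j'
        proof (rule ccontr)
          assume "i' \<noteq> j'"
          then have pos: "0 < j' - i'" using that by simp
          have "g dvd (c + j') - (c + i')" using that by (intro mod_eq_dvd_iff_nat[THEN iffD1]) (auto simp: f_def)
          then have "g dvd j' - i'" by simp
          then have "g \<le> j' - i'" using pos by (rule dvd_imp_le)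
          then show False using that by simp
        qed
        show "i = j"
        proof (cases "i \<le> j")
          case True
          show ?thesis by (rule aux[OF True _ ij(3)]) (use ij(1,2) in simp)
        next
          case False
          then have "j \<le> i" by simp
          then show ?thesis by (rule aux[OF _ _ ij(3)[symmetric], symmetric]) (use ij(1,2) in simp)
        qed
      qed
      have sub: "f ` {z..<z + g} \<subseteq> {..<g}" using assms by (auto simp: f_def)
      have "card (f ` {z..<z + g}) = card {..<g}" using card_image[OF inj] by simp
      with sub have full: "f ` {z..<z + g} = {..<g}" by (intro card_subset_eq) simp_all
      have "f ` {j \<in> {z..<z + g}. f j < h} = f ` {z..<z + g} \<inter> {..<h}" by auto
      then have img: "f ` {j \<in> {z..<z + g}. f j < h} = {..<h}" unfolding full using assms by auto
      have "inj_on f {j \<in> {z..<z + g}. f j < h}" by (rule inj_on_subset[OF inj]) auto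
      then have "card {j \<in> {z..<z + g}. f j < h} = h" using card_image img by (metis card_lessThan)
      then show ?thesis by (simp add: f_def)
    qed
    define P where "P j \<longleftrightarrow> (c + j) mod g < h" for j
    have e: "{j \<in> {x..<x + Suc t * g}. P j} = {j \<in> {x..<z}. P j} \<union> {j \<in> {z..<z + g}. P j}"
      by (auto simp: z_def)
    have "card {j \<in> {x..<x + Suc t * g}. P j} = card {j \<in> {x..<z}. P j} + card {j \<in> {z..<z + g}. P j}"
      unfolding e by (rule card_Un_disjoint) auto
    then show ?case using Suc one unfolding P_def z_def by simp
  qed simp
  from this[of "y div g"] have 1: "h * (y div g) = card {j \<in> {x..<x + (y div g) * g}. (c + j) mod g < h}" by (simp only:)
  have "z \<le> y \<Longrightarrow> card {j \<in> {x..<x + z}. P j} \<le> card {j \<in> {x..<x + y}. P j}" for z P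
    by (rule card_mono) auto
  from this[OF div_times_less_eq_dividend[of y g]] show ?thesis unfolding 1 .
qed

text \<open>The shift by g - h moves the residues h, ..., g - 1 to 0, ..., g - h - 1, where the
  previous count applies.\<close>

lemma card_non_residues_ge:
  fixes c g h x y :: nat
  assumes "h \<le> g" "g > 0"
  shows "card {j \<in> {x..<x + y}. \<not> (c + j) mod g < h} \<ge> (g - h) * (y div g)"
proof -
  have "{j \<in> {x..<x + y}. (c + (g - h) + j) mod g < g - h} \<subseteq> {j \<in> {x..<x + y}. \<not> (c + j) mod g < h}"
  proof clarify
    fix j assume *: "(c + (g - h) + j) mod g < g - h" "(c + j) mod g < h"
    have "(c + (g - h) + j) mod g = ((c + j) mod g + (g - h)) mod g" by (simp add: mod_simps add.commute add.left_commute)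
    also have "\<dots> = (c + j) mod g + (g - h)" using *(2) assms by simp
    finally have "(c + (g - h) + j) mod g = (c + j) mod g + (g - h)" .
    then show False using *(1) by linarith
  qed
  then have "card {j \<in> {x..<x + y}. (c + (g - h) + j) mod g < g - h} \<le> card {j \<in> {x..<x + y}. \<not> (c + j) mod g < h}"
    by (intro card_mono) auto
  then show ?thesis using card_residues_ge[of "g - h" g y x "c + (g - h)"] assms by simp
qed

text \<open>The residue condition splits the arcs between {..<x} and {x..<x+y} evenly at every vertex, in the
  proportion h : g - h.\<close>

definition bip :: "nat \<Rightarrow> nat \<Rightarrow> nat \<Rightarrow> nat \<Rightarrow> nat \<Rightarrow> (nat \<times> nat) set" where
  "bip n x y g h = {(j, i). i < x \<and> x \<le> j \<and> j < x + y \<and> (i + j) mod g < h}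
     \<union> {(i, j). i < x \<and> x \<le> j \<and> j < n \<and> \<not> (j < x + y \<and> (i + j) mod g < h)}"

lemma digraph_bip: "x + y \<le> n \<Longrightarrow> digraph {..<n} (bip n x y g h)"
proof -
  assume "x + y \<le> n"
  then have "i < x \<Longrightarrow> i < n" "j < x + y \<Longrightarrow> j < n" for i j by simp_all
  then have "bip n x y g h \<subseteq> {..<n} \<times> {..<n}" unfolding bip_def by blast
  moreover have "(i, i) \<notin> bip n x y g h" for i unfolding bip_def by simp
  ultimately show ?thesis by (simp add: digraph_def)
qed

lemma bip_indep:
  "X \<subseteq> {..<x} \<Longrightarrow> indep (bip n x y g h) X" "X \<subseteq> {x..} \<Longrightarrow> indep (bip n x y g h) X"
proof -
  have "u < x \<and> v < x \<Longrightarrow> (u, v) \<notin> bip n x y g h" "x \<le> u \<and> x \<le> v \<Longrightarrow> (u, v) \<notin> bip n x y g h" for u v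
    by (auto simp: bip_def)
  then show "X \<subseteq> {..<x} \<Longrightarrow> indep (bip n x y g h) X" "X \<subseteq> {x..} \<Longrightarrow> indep (bip n x y g h) X"
    unfolding indep_def adj_def by (meson subsetD lessThan_iff atLeast_iff)+
qed

lemma card_sel_indep:
  assumes "finite P" "finite Q" "indep E (P \<union> Q)"
  shows "card (sel E k l P Q) = (card P choose k) * (card Q choose l)"
proof -
  have "sel E k l P Q = {K. K \<subseteq> P \<and> card K = k} \<times> {L. L \<subseteq> Q \<and> card L = l}"
    using assms(3) by (auto simp: sel_def indep_def)
  then show ?thesis using assms by (simp add: card_cartesian_product n_subsets)
qed

lemma fact_card_sel_ge:
  assumes "finite P" "finite Q" "indep E (P \<union> Q)" "p \<le> card P" "q \<le> card Q"
  shows "fact k * fact l * card (sel E k l P Q) \<ge> (p - k) ^ k * (q - l) ^ l"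
proof -
  have "(p - k) ^ k * (q - l) ^ l \<le> (card P - k) ^ k * (card Q - l) ^ l"
    using assms by (intro mult_le_mono power_mono) auto
  also have "\<dots> \<le> (fact k * (card P choose k)) * (fact l * (card Q choose l))"
    by (intro mult_le_mono fact_binomial_ge)
  finally show ?thesis by (simp add: card_sel_indep[OF assms(1-3)] mult_ac)
qed

text \<open>The summands belong to the centres below x and to those in {x..<x + y}. Vertices from x
  + y on receive an arc from every vertex below x and send none, so they serve as out-leaves
  only.\<close>

lemma card_copies_bip:
  assumes xy: "x + y \<le> n" and gh: "h \<le> g" "g > 0" and s: "k + l \<ge> 2"
  shows "fact k * fact l * card (copies (bip n x y g h) {..<n} k l) \<ge>
     x * ((((n - x - y) + (g - h) * (y div g)) - k) ^ k * (h * (y div g) - l) ^ l)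
     + y * ((h * (x div g) - k) ^ k * ((g - h) * (x div g) - l) ^ l)"
proof -
  let ?E = "bip n x y g h"
  have dg: "digraph {..<n} ?E" using xy by (rule digraph_bip)
  have fin: "finite (outs ?E c)" "finite (ins ?E c)" for c
    using dg finite_subset[of "outs ?E c" "{..<n}"] finite_subset[of "ins ?E c" "{..<n}"]
    by (auto simp: digraph_def outs_def ins_def)
  have "card (copies ?E {..<n} k l) = card (stars ?E {..<n} k l)"
    using bij_betw_same_card[OF bij_betw_stars_copies[OF dg s]] by simp
  also have "\<dots> = (\<Sum>c<n. card (sel ?E k l (outs ?E c) (ins ?E c)))"
    unfolding stars_def by (rule card_SigmaI) (auto intro: finite_sel fin)
  finally have eq: "fact k * fact l * card (copies ?E {..<n} k l) = (\<Sum>c<n. fact k * fact l * card (sel ?E k l (outs ?E c) (ins ?E c)))"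
    by (simp add: sum_distrib_left)
  have A: "(((n - x - y) + (g - h) * (y div g)) - k) ^ k * (h * (y div g) - l) ^ l \<le> fact k * fact l * card (sel ?E k l (outs ?E c) (ins ?E c))"
    if c: "c < x" for c
  proof (rule fact_card_sel_ge[OF fin])
    have o: "outs ?E c = {j \<in> {x..<x + y}. \<not> (c + j) mod g < h} \<union> {x + y..<n}"
      using c xy by (auto simp: outs_def bip_def)
    have i: "ins ?E c = {j \<in> {x..<x + y}. (c + j) mod g < h}"
      using c xy by (auto simp: ins_def bip_def)
    show "indep ?E (outs ?E c \<union> ins ?E c)" unfolding o i using xy by (intro bip_indep(2)) auto
    show "h * (y div g) \<le> card (ins ?E c)" unfolding i by (rule card_residues_ge[OF gh])
    have "card (outs ?E c) = card {j \<in> {x..<x + y}. \<not> (c + j) mod g < h} + card {x + y..<n}"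
      unfolding o by (intro card_Un_disjoint) auto
    then show "(n - x - y) + (g - h) * (y div g) \<le> card (outs ?E c)"
      using card_non_residues_ge[OF gh, of y x c] by simp
  qed
  have B: "(h * (x div g) - k) ^ k * ((g - h) * (x div g) - l) ^ l \<le> fact k * fact l * card (sel ?E k l (outs ?E c) (ins ?E c))"
    if c: "x \<le> c" "c < x + y" for c
  proof (rule fact_card_sel_ge[OF fin])
    have o: "outs ?E c = {i \<in> {0..<0 + x}. (c + i) mod g < h}"
      using c xy by (auto simp: outs_def bip_def add.commute)
    have i: "ins ?E c = {i \<in> {0..<0 + x}. \<not> (c + i) mod g < h}"
      using c xy by (auto simp: ins_def bip_def add.commute)
    show "indep ?E (outs ?E c \<union> ins ?E c)" unfolding o i by (intro bip_indep(1)) auto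
    show "h * (x div g) \<le> card (outs ?E c)" unfolding o by (rule card_residues_ge[OF gh])
    show "(g - h) * (x div g) \<le> card (ins ?E c)" unfolding i by (rule card_non_residues_ge[OF gh])
  qed
  have "(\<Sum>c\<in>{..<x} \<union> {x..<x + y}. fact k * fact l * card (sel ?E k l (outs ?E c) (ins ?E c))) \<le>
      (\<Sum>c<n. fact k * fact l * card (sel ?E k l (outs ?E c) (ins ?E c)))"
    using xy by (intro sum_mono2) auto
  moreover have "(\<Sum>c\<in>{..<x} \<union> {x..<x + y}. fact k * fact l * card (sel ?E k l (outs ?E c) (ins ?E c))) =
      (\<Sum>c<x. fact k * fact l * card (sel ?E k l (outs ?E c) (ins ?E c))) + (\<Sum>c\<in>{x..<x + y}. fact k * fact l * card (sel ?E k l (outs ?E c) (ins ?E c)))"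
    by (intro sum.union_disjoint) auto
  moreover have "(\<Sum>c<x. fact k * fact l * card (sel ?E k l (outs ?E c) (ins ?E c))) \<ge>
      of_nat (card {..<x}) * ((((n - x - y) + (g - h) * (y div g)) - k) ^ k * (h * (y div g) - l) ^ l)"
    using A by (intro sum_bounded_below) auto
  moreover have "(\<Sum>c\<in>{x..<x + y}. fact k * fact l * card (sel ?E k l (outs ?E c) (ins ?E c))) \<ge>
      of_nat (card {x..<x + y}) * ((h * (x div g) - k) ^ k * ((g - h) * (x div g) - l) ^ l)"
    using B by (intro sum_bounded_below) auto
  ultimately show ?thesis unfolding eq by simp
qed

section \<open>Normalized maximum and the limit of the constructions\<close>

definition maxcopies :: "nat \<Rightarrow> nat \<Rightarrow> nat \<Rightarrow> nat" where
  "maxcopies k l n = Max {card (copies E {..<n} k l) | E. digraph {..<n} E}"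

lemma finite_digraphs: "finite {E. digraph {..<n} E}"
  by (rule finite_subset[of _ "Pow ({..<n} \<times> {..<n})"]) (auto simp: digraph_def)

lemma maxcopies_set: "finite {card (copies E {..<n} k l) | E. digraph {..<n} E}"
  "{card (copies E {..<n} k l) | E. digraph {..<n} E} \<noteq> {}"
proof -
  show "finite {card (copies E {..<n} k l) | E. digraph {..<n} E}"
    using finite_imageI[OF finite_digraphs[of n], of "\<lambda>E. card (copies E {..<n} k l)"]
    by (simp add: image_Collect)
  have "digraph {..<n} {}" by (simp add: digraph_def)
  then show "{card (copies E {..<n} k l) | E. digraph {..<n} E} \<noteq> {}" by blast
qed

lemma maxcopies_ge: "digraph {..<n} E \<Longrightarrow> card (copies E {..<n} k l) \<le> maxcopies k l n"
  unfolding maxcopies_def using maxcopies_set by (intro Max_ge) auto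

lemma maxcopies_attained: "\<exists>E. digraph {..<n} E \<and> card (copies E {..<n} k l) = maxcopies k l n"
proof -
  have "maxcopies k l n \<in> {card (copies E {..<n} k l) | E. digraph {..<n} E}"
    unfolding maxcopies_def by (rule Max_in[OF maxcopies_set])
  then show ?thesis by auto
qed

text \<open>The value of T in an extremal digraph with weight 1/n. The binomial coefficient returns
  only in \<open>ind_density_limit\<close>.\<close>

definition dens :: "nat \<Rightarrow> nat \<Rightarrow> nat \<Rightarrow> real" where
  "dens k l n = fact k * fact l * maxcopies k l n / real n ^ (k + l + 1)"

lemma frac_floor_limit:
  fixes \<alpha> :: real
  shows "(\<lambda>n. real (nat \<lfloor>\<alpha> * real n\<rfloor>) / real n) \<longlonglongrightarrow> max 0 \<alpha>"
proof (cases "\<alpha> \<ge> 0")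
  case True
  have "(\<lambda>n. \<alpha> - 1 / real n) \<longlonglongrightarrow> \<alpha> - 0" by (intro tendsto_intros lim_1_over_n)
  then have 1: "(\<lambda>n. \<alpha> - 1 / real n) \<longlonglongrightarrow> \<alpha>" by simp
  have "(\<lambda>n. real (nat \<lfloor>\<alpha> * real n\<rfloor>) / real n) \<longlonglongrightarrow> \<alpha>"
  proof (rule tendsto_sandwich[OF _ _ 1 tendsto_const])
    show "\<forall>\<^sub>F n in sequentially. \<alpha> - 1 / real n \<le> real (nat \<lfloor>\<alpha> * real n\<rfloor>) / real n"
    proof (rule eventually_sequentiallyI[of 1])
      fix n :: nat assume n: "1 \<le> n"
      have "\<alpha> * n - 1 \<le> real (nat \<lfloor>\<alpha> * real n\<rfloor>)" using True by linarith
      then have "(\<alpha> * n - 1) / n \<le> real (nat \<lfloor>\<alpha> * real n\<rfloor>) / n" by (intro divide_right_mono) auto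
      then show "\<alpha> - 1 / real n \<le> real (nat \<lfloor>\<alpha> * real n\<rfloor>) / real n" using n by (simp add: diff_divide_distrib)
    qed
    show "\<forall>\<^sub>F n in sequentially. real (nat \<lfloor>\<alpha> * real n\<rfloor>) / real n \<le> \<alpha>"
    proof (rule eventually_sequentiallyI[of 1])
      fix n :: nat assume n: "1 \<le> n"
      have "real (nat \<lfloor>\<alpha> * real n\<rfloor>) \<le> \<alpha> * n" using True by simp
      then show "real (nat \<lfloor>\<alpha> * real n\<rfloor>) / real n \<le> \<alpha>" using n by (simp add: divide_le_eq)
    qed
  qed
  then show ?thesis using True by simp
next
  case False
  then have "nat \<lfloor>\<alpha> * real n\<rfloor> = 0" for n
  proof -
    have "\<alpha> * real n \<le> 0" using False by (simp add: mult_nonpos_nonneg)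
    then show ?thesis by simp
  qed
  then show ?thesis using False by simp
qed

lemma div_limit:
  assumes "(\<lambda>n. real (f n) / real n) \<longlonglongrightarrow> c" "g > 0"
  shows "(\<lambda>n. real (f n div g) / real n) \<longlonglongrightarrow> c / real g"
proof (rule tendsto_sandwich)
  have "(\<lambda>n. real (f n) / real n / real g - 1 / real n) \<longlonglongrightarrow> c / real g - 0"
    by (intro tendsto_intros lim_1_over_n assms) (use assms in auto)
  then show "(\<lambda>n. real (f n) / real n / real g - 1 / real n) \<longlonglongrightarrow> c / real g" by simp
  show "(\<lambda>n. real (f n) / real n / real g) \<longlonglongrightarrow> c / real g"
    by (intro tendsto_intros assms) (use assms in auto)
  show "\<forall>\<^sub>F n in sequentially. real (f n) / real n / real g - 1 / real n \<le> real (f n div g) / real n"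
  proof (rule always_eventually, rule allI)
    fix n
    have "f n < g + (f n div g) * g" using assms(2) by (rule dividend_less_div_times)
    then have "real (f n) \<le> real (g + (f n div g) * g)" by (intro of_nat_mono) simp
    then have "real (f n) \<le> (1 + real (f n div g)) * real g" by (simp add: algebra_simps)
    then have "real (f n) / real g \<le> 1 + real (f n div g)" using assms(2) by (subst pos_divide_le_eq) auto
    then have "real (f n) / real g - 1 \<le> real (f n div g)" by linarith
    then have "(real (f n) / real g - 1) / real n \<le> real (f n div g) / real n" by (intro divide_right_mono) auto
    then show "real (f n) / real n / real g - 1 / real n \<le> real (f n div g) / real n" by (simp add: diff_divide_distrib mult.commute)
  qed
  show "\<forall>\<^sub>F n in sequentially. real (f n div g) / real n \<le> real (f n) / real n / real g"
  proof (rule always_eventually, rule allI)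
    fix n
    have "real (f n div g) / real n \<le> (real (f n) / real g) / real n"
      by (intro divide_right_mono of_nat_div_le_of_nat) auto
    then show "real (f n div g) / real n \<le> real (f n) / real n / real g" by (simp add: mult.commute)
  qed
qed

lemma sub_limit:
  assumes "(\<lambda>n. real (f n) / real n) \<longlonglongrightarrow> c"
  shows "(\<lambda>n. real (f n - k) / real n) \<longlonglongrightarrow> c"
proof (rule tendsto_sandwich)
  have "(\<lambda>n. real (f n) / real n - real k * (1 / real n)) \<longlonglongrightarrow> c - real k * 0"
    by (intro tendsto_intros lim_1_over_n assms)
  then show "(\<lambda>n. real (f n) / real n - real k * (1 / real n)) \<longlonglongrightarrow> c" by simp
  show "(\<lambda>n. real (f n) / real n) \<longlonglongrightarrow> c" by (rule assms)
  show "\<forall>\<^sub>F n in sequentially. real (f n) / real n - real k * (1 / real n) \<le> real (f n - k) / real n"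
    by (rule always_eventually) (simp add: diff_divide_distrib[symmetric] divide_right_mono)
  show "\<forall>\<^sub>F n in sequentially. real (f n - k) / real n \<le> real (f n) / real n"
    by (rule always_eventually) (simp add: divide_right_mono)
qed

text \<open>\<alpha> is the measure of the first part, \<gamma> the fraction of the second part that
  sends arcs back, and h/g the share of the first part that each of those vertices reaches. Rounding
  and the excluded k or l candidates disappear in the limit.\<close>

lemma dens_lower:
  fixes \<alpha> \<gamma> :: real and g h :: nat
  assumes \<alpha>: "0 \<le> \<alpha>" "\<alpha> \<le> 1" and \<gamma>: "0 \<le> \<gamma>" "\<gamma> \<le> 1" and gh: "h \<le> g" "g > 0" and s: "k + l \<ge> 2"
    and M: "M < \<alpha> * (((1 - \<alpha>) * (1 - \<gamma> * (real h / real g))) ^ k * ((1 - \<alpha>) * (\<gamma> * (real h / real g))) ^ l)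
      + \<gamma> * (1 - \<alpha>) * ((\<alpha> * (real h / real g)) ^ k * (\<alpha> * (1 - real h / real g)) ^ l)" (is "M < ?L")
  shows "\<forall>\<^sub>F n in sequentially. M < dens k l n"
proof -
  define x y where "x n = nat \<lfloor>\<alpha> * real n\<rfloor>" and "y n = nat \<lfloor>\<gamma> * (1 - \<alpha>) * real n\<rfloor>" for n :: nat
  have xy: "x n + y n \<le> n" for n
  proof -
    have "real (x n) \<le> \<alpha> * n" using \<alpha> by (simp add: x_def)
    moreover have "0 \<le> \<gamma> * (1 - \<alpha>)" using \<alpha> \<gamma> by simp
    then have "real (y n) \<le> \<gamma> * (1 - \<alpha>) * n" by (simp add: y_def)
    moreover have "\<gamma> * (1 - \<alpha>) * n \<le> 1 * (1 - \<alpha>) * n" using \<alpha> \<gamma> by (intro mult_right_mono) auto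
    ultimately have "real (x n) + real (y n) \<le> n" by (simp add: algebra_simps)
    then show ?thesis by linarith
  qed
  have lx: "(\<lambda>n. real (x n) / real n) \<longlonglongrightarrow> \<alpha>" using frac_floor_limit[of \<alpha>] \<alpha> by (simp add: x_def)
  have ly: "(\<lambda>n. real (y n) / real n) \<longlonglongrightarrow> \<gamma> * (1 - \<alpha>)"
    using frac_floor_limit[of "\<gamma> * (1 - \<alpha>)"] \<alpha> \<gamma> by (simp add: y_def)
  define p q p' q' where "p n = n - x n - y n + (g - h) * (y n div g)" and "q n = h * (y n div g)"
    and "p' n = h * (x n div g)" and "q' n = (g - h) * (x n div g)" for n
  have ldy: "(\<lambda>n. real (y n div g) / real n) \<longlonglongrightarrow> \<gamma> * (1 - \<alpha>) / real g" by (rule div_limit[OF ly gh(2)])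
  have ldx: "(\<lambda>n. real (x n div g) / real n) \<longlonglongrightarrow> \<alpha> / real g" by (rule div_limit[OF lx gh(2)])
  have gh': "real (g - h) = real g - real h" using gh by (simp add: of_nat_diff)
  have lq: "(\<lambda>n. real (q n) / real n) \<longlonglongrightarrow> (1 - \<alpha>) * (\<gamma> * (real h / real g))"
    using tendsto_mult[OF tendsto_const[of "real h"] ldy] by (simp add: q_def algebra_simps)
  have lp': "(\<lambda>n. real (p' n) / real n) \<longlonglongrightarrow> \<alpha> * (real h / real g)"
    using tendsto_mult[OF tendsto_const[of "real h"] ldx] by (simp add: p'_def algebra_simps)
  have lq': "(\<lambda>n. real (q' n) / real n) \<longlonglongrightarrow> \<alpha> * (1 - real h / real g)"
    using tendsto_mult[OF tendsto_const[of "real (g - h)"] ldx] gh by (simp add: q'_def gh' diff_divide_distrib right_diff_distrib algebra_simps)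
  have lp: "(\<lambda>n. real (p n) / real n) \<longlonglongrightarrow> (1 - \<alpha>) * (1 - \<gamma> * (real h / real g))"
  proof -
    have "(\<lambda>n. 1 - real (x n) / real n - real (y n) / real n + real (g - h) * (real (y n div g) / real n)) \<longlonglongrightarrow>
        1 - \<alpha> - \<gamma> * (1 - \<alpha>) + real (g - h) * (\<gamma> * (1 - \<alpha>) / real g)"
      by (intro tendsto_intros lx ly ldy)
    also have "1 - \<alpha> - \<gamma> * (1 - \<alpha>) + real (g - h) * (\<gamma> * (1 - \<alpha>) / real g) = (1 - \<alpha>) * (1 - \<gamma> * (real h / real g))"
      using gh by (simp add: gh' field_simps)
    finally show ?thesis
    proof (rule Lim_transform_eventually)
      show "\<forall>\<^sub>F n in sequentially. 1 - real (x n) / real n - real (y n) / real n + real (g - h) * (real (y n div g) / real n) = real (p n) / real n"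
      proof (rule eventually_sequentiallyI[of 1])
        fix n :: nat assume n: "1 \<le> n"
        have "real (p n) = real n - real (x n) - real (y n) + real (g - h) * real (y n div g)"
          using xy[of n] by (simp add: p_def of_nat_diff)
        then show "1 - real (x n) / real n - real (y n) / real n + real (g - h) * (real (y n div g) / real n) = real (p n) / real n"
          using n by (simp add: add_divide_distrib diff_divide_distrib)
      qed
    qed
  qed
  define f where "f n = real (x n) / real n * ((real (p n - k) / real n) ^ k * (real (q n - l) / real n) ^ l)
     + real (y n) / real n * ((real (p' n - k) / real n) ^ k * (real (q' n - l) / real n) ^ l)" for n
  have "f \<longlonglongrightarrow> ?L" unfolding f_def by (intro tendsto_intros lx ly sub_limit lp lq lp' lq')
  then have "\<forall>\<^sub>F n in sequentially. M < f n" using M by (rule order_tendstoD(1))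
  moreover have dn: "f n \<le> dens k l n" if n: "n \<ge> 1" for n
  proof -
    have "x n * ((p n - k) ^ k * (q n - l) ^ l) + y n * ((p' n - k) ^ k * (q' n - l) ^ l) \<le>
        fact k * fact l * card (copies (bip n (x n) (y n) g h) {..<n} k l)"
      using card_copies_bip[OF xy gh s, of n] by (simp add: p_def q_def p'_def q'_def)
    also have "\<dots> \<le> fact k * fact l * maxcopies k l n" using maxcopies_ge[OF digraph_bip[OF xy]] by simp
    finally have "real (x n * ((p n - k) ^ k * (q n - l) ^ l) + y n * ((p' n - k) ^ k * (q' n - l) ^ l)) \<le>
        real (fact k * fact l * maxcopies k l n)" by (rule of_nat_mono)
    then have "real (x n * ((p n - k) ^ k * (q n - l) ^ l) + y n * ((p' n - k) ^ k * (q' n - l) ^ l)) / real n ^ (k + l + 1) \<le> dens k l n"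
      unfolding dens_def by (intro divide_right_mono) auto
    also have "real (x n * ((p n - k) ^ k * (q n - l) ^ l) + y n * ((p' n - k) ^ k * (q' n - l) ^ l)) / real n ^ (k + l + 1) = f n"
      by (simp add: f_def power_divide power_add add_divide_distrib mult_ac)
    finally show ?thesis .
  qed
  have le: "M < f n \<and> 1 \<le> n \<Longrightarrow> M < dens k l n" for n using dn[of n] by linarith
  ultimately have "\<forall>\<^sub>F n in sequentially. M < f n \<and> 1 \<le> n"
    by (intro eventually_conj eventually_ge_at_top)
  then show ?thesis by (rule eventually_mono) (rule le)
qed

section \<open>The limit\<close>

context wdigraph
begin

text \<open>A star through v has v either as its centre or as a leaf, never both.\<close>

lemma cc_lf_copies:
  assumes s: "k + l \<ge> 2" and v: "v \<in> V"
  shows "cc k l v + lf k l v = r ^ (k + l) * (fact k * fact l) * card {X \<in> copies E V k l. v \<in> X}"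
proof -
  let ?S = "\<lambda>c. sel E k l (Out c) (In c)"
  have bij: "bij_betw verts (stars E V k l) (copies E V k l)" by (rule bij_betw_stars_copies[OF digraph s])
  have "bij_betw verts {F \<in> stars E V k l. v \<in> verts F} {X \<in> copies E V k l. v \<in> X}"
    by (rule bij_betw_subset[OF bij]) (use bij in \<open>auto simp: bij_betw_def\<close>)
  then have "card {X \<in> copies E V k l. v \<in> X} = card {F \<in> stars E V k l. v \<in> verts F}"
    by (rule bij_betw_same_card[symmetric])
  also have "{F \<in> stars E V k l. v \<in> verts F} = (SIGMA c:V. {F \<in> ?S c. v = c \<or> v \<in> fst F \<union> snd F})"
    by (auto simp: stars_def verts_def)
  also have "card \<dots> = (\<Sum>c\<in>V. card {F \<in> ?S c. v = c \<or> v \<in> fst F \<union> snd F})"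
    by (rule card_SigmaI) (auto intro: finite_subset[OF _ finite_sel])
  also have "\<dots> = (\<Sum>c\<in>V. (if v = c then card (?S v) else 0) + card {F \<in> ?S c. v \<in> fst F \<union> snd F})"
  proof (rule sum.cong[OF refl])
    fix c
    have "{F \<in> ?S v. v \<in> fst F \<union> snd F} = {}"
      using not_self[of v] by (auto simp: sel_def nb_def)
    then have "card {F \<in> ?S v. v \<in> fst F \<union> snd F} = 0" by (simp only: card.empty)
    then show "card {F \<in> ?S c. v = c \<or> v \<in> fst F \<union> snd F} = (if v = c then card (?S v) else 0) + card {F \<in> ?S c. v \<in> fst F \<union> snd F}"
      by (cases "v = c") (simp_all del: card_0_eq)
  qed
  also have "\<dots> = card (?S v) + (\<Sum>c\<in>V. card {F \<in> ?S c. v \<in> fst F \<union> snd F})"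
    using v by (simp add: sum.distrib)
  finally show ?thesis
    by (simp add: cc_def lf_def thr_def cnt_def W_def algebra_simps sum_distrib_left)
qed

lemma sum_cc_copies:
  assumes s: "k + l \<ge> 2"
  shows "(\<Sum>v\<in>V. r * cc k l v) = r ^ (k + l + 1) * (fact k * fact l) * card (copies E V k l)"
proof -
  have "card (copies E V k l) = card (stars E V k l)"
    using bij_betw_same_card[OF bij_betw_stars_copies[OF digraph s]] by simp
  also have "\<dots> = (\<Sum>c\<in>V. card (sel E k l (Out c) (In c)))"
    unfolding stars_def by (rule card_SigmaI) (auto intro: finite_sel)
  finally show ?thesis
    by (simp add: cc_def cnt_def W_def sum_distrib_left mult_ac)
qed

end

text \<open>Averaging the twin inequality over one of its two vertices bounds the deviation of each
  vertex from the mean by n^(s-1), that is by k! l!/n after normalization. \<open>err\<close> and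
  \<open>big\<close> let this fit the fixed tolerances of the locale.\<close>

lemma balanced_extremal:
  assumes kl: "l \<ge> 1" "k \<ge> l" "k + l \<ge> 6" and n: "n \<ge> 1"
    and dg: "digraph {..<n} E" and ext: "card (copies E {..<n} k l) = maxcopies k l n"
    and err: "fact k * fact l / real n \<le> kap k l * (1 / (real (k + l) + 1)) ^ (k + l)"
    and big: "kap k l * ww (k + l) + fact k * fact l / real n \<le> (real (k + l) + 1) * dens k l n"
  shows "balanced E {..<n} (1 / real n) k l (k + l) (dens k l n)"
proof -
  interpret wdigraph E "{..<n}" "1 / real n"
    using dg n by unfold_locales simp_all
  let ?V = "{..<n}"
  let ?s = "k + l" and ?N = "card (copies E {..<n} k l)"
  let ?d = "\<lambda>v. card {X \<in> copies E ?V k l. v \<in> X}"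
  have s2: "?s \<ge> 2" using kl by simp
  have T: "dens k l n = (1 / real n) ^ (?s + 1) * (fact k * fact l) * ?N"
    by (simp add: dens_def ext power_one_over divide_inverse power_inverse mult_ac)
  have sum: "(\<Sum>u\<in>?V. ?d u) = (?s + 1) * ?N" by (rule sum_card_copies) simp
  have near: "\<bar>cc k l v + lf k l v - (real ?s + 1) * dens k l n\<bar> \<le> fact k * fact l / real n" if v: "v \<in> ?V" for v
  proof -
    have pair: "?d u \<le> ?d w + n ^ (?s - 1)" if "u \<in> ?V" "w \<in> ?V" for u w
      using extremal_copies_degree[OF dg that(2,1), of k l] s2 maxcopies_ge[of n _ k l] by (simp add: ext)
    have "(\<Sum>u\<in>?V. ?d v) \<le> (\<Sum>u\<in>?V. ?d u + n ^ (?s - 1))" by (intro sum_mono pair v)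
    then have 1: "n * ?d v \<le> (?s + 1) * ?N + n * n ^ (?s - 1)" by (simp add: sum.distrib sum)
    have "(\<Sum>u\<in>?V. ?d u) \<le> (\<Sum>u\<in>?V. ?d v + n ^ (?s - 1))" by (intro sum_mono pair v)
    then have 2: "(?s + 1) * ?N \<le> n * ?d v + n * n ^ (?s - 1)" by (simp add: sum.distrib sum algebra_simps)
    have nn: "n * n ^ (?s - 1) = n ^ ?s" using s2 by (cases ?s) auto
    have "real (n * ?d v) \<le> real ((?s + 1) * ?N + n ^ ?s)" "real ((?s + 1) * ?N) \<le> real (n * ?d v + n ^ ?s)"
      using 1 2 unfolding nn by (simp_all only: of_nat_le_iff)
    then have abs: "\<bar>real n * ?d v - (real ?s + 1) * ?N\<bar> \<le> real n ^ ?s" by (simp add: abs_le_iff algebra_simps)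
    have "cc k l v + lf k l v - (real ?s + 1) * dens k l n =
        (1 / real n) ^ (?s + 1) * (fact k * fact l) * (real n * ?d v - (real ?s + 1) * ?N)"
      unfolding T cc_lf_copies[OF s2 v] using n by (simp add: field_simps)
    then have "\<bar>cc k l v + lf k l v - (real ?s + 1) * dens k l n\<bar> =
        (1 / real n) ^ (?s + 1) * (fact k * fact l) * \<bar>real n * ?d v - (real ?s + 1) * ?N\<bar>"
      by (simp add: abs_mult)
    also have "\<dots> \<le> (1 / real n) ^ (?s + 1) * (fact k * fact l) * real n ^ ?s"
      by (intro mult_left_mono abs) simp
    also have "\<dots> = fact k * fact l / real n" using n by (simp add: power_one_over field_simps)
    finally show ?thesis .
  qed
  have nonneg: "0 \<le> fact k * fact l / real n" by simp
  show ?thesis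
  proof unfold_locales
    show "dens k l n = (\<Sum>v\<in>?V. 1 / real n * cc k l v)" unfolding T sum_cc_copies[OF s2] ..
    show "kap k l * ww ?s \<le> (real ?s + 1) * dens k l n" using big nonneg by linarith
    show "kap k l * ww ?s \<le> cc k l v + lf k l v" if "v \<in> ?V" for v using near[OF that] big by linarith
    show "\<bar>cc k l v + lf k l v - (real ?s + 1) * dens k l n\<bar> \<le> kap k l * (1 / (real ?s + 1)) ^ ?s" if "v \<in> ?V" for v
      using near[OF that] err by linarith
  qed (use kl in auto)
qed

text \<open>By contradiction: a density above M supplies the lower bound on T that the locale asks
  for, and the strict inequality for M leaves room for the deviation of order 1/n.\<close>

lemma dens_upper:
  assumes kl: "l \<ge> 1" "k \<ge> l" "k + l \<ge> 6"
    and M: "kap k l * ww (k + l) < (real (k + l) + 1) * M"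
    and bal: "\<And>E V r T. balanced E V r k l (k + l) T \<Longrightarrow> T \<le> M"
  shows "\<forall>\<^sub>F n in sequentially. dens k l n \<le> M"
proof -
  have lim: "(\<lambda>n. fact k * fact l / real n) \<longlonglongrightarrow> 0"
    by (intro tendsto_divide_0[OF tendsto_const] filterlim_at_top_imp_at_infinity filterlim_real_sequentially)
  have "\<forall>\<^sub>F n in sequentially. fact k * fact l / real n < kap k l * (1 / (real (k + l) + 1)) ^ (k + l)"
    by (intro order_tendstoD(2)[OF lim] mult_pos_pos kap_pos) simp
  moreover have "\<forall>\<^sub>F n in sequentially. fact k * fact l / real n < (real (k + l) + 1) * M - kap k l * ww (k + l)"
    by (intro order_tendstoD(2)[OF lim]) (use M in simp)
  ultimately show ?thesis using eventually_ge_at_top[of 1]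
  proof eventually_elim
    case (elim n)
    show ?case
    proof (rule ccontr)
      assume "\<not> dens k l n \<le> M"
      then have M: "M < dens k l n" by simp
      then have M': "(real (k + l) + 1) * M \<le> (real (k + l) + 1) * dens k l n" by (intro mult_left_mono) auto
      obtain E where "digraph {..<n} E" "card (copies E {..<n} k l) = maxcopies k l n"
        using maxcopies_attained by blast
      then have "balanced E {..<n} (1 / real n) k l (k + l) (dens k l n)"
        using elim kl M' by (intro balanced_extremal) linarith+
      then show False using bal M by fastforce
    qed
  qed
qed

lemma ind_density_n_eq:
  "ind_density_n (star_V k l) (star_E k l) n = real (maxcopies k l n) / real (n choose (k + l + 1))"
proof -
  let ?f = "\<lambda>x. real x / real (n choose (k + l + 1))"
  have c: "card (star_V k l) = k + l + 1" by (simp add: star_V_def)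
  have "{ind_density (star_V k l) (star_E k l) {..<n} E |E. digraph {..<n} E} =
      ?f ` {card (copies E {..<n} k l) |E. digraph {..<n} E}"
    by (auto simp: ind_density_def copies_def c)
  moreover have "mono ?f" by (intro monoI divide_right_mono of_nat_mono) auto
  then have "?f (Max {card (copies E {..<n} k l) |E. digraph {..<n} E}) = Max (?f ` {card (copies E {..<n} k l) |E. digraph {..<n} E})"
    by (rule mono_Max_commute[OF _ maxcopies_set])
  ultimately show ?thesis by (simp add: ind_density_n_def maxcopies_def)
qed

lemma binomial_limit: "(\<lambda>n. real (n choose j) / real n ^ j) \<longlonglongrightarrow> 1 / fact j"
proof (rule tendsto_sandwich)
  have "(\<lambda>n. (real (n - j) / real n) ^ j / fact j) \<longlonglongrightarrow> 1 ^ j / fact j"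
    by (intro tendsto_intros sub_limit) (auto intro: Lim_transform_eventually[OF tendsto_const] eventually_sequentiallyI[of 1])
  then show "(\<lambda>n. (real (n - j) / real n) ^ j / fact j) \<longlonglongrightarrow> 1 / fact j" by simp
  show "\<forall>\<^sub>F n in sequentially. (real (n - j) / real n) ^ j / fact j \<le> real (n choose j) / real n ^ j"
  proof (rule always_eventually, rule allI)
    fix n
    have "real ((n - j) ^ j) \<le> real (fact j * (n choose j))" by (rule of_nat_mono[OF fact_binomial_ge])
    then have "real ((n - j) ^ j) / fact j / real n ^ j \<le> real (n choose j) / real n ^ j"
      by (intro divide_right_mono) (simp_all add: divide_le_eq mult.commute)
    then show "(real (n - j) / real n) ^ j / fact j \<le> real (n choose j) / real n ^ j" by (simp add: power_divide mult.commute)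
  qed
  show "\<forall>\<^sub>F n in sequentially. real (n choose j) / real n ^ j \<le> 1 / fact j"
  proof (rule always_eventually, rule allI)
    fix n
    have "real ((n choose j) * fact j) \<le> real (n ^ j)" by (rule of_nat_mono[OF binomial_fact_pow])
    then have "real (n choose j) / real n ^ j * fact j \<le> 1" by (auto simp: divide_le_eq_1)
    then show "real (n choose j) / real n ^ j \<le> 1 / fact j" by (subst pos_le_divide_eq) auto
  qed
qed simp

lemma ind_density_limit:
  assumes "dens k l \<longlonglongrightarrow> M"
  shows "(\<lambda>n. ind_density_n (star_V k l) (star_E k l) n) \<longlonglongrightarrow> fact (k + l + 1) / (fact k * fact l) * M"
proof -
  let ?j = "k + l + 1"
  have "(\<lambda>n. dens k l n / (fact k * fact l) / (real (n choose ?j) / real n ^ ?j)) \<longlonglongrightarrow> M / (fact k * fact l) / (1 / fact ?j)"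
    by (intro tendsto_intros assms binomial_limit) auto
  moreover have "\<forall>\<^sub>F n in sequentially. dens k l n / (fact k * fact l) / (real (n choose ?j) / real n ^ ?j) =
      ind_density_n (star_V k l) (star_E k l) n"
    by (rule eventually_sequentiallyI[of 1]) (simp add: ind_density_n_eq dens_def divide_simps)
  ultimately have "(\<lambda>n. ind_density_n (star_V k l) (star_E k l) n) \<longlonglongrightarrow> M / (fact k * fact l) / (1 / fact ?j)"
    by (rule Lim_transform_eventually)
  then show ?thesis by (simp add: mult.commute del: fact_Suc)
qed

definition star_obj :: "nat \<Rightarrow> nat \<Rightarrow> real \<Rightarrow> real \<Rightarrow> real" where
  "star_obj k l \<alpha> d = \<alpha> * (1 - \<alpha>) ^ (k + l) * d ^ k * (1 - d) ^ l + kap (k - 1) l * (1 - \<alpha>) * \<alpha> ^ (k + l) * (1 - d)"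

text \<open>x^a (1-x)^l increases up to a/(a+l), and the hypothesis places y there or below. AM-GM
  for the ratios x/y and (1-x)/(1-y) replaces the derivative.\<close>

lemma pow_mult_pow_mono:
  fixes x y :: real
  assumes "0 \<le> x" "x \<le> y" "0 < y" "y < 1" "a * (1 - y) \<ge> l * y" "a \<ge> 1" "l \<ge> 1"
  shows "x ^ a * (1 - x) ^ l \<le> y ^ a * (1 - y) ^ l"
proof -
  define p q where "p = x / y" and "q = (1 - x) / (1 - y)"
  have pq: "0 \<le> p" "0 \<le> q" using assms by (auto simp: p_def q_def)
  have "a * p + l * q = a + l - (y - x) * (a / y - l / (1 - y))"
    using assms by (simp add: p_def q_def field_simps)
  moreover have "a / y - l / (1 - y) \<ge> 0" using assms by (simp add: field_simps)
  ultimately have le: "a * p + l * q \<le> real (a + l)" using assms by (auto intro: mult_nonneg_nonneg)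
  have "(a * p) ^ a * (l * q) ^ l \<le> kap a l * (a * p + l * q) ^ (a + l)"
    using pq by (intro pow_mult_pow_le_kap) auto
  also have "\<dots> \<le> kap a l * real (a + l) ^ (a + l)"
    using le pq kap_pos[of a l] by (intro mult_left_mono power_mono) auto
  also have "\<dots> = real a ^ a * real l ^ l" using assms by (simp add: kap_def)
  finally have "(real a ^ a * real l ^ l) * (p ^ a * q ^ l) \<le> (real a ^ a * real l ^ l) * 1"
    by (simp add: power_mult_distrib mult_ac)
  then have "p ^ a * q ^ l \<le> 1" by (rule mult_left_le_imp_le) (use assms in simp)
  moreover have "p ^ a * q ^ l = (x ^ a * (1 - x) ^ l) / (y ^ a * (1 - y) ^ l)"
    by (simp add: p_def q_def power_divide)
  moreover have "0 < y ^ a * (1 - y) ^ l" using assms by simp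
  ultimately show ?thesis by (simp add: pos_divide_le_eq)
qed

lemma half_power_bound: "s \<ge> 6 \<Longrightarrow> (real s + 1) * (1 / 2) ^ (s + 1) \<le> 7 / 128"
proof (induction s rule: nat_induct_at_least)
  case base
  show ?case by (simp add: power_numeral_reduce)
next
  case (Suc s)
  have "(real (Suc s) + 1) * (1 / 2) ^ (Suc s + 1) = ((real s + 2) / 2) * (1 / 2) ^ (s + 1)" by (simp add: algebra_simps)
  also have "\<dots> \<le> (real s + 1) * (1 / 2) ^ (s + 1)" by (intro mult_right_mono) auto
  finally show ?case using Suc by linarith
qed

section \<open>The case k > l\<close>

context
  fixes k l s :: nat
  assumes kl: "l \<ge> 1" "k \<ge> l + 1" "k + l \<ge> 6" and s: "s = k + l"
begin

lemma reals: "real s = real k + real l" "real (s - 1) = real s - 1" "real (k - 1) = real k - 1" "real k \<ge> real l + 1"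
    "real l \<ge> 1" "real s \<ge> 6"
  using kl s by (simp_all add: of_nat_diff)

text \<open>At this point the first term alone gives equality; the positive second term provides the
  strictness required by \<open>dens_upper\<close>.\<close>

lemma star_obj_special: "(real s + 1) * star_obj k l (1 / (real s + 1)) (k / s) > kap k l * ww s"
proof -
  define x where "x = 1 / (real s + 1)"
  have x: "0 < x" "x < 1" "(real s + 1) * x = 1" "1 - x = s / (real s + 1)"
    using reals by (auto simp: x_def field_simps)
  have e: "1 - k / s = l / s" using reals by (simp add: field_simps)
  have "(k / s) ^ k * (1 - k / s) ^ l = kap k l"
    unfolding e by (simp add: kap_def s power_divide power_add)
  moreover have "(1 - x) ^ s = ww s" unfolding x(4) ww_def ..
  ultimately have "star_obj k l x (k / s) = x * (kap k l * ww s) + kap (k - 1) l * (1 - x) * x ^ s * (1 - k / s)"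
    by (simp add: star_obj_def s mult_ac)
  moreover have "0 < kap (k - 1) l * (1 - x) * x ^ s * (1 - k / s)"
    using x reals kap_pos[of "k - 1" l] e by (intro mult_pos_pos) auto
  ultimately have "(real s + 1) * x * (kap k l * ww s) < (real s + 1) * star_obj k l x (k / s)"
    unfolding mult.assoc by (intro mult_strict_left_mono) auto
  then show ?thesis unfolding x(3) by (simp add: x_def)
qed

text \<open>Each vertex of the second part that sends arcs back has out-share (k-1)/(s-1), where the
  tangent from the origin touches x^k (1-x)^l. The fraction \<gamma> of such vertices makes the
  in-share of the first part equal to 1 - d, and \<gamma> \<le> 1 amounts to l/(s-1) \<le>
  d.\<close>

lemma star_obj_dens_lower:
  assumes \<alpha>: "0 \<le> \<alpha>" "\<alpha> \<le> 1" and d: "l / (real s - 1) \<le> d" "d \<le> 1" and M: "M < star_obj k l \<alpha> d"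
  shows "\<forall>\<^sub>F n in sequentially. M < dens k l n"
proof (rule dens_lower[of \<alpha> "(1 - d) * (real s - 1) / (real k - 1)" "k - 1" "s - 1"])
  let ?\<gamma> = "(1 - d) * (real s - 1) / (real k - 1)" and ?\<rho> = "real (k - 1) / real (s - 1)"
  have "l \<le> d * (real s - 1)" using d(1) reals by (simp add: divide_le_eq)
  then have "(1 - d) * (real s - 1) \<le> real k - 1" using reals by (simp add: algebra_simps)
  then show "?\<gamma> \<le> 1" using reals by (simp add: divide_le_eq_1)
  show "0 \<le> ?\<gamma>" using d reals by simp
  show "k - 1 \<le> s - 1" "0 < s - 1" "2 \<le> k + l" using kl s by auto
  have \<gamma>: "?\<gamma> * ?\<rho> = 1 - d" unfolding reals(2,3) using reals(4,5,6) by simp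
  have "1 - ?\<rho> = l / real (s - 1)" using reals by (simp add: field_simps)
  then have "?\<rho> ^ (k - 1) * (1 - ?\<rho>) ^ l = kap (k - 1) l"
    using kl by (simp add: kap_def s power_divide power_add[symmetric] of_nat_diff)
  moreover have "?\<rho> ^ k = ?\<rho> * ?\<rho> ^ (k - 1)" using kl by (cases k) auto
  ultimately have e: "?\<gamma> * (?\<rho> ^ k * (1 - ?\<rho>) ^ l) = (?\<gamma> * ?\<rho>) * kap (k - 1) l" by (simp only: mult.assoc)
  have h: "\<gamma> * (1 - \<alpha>) * ((\<alpha> * \<rho>) ^ k * (\<alpha> * (1 - \<rho>)) ^ l) = (\<gamma> * (\<rho> ^ k * (1 - \<rho>) ^ l)) * (1 - \<alpha>) * \<alpha> ^ (k + l)" for \<gamma> \<rho> :: real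
    by (simp add: power_mult_distrib power_add mult_ac)
  have "?\<gamma> * (1 - \<alpha>) * ((\<alpha> * ?\<rho>) ^ k * (\<alpha> * (1 - ?\<rho>)) ^ l) = kap (k - 1) l * (1 - \<alpha>) * \<alpha> ^ (k + l) * (1 - d)"
    unfolding h e \<gamma> by simp
  moreover have "\<alpha> * (((1 - \<alpha>) * d) ^ k * ((1 - \<alpha>) * (1 - d)) ^ l) = \<alpha> * (1 - \<alpha>) ^ (k + l) * d ^ k * (1 - d) ^ l"
    by (simp add: power_mult_distrib power_add mult_ac)
  ultimately show "M < \<alpha> * (((1 - \<alpha>) * (1 - ?\<gamma> * ?\<rho>)) ^ k * ((1 - \<alpha>) * (?\<gamma> * ?\<rho>)) ^ l)
      + ?\<gamma> * (1 - \<alpha>) * ((\<alpha> * ?\<rho>) ^ k * (\<alpha> * (1 - ?\<rho>)) ^ l)"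
    using M unfolding \<gamma> star_obj_def by (simp only: diff_diff_eq2 add_diff_cancel_left')
qed (use \<alpha> in auto)

lemma d0_le: "l / (real s - 1) \<le> k / s"
proof -
  have "real l * s \<le> (real k - 1) * s" using reals by (intro mult_right_mono) auto
  also have "\<dots> \<le> k * (real s - 1)" using reals by (simp add: algebra_simps)
  finally show ?thesis using reals by (simp add: field_simps)
qed

text \<open>For smaller d the construction would need \<gamma> > 1. There d^k (1-d)^l lies below its
  chord from 0 to d0 = l/(s-1), since x^(k-1) (1-x)^l still increases; so the objective is at most a
  convex combination of its values at 0 and d0. The value at d = 0 is small because \<alpha> \<le>
  1/2.\<close>

lemma star_obj_le_max:
  assumes \<alpha>: "0 \<le> \<alpha>" "\<alpha> \<le> 1 / 2" and d: "0 \<le> d" "d \<le> l / (real s - 1)"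
  shows "star_obj k l \<alpha> d \<le> max (star_obj k l \<alpha> (l / (real s - 1))) (star_obj k l (1 / (real s + 1)) (k / s))"
proof -
  define d0 where "d0 = l / (real s - 1)"
  define t where "t = d / d0"
  define c where "c = kap (k - 1) l * (1 - \<alpha>) * \<alpha> ^ s"
  have d0: "0 < d0" "d0 < 1" "1 - d0 = (real k - 1) / (real s - 1)" using reals by (auto simp: d0_def field_simps)
  have t: "0 \<le> t" "t \<le> 1" "d = t * d0" using d d0 by (auto simp: t_def d0_def[symmetric])
  have "real l * d0 \<le> (k - 1) * (1 - d0)"
  proof -
    have "l * (l / (real s - 1)) \<le> (real k - 1) * ((real k - 1) / (real s - 1))"
      using reals by (intro mult_mono divide_right_mono) auto
    then show ?thesis unfolding d0(3) using reals by (simp add: d0_def)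
  qed
  then have "d ^ (k - 1) * (1 - d) ^ l \<le> d0 ^ (k - 1) * (1 - d0) ^ l"
    using d d0 kl by (intro pow_mult_pow_mono) (auto simp: d0_def)
  then have le: "d * (d ^ (k - 1) * (1 - d) ^ l) \<le> d * (d0 ^ (k - 1) * (1 - d0) ^ l)"
    by (rule mult_left_mono) (rule d)
  have "d * d ^ (k - 1) = d ^ k" "d0 * d0 ^ (k - 1) = d0 ^ k" using kl by (cases k; simp)+
  then have e: "d * (d ^ (k - 1) * (1 - d) ^ l) = d ^ k * (1 - d) ^ l"
    "d * (d0 ^ (k - 1) * (1 - d0) ^ l) = t * (d0 ^ k * (1 - d0) ^ l)"
    using t(3) by (metis mult.assoc)+
  have "d ^ k * (1 - d) ^ l \<le> t * (d0 ^ k * (1 - d0) ^ l)" using le unfolding e .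
  then have "\<alpha> * (1 - \<alpha>) ^ s * (d ^ k * (1 - d) ^ l) \<le> \<alpha> * (1 - \<alpha>) ^ s * (t * (d0 ^ k * (1 - d0) ^ l))"
    using \<alpha> by (intro mult_left_mono) auto
  then have "star_obj k l \<alpha> d \<le> t * star_obj k l \<alpha> d0 + (1 - t) * c"
    by (simp add: star_obj_def s[symmetric] c_def t(3) algebra_simps)
  also have "\<dots> \<le> t * max (star_obj k l \<alpha> d0) c + (1 - t) * max (star_obj k l \<alpha> d0) c"
    using t by (intro add_mono mult_left_mono) auto
  also have "\<dots> = max (star_obj k l \<alpha> d0) c" by (simp add: algebra_simps)
  finally have 1: "star_obj k l \<alpha> d \<le> max (star_obj k l \<alpha> d0) c" .
  have kp: "kap (k - 1) l \<le> (109/20) * kap k l"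
  proof -
    have "k * kap (k - 1) l \<le> real s * ee s * kap k l" using kap_out[of k l] kl s by simp
    also have "\<dots> \<le> (2 * real k) * (109/40) * kap k l"
      using reals ee_le[of s] ee_nonneg[of s] kap_pos[of k l] by (intro mult_right_mono mult_mono) auto
    finally have "k * kap (k - 1) l \<le> k * ((109/20) * kap k l)" by simp
    then show ?thesis by (rule mult_left_le_imp_le) (use reals in simp)
  qed
  have pw: "(1 - \<alpha>) * \<alpha> ^ s \<le> (1 / 2) ^ (s + 1)"
  proof -
    have "(1 - \<alpha>) * \<alpha> = 1 / 4 - (\<alpha> - 1 / 2) ^ 2" by (simp add: power2_eq_square algebra_simps)
    then have "(1 - \<alpha>) * \<alpha> \<le> 1 / 4" by simp
    moreover have "\<alpha> ^ (s - 1) \<le> (1 / 2) ^ (s - 1)" using \<alpha> by (intro power_mono)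
    ultimately have "((1 - \<alpha>) * \<alpha>) * \<alpha> ^ (s - 1) \<le> 1 / 4 * (1 / 2) ^ (s - 1)"
      using \<alpha> by (intro mult_mono) auto
    then show ?thesis using reals by (cases s) auto
  qed
  have "(real s + 1) * c = (real s + 1) * (kap (k - 1) l * ((1 - \<alpha>) * \<alpha> ^ s))" by (simp add: c_def)
  also have "\<dots> \<le> (real s + 1) * ((109/20) * kap k l * (1 / 2) ^ (s + 1))"
    using \<alpha> kp pw kap_pos[of k l] by (intro mult_left_mono mult_mono) auto
  also have "\<dots> = (109/20) * kap k l * ((real s + 1) * (1 / 2) ^ (s + 1))" by simp
  also have "\<dots> \<le> (109/20) * kap k l * (7 / 128)"
    using half_power_bound[of s] kap_pos[of k l] reals by (intro mult_left_mono) auto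
  also have "\<dots> \<le> kap k l * (367/1000)" using kap_pos[of k l] by simp
  also have "\<dots> \<le> kap k l * ww s" using ww_ge[of s] kap_pos[of k l] reals by (intro mult_left_mono) auto
  also have "\<dots> \<le> (real s + 1) * star_obj k l (1 / (real s + 1)) (k / s)" using star_obj_special by simp
  finally have "c \<le> star_obj k l (1 / (real s + 1)) (k / s)" by (rule mult_left_le_imp_le) simp
  then show ?thesis using 1 unfolding d0_def by linarith
qed

lemma star_obj_dens_lower':
  assumes \<alpha>: "0 \<le> \<alpha>" "\<alpha> \<le> 1 / 2" and d: "0 \<le> d" "d \<le> k / s" and M: "M < star_obj k l \<alpha> d"
  shows "\<forall>\<^sub>F n in sequentially. M < dens k l n"
proof (cases "l / (real s - 1) \<le> d")
  case True
  have "k / s \<le> 1" using reals by simp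
  then show ?thesis using assms True by (intro star_obj_dens_lower[of \<alpha> d]) auto
next
  case False
  then have "M < star_obj k l \<alpha> (l / (real s - 1)) \<or> M < star_obj k l (1 / (real s + 1)) (k / s)"
    using star_obj_le_max[OF \<alpha> d(1)] M by (simp add: le_max_iff_disj) linarith
  then show ?thesis
  proof
    assume "M < star_obj k l \<alpha> (l / (real s - 1))"
    then show ?thesis using \<alpha> reals by (intro star_obj_dens_lower[of \<alpha> "l / (real s - 1)"]) (auto simp: divide_le_eq)
  next
    assume "M < star_obj k l (1 / (real s + 1)) (k / s)"
    then show ?thesis using d0_le reals by (intro star_obj_dens_lower[of "1 / (real s + 1)" "k / s"]) auto
  qed
qed

lemma star_obj_bdd: "bdd_above ((\<lambda>(\<alpha>, d). star_obj k l \<alpha> d) ` ({0..1/2} \<times> {0..k / s}))"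
proof (rule bdd_aboveI2)
  fix x :: "real \<times> real"
  assume x: "x \<in> {0..1/2} \<times> {0..k / s}"
  obtain \<alpha> d where e: "x = (\<alpha>, d)" by (cases x)
  have "k / s \<le> 1" using reals by simp
  then have \<alpha>: "0 \<le> \<alpha>" "\<alpha> \<le> 1" and d: "0 \<le> d" "d \<le> 1" using x by (auto simp: e)
  have "\<alpha> * (1 - \<alpha>) ^ (k + l) * d ^ k * (1 - d) ^ l \<le> 1 * 1 * 1 * 1"
    using \<alpha> d by (intro mult_mono power_le_one) auto
  moreover have "kap (k - 1) l * (1 - \<alpha>) * \<alpha> ^ (k + l) * (1 - d) \<le> kap (k - 1) l * 1 * 1 * 1"
    using \<alpha> d kap_pos[of "k - 1" l] by (intro mult_mono power_le_one) auto
  ultimately show "(case x of (\<alpha>, d) \<Rightarrow> star_obj k l \<alpha> d) \<le> 1 + kap (k - 1) l"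
    by (simp add: e star_obj_def)
qed

lemma balanced_le_star_obj:
  assumes bal: "balanced E V r k l s T"
    and M: "\<And>\<alpha> d. 0 \<le> \<alpha> \<Longrightarrow> \<alpha> \<le> 1 / 2 \<Longrightarrow> 0 \<le> d \<Longrightarrow> d \<le> k / s \<Longrightarrow> star_obj k l \<alpha> d \<le> M"
  shows "T \<le> M"
proof -
  interpret balanced E V r k l s T by (rule bal)
  have "T \<le> (\<Sum>c\<in>A. r * (g c * b ^ s)) + kp * a ^ (s - 1) * (\<Sum>w\<in>A. r * q w)"
  proof (cases "l = 1")
    case True
    then interpret balanced1 E V r k l s T by unfold_locales
    show ?thesis by (rule T_le_gt_l1)
  next
    case False
    then show ?thesis using kl by (intro T_le_gt_l2) (use l1 in linarith)
  qed
  then show ?thesis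
  proof (rule T_le_obj)
    fix d assume d: "0 \<le> d" "d \<le> k / s"
    have "a \<le> 1 / 2" using X1 by simp
    then show "obj a d \<le> M" using M[OF a_nonneg _ d] unfolding obj_def star_obj_def kp_def s_def[symmetric] by blast
  qed
qed

lemma dens_limit_gt: "dens k l \<longlonglongrightarrow> (SUP (\<alpha>, d)\<in>{0..1/2} \<times> {0..k / s}. star_obj k l \<alpha> d)"
proof (rule order_tendstoI)
  let ?D = "{0..1/2} \<times> {0..k / s}" and ?f = "\<lambda>(\<alpha>, d). star_obj k l \<alpha> d"
  let ?M = "SUP x\<in>?D. ?f x"
  have up: "star_obj k l \<alpha> d \<le> ?M" if "0 \<le> \<alpha>" "\<alpha> \<le> 1 / 2" "0 \<le> d" "d \<le> k / s" for \<alpha> d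
    using cSUP_upper[OF _ star_obj_bdd, of "(\<alpha>, d)"] that by simp
  have ne: "?D \<noteq> ({} :: (real \<times> real) set)" by simp
  show "\<forall>\<^sub>F n in sequentially. M < dens k l n" if "M < ?M" for M
  proof -
    have "\<exists>x\<in>?D. M < ?f x" using that by (rule less_cSUP_iff[OF ne star_obj_bdd, THEN iffD1])
    then obtain x where x: "x \<in> ?D" "M < ?f x" by (rule bexE)
    obtain \<alpha> d where "x = (\<alpha>, d)" by (cases x)
    with x have "(\<alpha>, d) \<in> ?D" "M < star_obj k l \<alpha> d" by simp_all
    then show ?thesis by (intro star_obj_dens_lower'[of \<alpha> d]) auto
  qed
  have "\<forall>\<^sub>F n in sequentially. dens k l n \<le> ?M"
  proof (rule dens_upper)
    have "star_obj k l (1 / (real s + 1)) (k / s) \<le> ?M" using reals by (intro up) auto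
    then have "(real s + 1) * star_obj k l (1 / (real s + 1)) (k / s) \<le> (real s + 1) * ?M" by (intro mult_left_mono) auto
    then show "kap k l * ww (k + l) < (real (k + l) + 1) * ?M" using star_obj_special unfolding s by linarith
    show "T \<le> ?M" if "balanced E V r k l (k + l) T" for E V r T
      by (rule balanced_le_star_obj[OF that[folded s] up])
  qed (use kl in auto)
  then show "\<forall>\<^sub>F n in sequentially. dens k l n < M" if "?M < M" for M
    using that by (auto elim: eventually_mono)
qed

end

section \<open>The case k = l\<close>

lemma dens_limit_eq:
  assumes k: "k \<ge> 3"
  shows "dens k k \<longlonglongrightarrow> 1 / 2 ^ (2 * k) * (SUP a\<in>{0..1}. a * (1 - a) ^ (2 * k) + (1 - a) * a ^ (2 * k))"
proof (rule order_tendstoI)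
  let ?f = "\<lambda>a::real. a * (1 - a) ^ (2 * k) + (1 - a) * a ^ (2 * k)"
  let ?S = "SUP a\<in>{0..1}. ?f a"
  let ?M = "1 / 2 ^ (2 * k) * ?S"
  have bdd: "bdd_above (?f ` {0..1})"
  proof (rule bdd_aboveI2)
    fix a :: real assume a: "a \<in> {0..1}"
    then have "a * (1 - a) ^ (2 * k) \<le> 1 * 1" "(1 - a) * a ^ (2 * k) \<le> 1 * 1"
      by (intro mult_mono power_le_one; simp)+
    then show "?f a \<le> 2" by simp
  qed
  have up: "?f a \<le> ?S" if "0 \<le> a" "a \<le> 1" for a
    using that by (intro cSUP_upper[OF _ bdd]) auto
  have kap: "kap k k = 1 / 2 ^ (2 * k)"
    using k by (simp add: kap_def mult_2[symmetric] power_mult_distrib power_add[symmetric])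
  have ne: "{0..1::real} \<noteq> {}" by simp
  show "\<forall>\<^sub>F n in sequentially. M < dens k k n" if M: "M < ?M" for M
  proof -
    have "M * 2 ^ (2 * k) < ?S" using M by (simp add: field_simps)
    then obtain a where a: "a \<in> {0..1}" "M * 2 ^ (2 * k) < ?f a"
      using less_cSUP_iff[OF ne bdd] by auto
    have h: "((x::real) * (1 / 2)) ^ k * (x * (1 / 2)) ^ k = x ^ (2 * k) / 2 ^ (2 * k)" for x
      by (simp add: power_add[symmetric] mult_2[symmetric] power_divide)
    show ?thesis
    \<comment> \<open>All of the second part sends arcs back (\<gamma> = 1), and h/g = 1/2 is the
      optimal share for the centres on both sides.\<close>
    proof (rule dens_lower[of a 1 1 2])
      have "M < a * ((1 - a) ^ (2 * k) / 2 ^ (2 * k)) + 1 * (1 - a) * (a ^ (2 * k) / 2 ^ (2 * k))"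
        using a(2) by (simp add: field_simps)
      then show "M < a * (((1 - a) * (1 - 1 * (real 1 / real 2))) ^ k * ((1 - a) * (1 * (real 1 / real 2))) ^ k) +
          1 * (1 - a) * ((a * (real 1 / real 2)) ^ k * (a * (1 - real 1 / real 2)) ^ k)"
        unfolding h[symmetric] by simp
    qed (use a k in auto)
  qed
  have "\<forall>\<^sub>F n in sequentially. dens k k n \<le> ?M"
  proof (rule dens_upper)
    define x where "x = 1 / (real (k + k) + 1)"
    have x: "0 < x" "x < 1" "(real (k + k) + 1) * x = 1" "1 - x = real (k + k) / (real (k + k) + 1)"
      using k by (auto simp: x_def field_simps)
    have "(1 - x) ^ (2 * k) = ww (k + k)" unfolding x(4) ww_def mult_2 ..
    moreover have "0 < (1 - x) * x ^ (2 * k)" using x(1,2) by simp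
    ultimately have "?f x > x * ww (k + k)" by simp
    then have "?S > x * ww (k + k)" using up[of x] x by linarith
    then have "(real (k + k) + 1) * (x * ww (k + k)) < (real (k + k) + 1) * ?S" by (intro mult_strict_left_mono) auto
    then have "ww (k + k) < (real (k + k) + 1) * ?S" unfolding mult.assoc[symmetric] x(3) by simp
    then have "kap k k * ww (k + k) < kap k k * ((real (k + k) + 1) * ?S)" using kap_pos[of k k] by simp
    then show "kap k k * ww (k + k) < (real (k + k) + 1) * ?M" by (simp add: kap mult_ac)
    fix E V r T assume "balanced E V r k k (k + k) T"
    then interpret balanced E V r k k "k + k" T .
    have "T \<le> \<kappa> * ?f a" using T_le_eq k by (simp add: mult_2)
    also have "\<dots> \<le> \<kappa> * ?S" using up[OF a_nonneg a_le_1] kap_pos[of k k] by (intro mult_left_mono) (auto simp: \<kappa>_def)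
    finally show "T \<le> ?M" by (simp add: \<kappa>_def kap)
  qed (use k in auto)
  then show "\<forall>\<^sub>F n in sequentially. dens k k n < M" if "?M < M" for M
    using that by (auto elim: eventually_mono)
qed

theorem theorem1p1:
  fixes k l :: nat
  assumes "l \<ge> 1" and "k \<ge> l" and "k + l \<ge> 6"
  shows "(k = l \<longrightarrow>
           (\<lambda>n. ind_density_n (star_V k l) (star_E k l) n) \<longlonglongrightarrow>
             fact (2 * k + 1) / (2 ^ (2 * k) * (fact k) ^ 2) *
             (SUP a\<in>{0..1::real}. a * (1 - a) ^ (2 * k) + (1 - a) * a ^ (2 * k)))
       \<and> (k \<ge> l + 1 \<longrightarrow>
           (\<lambda>n. ind_density_n (star_V k l) (star_E k l) n) \<longlonglongrightarrow>
             fact (k + l + 1) / (fact k * fact l) *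
             (SUP (a, d)\<in>{0..1/2::real} \<times> {0..real k / real (k + l)}.
                a * (1 - a) ^ (k + l) * d ^ k * (1 - d) ^ l
                + (real (k - 1) ^ (k - 1) * real l ^ l / real (k + l - 1) ^ (k + l - 1))
                  * (1 - a) * a ^ (k + l) * (1 - d)))"
proof (intro conjI impI)
  assume "k = l"
  then have "k \<ge> 3" using assms by simp
  from ind_density_limit[OF dens_limit_eq[OF this]] \<open>k = l\<close>
  show "(\<lambda>n. ind_density_n (star_V k l) (star_E k l) n) \<longlonglongrightarrow>
             fact (2 * k + 1) / (2 ^ (2 * k) * (fact k) ^ 2) *
             (SUP a\<in>{0..1::real}. a * (1 - a) ^ (2 * k) + (1 - a) * a ^ (2 * k))"
    by (simp add: mult_2[symmetric] power2_eq_square mult_ac del: fact_Suc)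
next
  assume "k \<ge> l + 1"
  moreover have "k - 1 + l = k + l - 1" using assms by simp
  ultimately show "(\<lambda>n. ind_density_n (star_V k l) (star_E k l) n) \<longlonglongrightarrow>
             fact (k + l + 1) / (fact k * fact l) *
             (SUP (a, d)\<in>{0..1/2::real} \<times> {0..real k / real (k + l)}.
                a * (1 - a) ^ (k + l) * d ^ k * (1 - d) ^ l
                + (real (k - 1) ^ (k - 1) * real l ^ l / real (k + l - 1) ^ (k + l - 1))
                  * (1 - a) * a ^ (k + l) * (1 - d))"
    using ind_density_limit[OF dens_limit_gt[OF assms(1) _ assms(3) refl]]
    by (simp only: star_obj_def kap_def)
qed

end
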